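(* The category $\mathbf{SMon}$ of $\Sigma$-monoids and linear maps, with its symmetric monoidal closed structure (tensor product representing bilinear maps, unit $I$, internal hom $M\multimap N$), is a Lafont model of intuitionistic linear logic; that is, it is symmetric monoidal closed and the forgetful functor from the category of cocommutative comonoids in $(\mathbf{SMon},\otimes)$ to $\mathbf{SMon}$ has a right adjoint.
   Context: Conventions: $e\sqsubseteq e'$ means "if $e$ is defined then so is $e'$ and they are equal"; $e\simeq e'$ means both directions. A $\Sigma$-monoid $M$ is a set $|M|$ with $0$ and a partial operation $\sum:|M|^\omega\rightharpoonup|M|$ such that: (1) if $x_i=0$ for $i\ne j$ then $\sum_ix_i=x_j$; (2) for $I,J\subseteq\omega$ and bijection $\sigma:\omega\setminus I\to\omega\setminus J$, if $x_i=0$ ($i\in I$), $y_j=0$ ($j\in J$), $x_i=y_{\sigma(i)}$ ($i\notin I$), then $\sum_ix_i\simeq\sum_jy_j$; (3) $\sum_ix_i\simeq\sum_j\sum_kx_{\sigma(j,k)}$ for every bijection $\sigma:\omega\times\omega\to\omega$. Finite sums are obtained by padding with $0$. A linear map is $f:|M|\to|N|$ with $f(0)=0$ and $f(\sum_ix_i)\sqsubseteq\sum_if(x_i)$. $I$ is the $\Sigma$-monoid on $\{0,1\}$ in which a family has a sum iff at most one entry is $1$ (so $1+1$ is undefined). A bilinear map $M,N\to L$ is $f:|M|\times|N|\to|L|$ that is linear in each argument separately; the tensor product $M\otimes N$ represents bilinear maps. $M\multimap N$ is the $\Sigma$-monoid of linear maps with $\sum_if_i$ defined iff $\sum_if_i(x)$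 is defined for all $x$, and then computed pointwise. *)

theory Defs
  imports "HOL-Library.FuncSet"
begin

section \<open>Sigma-monoids and linear maps\<close>

text \<open>
  A partial sum is \<open>None\<close> when it is undefined, so Kleene equality of partial expressions is
  equality of options.  Objects are carried by subsets of HOL types; the collection of all
  Sigma-monoids ranges over all types, hence is not itself the value of an HOL term, and
  categorical statements about it are stated polymorphically in the types of the objects involved.
\<close>

record 'a smon =
  carr :: "'a set"
  zer :: 'a
  sm :: "(nat \<Rightarrow> 'a) \<Rightarrow> 'a option"

text \<open>The iterated sum is defined only if all inner sums and the outer sum are.\<close>

definition dsum :: "'a smon \<Rightarrow> (nat \<Rightarrow> nat \<Rightarrow> 'a) \<Rightarrow> 'a option" where
  "dsum M x =
     (if \<forall>j. sm M (x j) \<noteq> None then sm M (\<lambda>j. the (sm M (x j))) else None)"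

locale sigma_monoid =
  fixes M :: "'a smon"
  assumes zer_closed: "zer M \<in> carr M"
    and sm_partial: "\<And>x s. sm M x = Some s \<Longrightarrow> range x \<subseteq> carr M \<and> s \<in> carr M"
    and sm_single: "\<And>x j. range x \<subseteq> carr M \<Longrightarrow> (\<And>i. i \<noteq> j \<Longrightarrow> x i = zer M)
          \<Longrightarrow> sm M x = Some (x j)"
    and sm_reindex: "\<And>x y I J (\<sigma> :: nat \<Rightarrow> nat).
          range x \<subseteq> carr M \<Longrightarrow> range y \<subseteq> carr M \<Longrightarrow> bij_betw \<sigma> (- I) (- J)
          \<Longrightarrow> (\<And>i. i \<in> I \<Longrightarrow> x i = zer M) \<Longrightarrow> (\<And>j. j \<in> J \<Longrightarrow> y j = zer M)
          \<Longrightarrow> (\<And>i. i \<notin> I \<Longrightarrow> x i = y (\<sigma> i))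
          \<Longrightarrow> sm M x = sm M y"
    and sm_assoc: "\<And>x (\<sigma> :: nat \<times> nat \<Rightarrow> nat). range x \<subseteq> carr M \<Longrightarrow> bij \<sigma>
          \<Longrightarrow> sm M x = dsum M (\<lambda>j k. x (\<sigma> (j, k)))"

text \<open>Maps are extensional, so equal maps of Sigma-monoids are equal HOL functions.\<close>

definition linear_map :: "'a smon \<Rightarrow> 'b smon \<Rightarrow> ('a \<Rightarrow> 'b) \<Rightarrow> bool" where
  "linear_map M N f \<longleftrightarrow> f \<in> carr M \<rightarrow>\<^sub>E carr N \<and> f (zer M) = zer N \<and>
     (\<forall>x s. sm M x = Some s \<longrightarrow> sm N (f \<circ> x) = Some (f s))"

record ('a, 'b) arrow =
  src :: "'a smon"
  tgt :: "'b smon"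
  fn :: "'a \<Rightarrow> 'b"

definition Hom :: "'a smon \<Rightarrow> 'b smon \<Rightarrow> ('a, 'b) arrow set" where
  "Hom M N = {f. src f = M \<and> tgt f = N \<and> linear_map M N (fn f)}"

definition ident :: "'a smon \<Rightarrow> ('a, 'a) arrow" where
  "ident M = \<lparr>src = M, tgt = M, fn = (\<lambda>x\<in>carr M. x)\<rparr>"

definition arrow_comp :: "('b, 'c) arrow \<Rightarrow> ('a, 'b) arrow \<Rightarrow> ('a, 'c) arrow" (infixr "\<odot>" 65) where
  "g \<odot> f = \<lparr>src = src f, tgt = tgt g, fn = compose (carr (src f)) (fn g) (fn f)\<rparr>"

definition iso :: "'a smon \<Rightarrow> 'b smon \<Rightarrow> ('a, 'b) arrow \<Rightarrow> bool" where
  "iso M N f \<longleftrightarrow> f \<in> Hom M N \<and> (\<exists>g\<in>Hom N M. g \<odot> f = ident M \<and> f \<odot> g = ident N)"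

definition category_laws :: "'k smon \<Rightarrow> 'l smon \<Rightarrow> 'm smon \<Rightarrow> 'n smon \<Rightarrow> bool" where
  "category_laws K L M N \<longleftrightarrow>
     ident M \<in> Hom M M \<and>
     (\<forall>f\<in>Hom L M. \<forall>g\<in>Hom M N. g \<odot> f \<in> Hom L N) \<and>
     (\<forall>f\<in>Hom M N. f \<odot> ident M = f \<and> ident N \<odot> f = f) \<and>
     (\<forall>f\<in>Hom K L. \<forall>g\<in>Hom L M. \<forall>h\<in>Hom M N. h \<odot> (g \<odot> f) = (h \<odot> g) \<odot> f)"


section \<open>Unit, tensor product and internal hom\<close>

definition unitI :: "nat smon" where
  "unitI = \<lparr>carr = {0, 1}, zer = 0,
     sm = (\<lambda>x. if range x \<subseteq> {0, 1} \<and> (\<forall>i j. x i = 1 \<and> x j = 1 \<longrightarrow> i = j)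
               then Some (if \<exists>i. x i = 1 then 1 else 0) else None)\<rparr>"

definition bilinear :: "'a smon \<Rightarrow> 'b smon \<Rightarrow> 'c smon \<Rightarrow> ('a \<times> 'b \<Rightarrow> 'c) \<Rightarrow> bool" where
  "bilinear M N L b \<longleftrightarrow> b \<in> carr M \<times> carr N \<rightarrow>\<^sub>E carr L \<and>
     (\<forall>x\<in>carr M. linear_map N L (\<lambda>y\<in>carr N. b (x, y))) \<and>
     (\<forall>y\<in>carr N. linear_map M L (\<lambda>x\<in>carr M. b (x, y)))"

text \<open>\<open>t\<close> is a universal bilinear map among those into Sigma-monoids over the type \<open>'l\<close>.\<close>

definition represents_bilinear ::
  "'l itself \<Rightarrow> 'a smon \<Rightarrow> 'b smon \<Rightarrow> 't smon \<Rightarrow> ('a \<times> 'b \<Rightarrow> 't) \<Rightarrow> bool" where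
  "represents_bilinear _ M N T t \<longleftrightarrow>
     sigma_monoid T \<and> bilinear M N T t \<and>
     (\<forall>(L :: 'l smon) b. sigma_monoid L \<and> bilinear M N L b \<longrightarrow>
        (\<exists>!h. h \<in> Hom T L \<and> (\<forall>p\<in>carr M \<times> carr N. fn h (t p) = b p)))"

text \<open>
  Every element of a tensor product is a countable sum of pure tensors, so a tensor product
  can be realised on a set of classes of sequences of pairs.  The tensor product is an arbitrarily
  chosen representing object on that type, universal for targets over that same type.
  Universality for targets over every type is a theorem, not part of the definition.
\<close>

type_synonym ('a, 'b) tens = "(nat \<Rightarrow> 'a \<times> 'b) set"

definition tensor_choice ::
  "'a smon \<Rightarrow> 'b smon \<Rightarrow> ('a, 'b) tens smon \<times> ('a \<times> 'b \<Rightarrow> ('a, 'b) tens)" where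
  "tensor_choice M N =
     (SOME p. represents_bilinear TYPE(('a, 'b) tens) M N (fst p) (snd p))"

definition tensor :: "'a smon \<Rightarrow> 'b smon \<Rightarrow> ('a, 'b) tens smon" (infixr "\<otimes>" 70) where
  "M \<otimes> N = fst (tensor_choice M N)"

definition pure_tensor :: "'a smon \<Rightarrow> 'b smon \<Rightarrow> 'a \<times> 'b \<Rightarrow> ('a, 'b) tens" where
  "pure_tensor M N = snd (tensor_choice M N)"

definition tmap :: "('a, 'c) arrow \<Rightarrow> ('b, 'd) arrow \<Rightarrow> (('a, 'b) tens, ('c, 'd) tens) arrow"
    (infixr "\<otimes>\<^sub>m" 70) where
  "f \<otimes>\<^sub>m g = (THE h. h \<in> Hom (src f \<otimes> src g) (tgt f \<otimes> tgt g) \<and>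
     (\<forall>x\<in>carr (src f). \<forall>y\<in>carr (src g).
        fn h (pure_tensor (src f) (src g) (x, y)) = pure_tensor (tgt f) (tgt g) (fn f x, fn g y)))"

definition assoc :: "'l smon \<Rightarrow> 'm smon \<Rightarrow> 'n smon \<Rightarrow>
    ((('l, 'm) tens, 'n) tens, ('l, ('m, 'n) tens) tens) arrow" where
  "assoc L M N = (THE h. h \<in> Hom ((L \<otimes> M) \<otimes> N) (L \<otimes> (M \<otimes> N)) \<and>
     (\<forall>x\<in>carr L. \<forall>y\<in>carr M. \<forall>z\<in>carr N.
        fn h (pure_tensor (L \<otimes> M) N (pure_tensor L M (x, y), z)) = pure_tensor L (M \<otimes> N) (x, pure_tensor M N (y, z))))"

definition lunit :: "'m smon \<Rightarrow> ((nat, 'm) tens, 'm) arrow" where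
  "lunit M = (THE h. h \<in> Hom (unitI \<otimes> M) M \<and> (\<forall>x\<in>carr M. fn h (pure_tensor unitI M (1, x)) = x))"

definition runit :: "'m smon \<Rightarrow> (('m, nat) tens, 'm) arrow" where
  "runit M = (THE h. h \<in> Hom (M \<otimes> unitI) M \<and> (\<forall>x\<in>carr M. fn h (pure_tensor M unitI (x, 1)) = x))"

definition swap :: "'m smon \<Rightarrow> 'n smon \<Rightarrow> (('m, 'n) tens, ('n, 'm) tens) arrow" where
  "swap M N = (THE h. h \<in> Hom (M \<otimes> N) (N \<otimes> M) \<and>
     (\<forall>x\<in>carr M. \<forall>y\<in>carr N. fn h (pure_tensor M N (x, y)) = pure_tensor N M (y, x)))"

definition ihom :: "'a smon \<Rightarrow> 'b smon \<Rightarrow> ('a \<Rightarrow> 'b) smon" where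
  "ihom M N = \<lparr>carr = {f. linear_map M N f}, zer = (\<lambda>x\<in>carr M. zer N),
     sm = (\<lambda>F. if (\<forall>i. linear_map M N (F i)) \<and> (\<forall>x\<in>carr M. sm N (\<lambda>i. F i x) \<noteq> None)
               then Some (\<lambda>x\<in>carr M. the (sm N (\<lambda>i. F i x))) else None)\<rparr>"

definition ihom_map :: "'m smon \<Rightarrow> ('a, 'b) arrow \<Rightarrow> ('m \<Rightarrow> 'a, 'm \<Rightarrow> 'b) arrow" where
  "ihom_map M g = \<lparr>src = ihom M (src g), tgt = ihom M (tgt g),
     fn = (\<lambda>f\<in>carr (ihom M (src g)). compose (carr M) (fn g) f)\<rparr>"

definition curry_arrow ::
  "'l smon \<Rightarrow> 'm smon \<Rightarrow> (('l, 'm) tens, 'n) arrow \<Rightarrow> ('l, 'm \<Rightarrow> 'n) arrow" where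
  "curry_arrow L M f = \<lparr>src = L, tgt = ihom M (tgt f),
     fn = (\<lambda>z\<in>carr L. \<lambda>x\<in>carr M. fn f (pure_tensor L M (z, x)))\<rparr>"


section \<open>Symmetric monoidal closed structure\<close>

definition tensor_bifunctor ::
  "'m smon \<Rightarrow> 'm1 smon \<Rightarrow> 'm2 smon \<Rightarrow> 'n smon \<Rightarrow> 'n1 smon \<Rightarrow> 'n2 smon \<Rightarrow> bool" where
  "tensor_bifunctor M M' M'' N N' N'' \<longleftrightarrow>
     ident M \<otimes>\<^sub>m ident N = ident (M \<otimes> N) \<and>
     (\<forall>f\<in>Hom M M'. \<forall>g\<in>Hom N N'. f \<otimes>\<^sub>m g \<in> Hom (M \<otimes> N) (M' \<otimes> N')) \<and>
     (\<forall>f\<in>Hom M M'. \<forall>f'\<in>Hom M' M''. \<forall>g\<in>Hom N N'. \<forall>g'\<in>Hom N' N''.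
        (f' \<odot> f) \<otimes>\<^sub>m (g' \<odot> g) = (f' \<otimes>\<^sub>m g') \<odot> (f \<otimes>\<^sub>m g))"

definition structure_isos ::
  "'l smon \<Rightarrow> 'm smon \<Rightarrow> 'n smon \<Rightarrow> 'l1 smon \<Rightarrow> 'm1 smon \<Rightarrow> 'n1 smon \<Rightarrow> bool" where
  "structure_isos L M N L' M' N' \<longleftrightarrow>
     iso ((L \<otimes> M) \<otimes> N) (L \<otimes> (M \<otimes> N)) (assoc L M N) \<and>
     iso (unitI \<otimes> M) M (lunit M) \<and>
     iso (M \<otimes> unitI) M (runit M) \<and>
     iso (M \<otimes> N) (N \<otimes> M) (swap M N) \<and>
     (\<forall>f\<in>Hom L L'. \<forall>g\<in>Hom M M'. \<forall>h\<in>Hom N N'.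
        assoc L' M' N' \<odot> ((f \<otimes>\<^sub>m g) \<otimes>\<^sub>m h) = (f \<otimes>\<^sub>m (g \<otimes>\<^sub>m h)) \<odot> assoc L M N) \<and>
     (\<forall>f\<in>Hom M M'. lunit M' \<odot> (ident unitI \<otimes>\<^sub>m f) = f \<odot> lunit M) \<and>
     (\<forall>f\<in>Hom M M'. runit M' \<odot> (f \<otimes>\<^sub>m ident unitI) = f \<odot> runit M) \<and>
     (\<forall>f\<in>Hom M M'. \<forall>g\<in>Hom N N'. swap M' N' \<odot> (f \<otimes>\<^sub>m g) = (g \<otimes>\<^sub>m f) \<odot> swap M N)"

text \<open>Pentagon, triangle, hexagon and involutivity of the symmetry.\<close>

definition coherence :: "'k smon \<Rightarrow> 'l smon \<Rightarrow> 'm smon \<Rightarrow> 'n smon \<Rightarrow> bool" where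
  "coherence K L M N \<longleftrightarrow>
     assoc K L (M \<otimes> N) \<odot> assoc (K \<otimes> L) M N =
       (ident K \<otimes>\<^sub>m assoc L M N) \<odot> assoc K (L \<otimes> M) N \<odot> (assoc K L M \<otimes>\<^sub>m ident N) \<and>
     (ident M \<otimes>\<^sub>m lunit N) \<odot> assoc M unitI N = runit M \<otimes>\<^sub>m ident N \<and>
     assoc M N L \<odot> swap L (M \<otimes> N) \<odot> assoc L M N =
       (ident M \<otimes>\<^sub>m swap L N) \<odot> assoc M L N \<odot> (swap L M \<otimes>\<^sub>m ident N) \<and>
     swap N M \<odot> swap M N = ident (M \<otimes> N)"

text \<open>
  The functor \<open>ihom M\<close> is right adjoint to tensoring with \<open>M\<close>: currying is a bijection of hom-sets,
  natural in both arguments.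
\<close>

definition tensor_hom_adjunction ::
  "'l smon \<Rightarrow> 'l1 smon \<Rightarrow> 'm smon \<Rightarrow> 'n smon \<Rightarrow> 'n1 smon \<Rightarrow> 'n2 smon \<Rightarrow> bool" where
  "tensor_hom_adjunction L L' M N N' N'' \<longleftrightarrow>
     sigma_monoid (ihom M N) \<and>
     (\<forall>g\<in>Hom N N'. ihom_map M g \<in> Hom (ihom M N) (ihom M N')) \<and>
     ihom_map M (ident N) = ident (ihom M N) \<and>
     (\<forall>g\<in>Hom N N'. \<forall>g'\<in>Hom N' N''. ihom_map M (g' \<odot> g) = ihom_map M g' \<odot> ihom_map M g) \<and>
     bij_betw (curry_arrow L M) (Hom (L \<otimes> M) N) (Hom L (ihom M N)) \<and>
     (\<forall>u\<in>Hom L' L. \<forall>f\<in>Hom (L \<otimes> M) N. \<forall>v\<in>Hom N N'.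
        curry_arrow L' M (v \<odot> f \<odot> (u \<otimes>\<^sub>m ident M)) = ihom_map M v \<odot> curry_arrow L M f \<odot> u)"


section \<open>Cocommutative comonoids and the cofree comonoid\<close>

record 'a comonoid =
  und :: "'a smon"
  comult :: "('a, ('a, 'a) tens) arrow"
  counit :: "('a, nat) arrow"

definition cocomm_comonoid :: "'a comonoid \<Rightarrow> bool" where
  "cocomm_comonoid C \<longleftrightarrow> sigma_monoid (und C) \<and>
     comult C \<in> Hom (und C) (und C \<otimes> und C) \<and>
     counit C \<in> Hom (und C) unitI \<and>
     assoc (und C) (und C) (und C) \<odot> (comult C \<otimes>\<^sub>m ident (und C)) \<odot> comult C =
       (ident (und C) \<otimes>\<^sub>m comult C) \<odot> comult C \<and>
     lunit (und C) \<odot> (counit C \<otimes>\<^sub>m ident (und C)) \<odot> comult C = ident (und C) \<and>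
     runit (und C) \<odot> (ident (und C) \<otimes>\<^sub>m counit C) \<odot> comult C = ident (und C) \<and>
     swap (und C) (und C) \<odot> comult C = comult C"

text \<open>
  Comonoid morphisms are certain arrows of underlying Sigma-monoids, with their identities and
  composition; the forgetful functor is \<open>und\<close> on objects and the inclusion on morphisms.
\<close>

definition CHom :: "'a comonoid \<Rightarrow> 'b comonoid \<Rightarrow> ('a, 'b) arrow set" where
  "CHom C D = {f \<in> Hom (und C) (und D).
     comult D \<odot> f = (f \<otimes>\<^sub>m f) \<odot> comult C \<and> counit D \<odot> f = counit C}"

definition comonoid_category_laws ::
  "'a comonoid \<Rightarrow> 'b comonoid \<Rightarrow> 'c comonoid \<Rightarrow> bool" where
  "comonoid_category_laws C C' C'' \<longleftrightarrow>
     ident (und C) \<in> CHom C C \<and>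
     (\<forall>f\<in>CHom C C'. \<forall>g\<in>CHom C' C''. g \<odot> f \<in> CHom C C'')"

text \<open>
  \<open>d\<close> is a universal arrow from the forgetful functor to \<open>M\<close>, among comonoids over the type \<open>'c\<close>.
\<close>

definition cofree :: "'c itself \<Rightarrow> 'm smon \<Rightarrow> 'b comonoid \<Rightarrow> ('b, 'm) arrow \<Rightarrow> bool" where
  "cofree _ M B d \<longleftrightarrow> cocomm_comonoid B \<and> d \<in> Hom (und B) M \<and>
     (\<forall>C :: 'c comonoid. cocomm_comonoid C \<longrightarrow>
        (\<forall>f\<in>Hom (und C) M. \<exists>!g. g \<in> CHom C B \<and> d \<odot> g = f))"

text \<open>
  The chosen cofree comonoid lives on a type large enough to carry one.  Any element of a
  comonoid is in the image of a comonoid morphism from a comonoid \<open>D\<close> of at most continuum size,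
  so the elements of a cofree comonoid over \<open>M\<close> are classes of countable formal sums of triples
  (\<open>D\<close>, linear map from \<open>D\<close> to \<open>M\<close>, element of \<open>D\<close>).  As for the tensor product, the choice refers
  only to comonoids over this type; universality with respect to comonoids over every type is a
  theorem.
\<close>

type_synonym 'm bangt = "(nat \<Rightarrow> nat set comonoid \<times> (nat set \<Rightarrow> 'm) \<times> nat set) set"

definition bang_choice :: "'m smon \<Rightarrow> 'm bangt comonoid \<times> ('m bangt, 'm) arrow" where
  "bang_choice M = (SOME p. cofree TYPE('m bangt) M (fst p) (snd p))"

definition bang :: "'m smon \<Rightarrow> 'm bangt comonoid" where
  "bang M = fst (bang_choice M)"

definition der :: "'m smon \<Rightarrow> ('m bangt, 'm) arrow" where
  "der M = snd (bang_choice M)"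

definition bang_map :: "('m, 'n) arrow \<Rightarrow> ('m bangt, 'n bangt) arrow" where
  "bang_map f = (THE g. g \<in> CHom (bang (src f)) (bang (tgt f)) \<and>
     der (tgt f) \<odot> g = f \<odot> der (src f))"

text \<open>
  The functor \<open>bang\<close> is right adjoint to the forgetful functor: composition with \<open>der\<close> is a
  bijection from comonoid morphisms into \<open>bang M\<close> to linear maps into \<open>M\<close>, natural in both
  arguments.
\<close>

definition forgetful_bang_adjunction ::
  "'c comonoid \<Rightarrow> 'c1 comonoid \<Rightarrow> 'm smon \<Rightarrow> 'm1 smon \<Rightarrow> 'm2 smon \<Rightarrow> bool" where
  "forgetful_bang_adjunction C C' M M' M'' \<longleftrightarrow>
     cocomm_comonoid (bang M) \<and>
     (\<forall>f\<in>Hom M M'. bang_map f \<in> CHom (bang M) (bang M')) \<and>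
     bang_map (ident M) = ident (und (bang M)) \<and>
     (\<forall>f\<in>Hom M M'. \<forall>f'\<in>Hom M' M''. bang_map (f' \<odot> f) = bang_map f' \<odot> bang_map f) \<and>
     bij_betw (\<lambda>g. der M \<odot> g) (CHom C (bang M)) (Hom (und C) M) \<and>
     (\<forall>u\<in>CHom C' C. \<forall>g\<in>CHom C (bang M). \<forall>v\<in>Hom M M'.
        der M' \<odot> (bang_map v \<odot> g \<odot> u) = v \<odot> (der M \<odot> g) \<odot> u)"

end

theory Submission
  imports "HOL-Library.Countable_Set" "HOL-Library.Nat_Bijection" Defs
begin

text \<open>
  Countable formal sums of generators, modulo the least congruence that contains given relations
  and is compatible with regrouping, form a Sigma-monoid, because all closure conditions are Horn
  clauses.  The tensor product is presented in this way by pairs and the bilinearity relations;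
  induction on the congruence gives linear maps into Sigma-monoids over arbitrary types.

  A derivation of an equation in a tensor product involves only countably many elements.
  Closing a subset of a comonoid \<open>C\<close> under sums, entries of comultiplications and the elements of
  such derivations therefore gives a subcomonoid \<open>D\<close> for which \<open>D \<otimes> D\<close> and \<open>D \<otimes> (D \<otimes> D)\<close> embed into
  the corresponding powers of \<open>C\<close>, and \<open>D\<close> has at most continuum size if the subset does.
  The cofree comonoid over \<open>M\<close> is the colimit, formed in Sigma-monoids, of all comonoids of at most
  continuum size equipped with a linear map to \<open>M\<close>.  A linear map from \<open>C\<close> to \<open>M\<close> lifts along the small
  subcomonoids of \<open>C\<close>; the lift is well defined because any two of them lie in a third.
\<close>

subsection \<open>Countable families\<close>

text \<open>The obstacle is that tensoring need not preserve inclusions: sums of pure tensors over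
  \<open>D\<close> may become equal in \<open>C \<otimes> C\<close>, or become summable there, only
  through a derivation that leaves \<open>D\<close>. Without control over this the comultiplication
  of \<open>C\<close> need not restrict to \<open>D\<close>, and the laws of \<open>C\<close> need
  not be reflected to \<open>D\<close>. Adding the elements of the derivations cures both; the cube
  is treated like the square because the two sides of coassociativity take their values in it. The
  bound is the continuum because it is the least cardinal above 1 that is equal to its own countable
  power: countable families and well-founded countably branching trees over a set of that size are
  again no more numerous. Up to isomorphism all comonoids of that size are carried by subsets of
  \<open>nat set\<close>, so they are values of one HOL type and their colimit is a quotient of a
  set.\<close>

definition flat :: "(nat \<Rightarrow> nat \<Rightarrow> 'a) \<Rightarrow> nat \<Rightarrow> 'a" where
  "flat x = (\<lambda>n. case prod_decode n of (j, k) \<Rightarrow> x j k)"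

definition single :: "'a \<Rightarrow> 'a \<Rightarrow> nat \<Rightarrow> 'a" where
  "single z x = (\<lambda>i. if i = 0 then x else z)"

text \<open>Axiom \<open>sm_reindex\<close> with the exceptional sets fixed to be exactly the zero
  sets. By \<open>reindexI\<close> nothing is lost, and the relation becomes symmetric.\<close>

definition reindex :: "'a \<Rightarrow> (nat \<Rightarrow> 'a) \<Rightarrow> (nat \<Rightarrow> 'a) \<Rightarrow> bool" where
  "reindex z s t \<longleftrightarrow>
     (\<exists>\<sigma>. bij_betw \<sigma> {i. s i \<noteq> z} {j. t j \<noteq> z} \<and> (\<forall>i. s i \<noteq> z \<longrightarrow> t (\<sigma> i) = s i))"

lemma flat_encode [simp]: "flat x (prod_encode (j, k)) = x j k"
  by (simp add: flat_def)

lemma comp_flat: "f \<circ> flat x = flat (\<lambda>j. f \<circ> x j)"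
  by (auto simp: flat_def fun_eq_iff split: prod.split)

lemma range_flat: "range (flat x) = (\<Union>j. range (x j))"
proof
  show "range (flat x) \<subseteq> (\<Union>j. range (x j))"
    by (auto simp: flat_def split: prod.split) blast
  show "(\<Union>j. range (x j)) \<subseteq> range (flat x)"
  proof
    fix y assume "y \<in> (\<Union>j. range (x j))"
    then obtain j k where "y = flat x (prod_encode (j, k))" by auto
    then show "y \<in> range (flat x)" by blast
  qed
qed

lemma comp_single: "f \<circ> single z x = single (f z) (f x)"
  by (auto simp: single_def fun_eq_iff)

lemma single_0 [simp]: "single z x 0 = x"
  by (simp add: single_def)

lemma range_single: "range (single z x) = {x, z}"
  by (auto simp: single_def image_def intro: exI [of _ "Suc 0"])

lemma reindexI:
  assumes \<sigma>: "bij_betw \<sigma> I J" and "\<And>i. i \<notin> I \<Longrightarrow> s i = z" and J: "\<And>j. j \<notin> J \<Longrightarrow> t j = z"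
    and eq: "\<And>i. i \<in> I \<Longrightarrow> t (\<sigma> i) = s i"
  shows "reindex z s t"
proof -
  have sub: "{i. s i \<noteq> z} \<subseteq> I" using assms by auto
  have "\<sigma> ` {i. s i \<noteq> z} = {j. t j \<noteq> z}"
  proof
    show "\<sigma> ` {i. s i \<noteq> z} \<subseteq> {j. t j \<noteq> z}" using sub eq by force
    show "{j. t j \<noteq> z} \<subseteq> \<sigma> ` {i. s i \<noteq> z}"
    proof
      fix j assume j: "j \<in> {j. t j \<noteq> z}"
      then have "j \<in> J" using J by auto
      then obtain i where "i \<in> I" "j = \<sigma> i" using \<sigma> by (auto simp: bij_betw_def)
      with eq j show "j \<in> \<sigma> ` {i. s i \<noteq> z}" by force
    qed
  qed
  then have "bij_betw \<sigma> {i. s i \<noteq> z} {j. t j \<noteq> z}"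
    using bij_betw_subset [OF \<sigma> sub] by simp
  then show ?thesis unfolding reindex_def using eq sub by blast
qed

lemma reindex_range: "reindex z s t \<Longrightarrow> range t \<subseteq> insert z (range s)"
  unfolding reindex_def bij_betw_def by (auto simp: set_eq_iff image_iff) metis

lemma reindex_sym:
  assumes "reindex z s t"
  shows "reindex z t s"
proof -
  from assms obtain \<sigma> where \<sigma>: "bij_betw \<sigma> {i. s i \<noteq> z} {j. t j \<noteq> z}"
    and eq: "\<And>i. s i \<noteq> z \<Longrightarrow> t (\<sigma> i) = s i" by (auto simp: reindex_def)
  let ?\<rho> = "the_inv_into {i. s i \<noteq> z} \<sigma>"
  have \<rho>: "bij_betw ?\<rho> {j. t j \<noteq> z} {i. s i \<noteq> z}" using \<sigma> by (rule bij_betw_the_inv_into)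
  show ?thesis
  proof (rule reindexI [OF \<rho>])
    fix j assume j: "j \<in> {j. t j \<noteq> z}"
    then have "\<sigma> (?\<rho> j) = j" "s (?\<rho> j) \<noteq> z"
      using \<sigma> \<rho> by (auto simp: bij_betw_def f_the_inv_into_f)
    then show "s (?\<rho> j) = t j" using eq by metis
  qed auto
qed

lemma reindex_map: "reindex z s t \<Longrightarrow> reindex (f z) (f \<circ> s) (f \<circ> t)"
proof -
  assume "reindex z s t"
  then obtain \<sigma> where "bij_betw \<sigma> {i. s i \<noteq> z} {j. t j \<noteq> z}" "\<And>i. s i \<noteq> z \<Longrightarrow> t (\<sigma> i) = s i"
    by (auto simp: reindex_def)
  then show ?thesis by (intro reindexI [of \<sigma>]) auto
qed

text \<open>Lemmas of this kind turn axioms of \<open>presented\<close> into instances of the rule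
  \<open>perm\<close> of \<open>gcong\<close>: this one serves \<open>sm_single\<close>,
  \<open>reindex_flat\<close> serves \<open>sm_reindex\<close>, and \<open>reindex_flat_flat\<close>
  serves \<open>sm_assoc\<close>.\<close>

lemma reindex_flat_row: "reindex z s (flat (\<lambda>j. if j = j0 then s else (\<lambda>_. z)))"
proof (rule reindexI)
  show "bij_betw (\<lambda>k. prod_encode (j0, k)) UNIV (range (\<lambda>k. prod_encode (j0, k)))"
    by (auto simp: bij_betw_def inj_on_def)
  fix n assume "n \<notin> range (\<lambda>k. prod_encode (j0, k))"
  then show "flat (\<lambda>j. if j = j0 then s else (\<lambda>_. z)) n = z"
    by (cases "prod_decode n") (auto simp: flat_def, metis prod_decode_inverse rangeI)
qed auto

text \<open>Spreads a sequence over rows with one entry each, so that statements about rows can be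
  applied to its entries.\<close>

lemma reindex_flat_single: "reindex z s (flat (\<lambda>i. single z (s i)))"
proof (rule reindexI)
  show "bij_betw (\<lambda>k. prod_encode (k, 0)) UNIV (range (\<lambda>k. prod_encode (k, 0)))"
    by (auto simp: bij_betw_def inj_on_def)
  fix n assume n: "n \<notin> range (\<lambda>k. prod_encode (k, 0))"
  obtain a b where ab: "n = prod_encode (a, b)" by (metis prod_decode_inverse surj_pair)
  with n have "b \<noteq> 0" by auto
  then show "flat (\<lambda>i. single z (s i)) n = z"
    using ab by (simp add: single_def)
qed auto

lemma bij_betw_encode:
  assumes "bij_betw f A B"
  shows "bij_betw (\<lambda>n. prod_encode (f (prod_decode n))) (prod_encode ` A) (prod_encode ` B)"
proof -
  have "bij_betw (prod_encode \<circ> f \<circ> prod_decode) (prod_encode ` A) (prod_encode ` B)"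
  proof (intro bij_betw_trans)
    show "bij_betw prod_decode (prod_encode ` A) A"
      by (intro bij_betw_byWitness [where f' = prod_encode]) auto
    show "bij_betw f A B" by fact
    show "bij_betw prod_encode B (prod_encode ` B)"
      by (auto simp: bij_betw_def inj_on_def)
  qed
  then show ?thesis by (simp add: comp_def)
qed

lemma reindex_flat:
  assumes \<sigma>: "bij_betw \<sigma> I J" and I: "\<And>i. i \<notin> I \<Longrightarrow> s i = (\<lambda>_. z)" and J: "\<And>j. j \<notin> J \<Longrightarrow> t j = (\<lambda>_. z)"
    and eq: "\<And>i. i \<in> I \<Longrightarrow> t (\<sigma> i) = s i"
  shows "reindex z (flat s) (flat t)"
proof (rule reindexI)
  have "bij_betw (map_prod \<sigma> id) (I \<times> UNIV) (J \<times> (UNIV :: nat set))"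
    using \<sigma> by (auto simp: bij_betw_def inj_on_def image_iff)
  then show "bij_betw (\<lambda>n. prod_encode (map_prod \<sigma> id (prod_decode n)))
      (prod_encode ` (I \<times> UNIV)) (prod_encode ` (J \<times> UNIV))"
    by (rule bij_betw_encode)
  fix n
  obtain a b where n: "n = prod_encode (a, b)" by (metis prod_decode_inverse surj_pair)
  show "n \<notin> prod_encode ` (I \<times> UNIV) \<Longrightarrow> flat s n = z" using n I by (cases "a \<in> I") auto
  show "n \<notin> prod_encode ` (J \<times> UNIV) \<Longrightarrow> flat t n = z" using n J by (cases "a \<in> J") auto
  show "n \<in> prod_encode ` (I \<times> UNIV) \<Longrightarrow> flat t (prod_encode (map_prod \<sigma> id (prod_decode n))) = flat s n"
    using n eq by auto
qed

lemma reindex_flat_flat: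
  assumes "bij \<sigma>"
  shows "reindex z (flat (\<lambda>j. flat (\<lambda>k. r (\<sigma> (j, k))))) (flat r)"
proof (rule reindexI)
  \<comment> \<open>On the left \<open>r (\<sigma> (j, k)) l\<close> stands at the code of
    \<open>(j, prod_encode (k, l))\<close>, on the right at the code of
    \<open>(\<sigma> (j, k), l)\<close>.\<close>
  let ?f = "\<lambda>(j, m). case prod_decode m of (k, l) \<Rightarrow> (\<sigma> (j, k), l)"
  have "bij ?f"
  proof (rule o_bij)
    let ?g = "\<lambda>(i, l). case inv \<sigma> i of (j, k) \<Rightarrow> (j, prod_encode (k, l))"
    show "?g \<circ> ?f = id"
      using assms by (auto simp: fun_eq_iff bij_is_inj split: prod.splits)
        (metis prod_decode_inverse)+
    show "?f \<circ> ?g = id"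
      using assms by (auto simp: fun_eq_iff bij_is_surj surj_f_inv_f split: prod.splits)
        (metis assms bij_is_surj surj_f_inv_f)+
  qed
  then show "bij_betw (\<lambda>n. prod_encode (?f (prod_decode n))) (prod_encode ` UNIV) (prod_encode ` UNIV)"
    by (rule bij_betw_encode)
  fix n
  obtain a b where n: "n = prod_encode (a, b)" by (metis prod_decode_inverse surj_pair)
  obtain c d where b: "b = prod_encode (c, d)" by (metis prod_decode_inverse surj_pair)
  show "flat r (prod_encode (?f (prod_decode n))) = flat (\<lambda>j. flat (\<lambda>k. r (\<sigma> (j, k)))) n"
    by (simp add: n b)
qed (auto simp: surj_prod_encode)


subsection \<open>Sums in a Sigma-monoid\<close>

lemma dsum_Some:
  "dsum M x = Some v \<longleftrightarrow> (\<exists>r. (\<forall>j. sm M (x j) = Some (r j)) \<and> sm M r = Some v)"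
proof
  assume "dsum M x = Some v"
  then show "\<exists>r. (\<forall>j. sm M (x j) = Some (r j)) \<and> sm M r = Some v"
    by (intro exI [of _ "\<lambda>j. the (sm M (x j))"]) (auto simp: dsum_def split: if_splits)
next
  assume "\<exists>r. (\<forall>j. sm M (x j) = Some (r j)) \<and> sm M r = Some v"
  then show "dsum M x = Some v" by (auto simp: dsum_def)
qed

lemma option_eqI: "(\<And>v. a = Some v \<longleftrightarrow> b = Some v) \<Longrightarrow> a = b"
  by (metis not_None_eq)

context sigma_monoid
begin

lemma sm_carr: "sm M x = Some s \<Longrightarrow> x i \<in> carr M" "sm M x = Some s \<Longrightarrow> s \<in> carr M"
  using sm_partial by blast+

lemma sm_reindexed:
  assumes "range x \<subseteq> carr M" "range y \<subseteq> carr M" "reindex (zer M) x y"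
  shows "sm M x = sm M y"
proof -
  from assms(3) obtain \<sigma> where "bij_betw \<sigma> {i. x i \<noteq> zer M} {j. y j \<noteq> zer M}"
    and "\<And>i. x i \<noteq> zer M \<Longrightarrow> y (\<sigma> i) = x i" by (auto simp: reindex_def)
  then show ?thesis
    by (intro sm_reindex [of x y \<sigma> "{i. x i = zer M}" "{j. y j = zer M}"])
      (use assms in \<open>auto simp: Compl_eq\<close>)
qed

lemma sm_flat: "range (flat x) \<subseteq> carr M \<Longrightarrow> sm M (flat x) = dsum M x"
  by (subst sm_assoc [of "flat x" prod_encode]) (auto simp: bij_prod_encode)

lemma sm_flat_Some:
  "range (flat x) \<subseteq> carr M \<Longrightarrow>
    sm M (flat x) = Some v \<longleftrightarrow> (\<exists>r. (\<forall>j. sm M (x j) = Some (r j)) \<and> sm M r = Some v)"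
  by (simp add: sm_flat dsum_Some)

text \<open>Both sides equal the sum of the flattened family: associativity is used once with
  \<open>prod_encode\<close> and once with \<open>prod_encode\<close> after the swap of
  coordinates.\<close>

lemma dsum_swap:
  assumes "\<And>j k. x j k \<in> carr M"
  shows "dsum M x = dsum M (\<lambda>j k. x k j)"
proof -
  have r: "range (flat x) \<subseteq> carr M" using assms by (auto simp: range_flat)
  have "bij (prod_encode \<circ> prod.swap)"
    by (intro bij_comp bij_prod_encode) (auto simp: bij_swap)
  from sm_assoc [OF r this] sm_flat [OF r] show ?thesis by simp
qed

text \<open>Interchange of summations as a Kleene equation: rows and columns are assumed summable,
  and definedness of either outer sum passes to the other. Linearity of pointwise sums and linearity
  in a parameter both rest on it.\<close>

lemma sum_swap:
  assumes x: "\<And>j. sm M (x j) = Some (r j)" and "\<And>k. sm M (\<lambda>j. x j k) = Some (c k)"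
  shows "sm M r = sm M c"
proof -
  have "dsum M x = dsum M (\<lambda>k j. x j k)"
    by (rule dsum_swap) (use x sm_carr in blast)
  then show ?thesis using assms by (simp add: dsum_def)
qed

lemma sm_const_zer [simp]: "sm M (\<lambda>_. zer M) = Some (zer M)"
  using sm_single [of "\<lambda>_. zer M" 0] zer_closed by auto

lemma sm_sing [simp]: "x \<in> carr M \<Longrightarrow> sm M (single (zer M) x) = Some x"
  using sm_single [of "single (zer M) x" 0] zer_closed
  by (auto simp: range_single) (simp add: single_def)

end


subsection \<open>Sigma-monoids presented by generators and relations\<close>

text \<open>A partial equivalence: \<open>gcong z R s s\<close> says that the formal sum
  \<open>s\<close> denotes an element, and undefined sums lie outside the field. \<open>row\<close>
  is the part of the associativity axiom by which a summable double family has summable rows.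
  \<open>flat_cong\<close> demands summability of \<open>flat s\<close> and thereby yields that of
  \<open>flat t\<close>.\<close>

inductive gcong :: "'g \<Rightarrow> ((nat \<Rightarrow> 'g) \<Rightarrow> (nat \<Rightarrow> 'g) \<Rightarrow> bool) \<Rightarrow> (nat \<Rightarrow> 'g) \<Rightarrow> (nat \<Rightarrow> 'g) \<Rightarrow> bool"
  for z R where
  base: "R s t \<Longrightarrow> gcong z R s t"
| zero: "gcong z R (\<lambda>_. z) (\<lambda>_. z)"
| sym: "gcong z R s t \<Longrightarrow> gcong z R t s"
| trans: "gcong z R s t \<Longrightarrow> gcong z R t u \<Longrightarrow> gcong z R s u"
| perm: "gcong z R s s \<Longrightarrow> reindex z s t \<Longrightarrow> gcong z R s t"
| flat_cong: "gcong z R (flat s) (flat s) \<Longrightarrow> (\<And>k. gcong z R (s k) (t k)) \<Longrightarrow>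
    gcong z R (flat s) (flat t)"
| row: "gcong z R (flat s) (flat s) \<Longrightarrow> gcong z R (s k) (s k)"

definition cls :: "'g \<Rightarrow> ((nat \<Rightarrow> 'g) \<Rightarrow> (nat \<Rightarrow> 'g) \<Rightarrow> bool) \<Rightarrow> (nat \<Rightarrow> 'g) \<Rightarrow> (nat \<Rightarrow> 'g) set" where
  "cls z R s = {t. gcong z R s t}"

definition rep :: "'g set \<Rightarrow> 'g" where
  "rep c = (SOME s. s \<in> c)"

text \<open>Adding classes means concatenating representatives; \<open>flat_cong\<close> makes the
  value and its definedness independent of the choice made by \<open>rep\<close>, as
  \<open>sm_presented\<close> records.\<close>

definition presented :: "'g \<Rightarrow> ((nat \<Rightarrow> 'g) \<Rightarrow> (nat \<Rightarrow> 'g) \<Rightarrow> bool) \<Rightarrow> (nat \<Rightarrow> 'g) set smon" where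
  "presented z R = \<lparr>carr = {cls z R s |s. gcong z R s s}, zer = cls z R (\<lambda>_. z),
     sm = (\<lambda>F. if range F \<subseteq> {cls z R s |s. gcong z R s s} \<and>
                  gcong z R (flat (rep \<circ> F)) (flat (rep \<circ> F))
               then Some (cls z R (flat (rep \<circ> F))) else None)\<rparr>"

lemma gcong_refl: "gcong z R s t \<Longrightarrow> gcong z R s s" "gcong z R s t \<Longrightarrow> gcong z R t t"
  by (blast intro: gcong.sym gcong.trans)+

lemma gcong_rep: "gcong z R s s \<Longrightarrow> gcong z R s (rep (cls z R s))"
  unfolding rep_def cls_def by (rule someI2 [of _ s]) auto

lemma cls_eq: "gcong z R s s \<Longrightarrow> cls z R s = cls z R t \<longleftrightarrow> gcong z R s t"
  unfolding cls_def set_eq_iff mem_Collect_eq by (meson gcong.sym gcong.trans)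

lemma gcong_range:
  assumes "gcong z R s t" and "\<And>s t. R s t \<Longrightarrow> range s \<subseteq> G \<and> range t \<subseteq> G" and "z \<in> G"
  shows "range s \<subseteq> G \<and> range t \<subseteq> G"
  using assms(1)
proof induction
  case (perm s t)
  then show ?case using reindex_range [of z s t] assms(3) by auto
next
  case (flat_cong s t)
  then show ?case by (simp add: range_flat) blast
next
  case (row s k)
  then show ?case by (auto simp: range_flat)
qed (use assms in auto)

lemma carr_presented: "carr (presented z R) = {cls z R s |s. gcong z R s s}"
  by (simp add: presented_def)

lemma zer_presented: "zer (presented z R) = cls z R (\<lambda>_. z)"
  by (simp add: presented_def)

lemma sm_presented:
  assumes "\<And>k. gcong z R (s k) (s k)"
  shows "sm (presented z R) (\<lambda>k. cls z R (s k)) =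
    (if gcong z R (flat s) (flat s) then Some (cls z R (flat s)) else None)"
proof -
  have rep: "gcong z R (s k) (rep (cls z R (s k)))" for k
    using assms by (rule gcong_rep)
  have iff: "gcong z R (flat s) (flat s) \<longleftrightarrow>
      gcong z R (flat (\<lambda>k. rep (cls z R (s k)))) (flat (\<lambda>k. rep (cls z R (s k))))"
    by (meson gcong.flat_cong gcong.sym gcong.trans rep)
  have eq: "gcong z R (flat s) (flat s) \<Longrightarrow>
      gcong z R (flat s) (flat (\<lambda>k. rep (cls z R (s k))))"
    by (rule gcong.flat_cong) (auto intro: rep)
  show ?thesis
    using assms iff eq by (auto simp: presented_def comp_def cls_eq [symmetric])
qed

lemma cls_reindex:
  assumes "reindex z s t"
  shows "(if gcong z R s s then Some (cls z R s) else None) = (if gcong z R t t then Some (cls z R t) else None)"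
proof -
  have "gcong z R s s \<longleftrightarrow> gcong z R t t" "gcong z R s s \<Longrightarrow> gcong z R s t"
    using assms reindex_sym [OF assms] by (meson gcong.perm gcong_refl)+
  then show ?thesis by (auto simp: cls_eq)
qed

text \<open>Up to reindexing \<open>s\<close> is the flattening of its one-entry rows. Hence a
  formal sum may be read as the actual sum of its generators, and their summability is membership in
  the field of \<open>gcong\<close>.\<close>

lemma sm_presented_gen:
  assumes "\<And>i. gcong z R (single z (s i)) (single z (s i))"
  shows "sm (presented z R) (\<lambda>i. cls z R (single z (s i))) =
    (if gcong z R s s then Some (cls z R s) else None)"
  unfolding sm_presented [of z R "\<lambda>i. single z (s i)", OF assms]
  by (rule cls_reindex [OF reindex_sym [OF reindex_flat_single]])

text \<open>Written as a flattened family of one-entry rows, \<open>s\<close> passes its summability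
  on to each entry by \<open>row\<close>.\<close>

lemma gcong_entry: "gcong z R s s \<Longrightarrow> gcong z R (single z (s i)) (single z (s i))"
  using gcong.perm [OF _ reindex_flat_single, of z R s, THEN gcong_refl(2)]
    gcong.row [of z R "\<lambda>i. single z (s i)"] by blast

lemma presented_rep:
  assumes "range F \<subseteq> carr (presented z R)"
  obtains s where "\<And>k. gcong z R (s k) (s k)" "F = (\<lambda>k. cls z R (s k))"
proof -
  from assms have "\<forall>k. \<exists>s. gcong z R s s \<and> F k = cls z R s"
    by (auto simp: carr_presented image_subset_iff)
  then obtain s where "\<forall>k. gcong z R (s k) (s k) \<and> F k = cls z R (s k)" by metis
  then show thesis by (intro that [of s]) auto
qed

lemma sigma_monoid_presented: "sigma_monoid (presented z R)"
proof
  let ?P = "presented z R"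
  show "zer ?P \<in> carr ?P"
    by (auto simp: carr_presented zer_presented intro: gcong.zero)
  show "range x \<subseteq> carr ?P \<and> s \<in> carr ?P" if "sm ?P x = Some s" for x s
    using that by (auto simp: presented_def split: if_splits)
  show "sm ?P x = Some (x j)"
    if x: "range x \<subseteq> carr ?P" and x0: "\<And>i. i \<noteq> j \<Longrightarrow> x i = zer ?P" for x j
  proof -
    obtain s where s: "\<And>k. gcong z R (s k) (s k)" "x = (\<lambda>k. cls z R (s k))"
      using presented_rep [OF x] by blast
    \<comment> \<open>Classes equal to zero get the constant representative \<open>z\<close>; only
      then is the flattened family literally a reindexing of \<open>s j\<close>.\<close>
    let ?t = "\<lambda>i. if i = j then s j else (\<lambda>_. z)"
    have t: "gcong z R (?t k) (?t k)" for k using s by (auto intro: gcong.zero)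
    have xt: "x = (\<lambda>k. cls z R (?t k))" 
    proof
      show "x k = cls z R (?t k)" for k using s(2) x0 [of k] by (simp add: zer_presented)
    qed
    have "gcong z R (s j) (flat ?t)"
      using gcong.perm [OF s(1) [of j] reindex_flat_row] .
    then show ?thesis
      using xt sm_presented [of z R ?t, OF t] s
      by (metis (no_types, lifting) cls_eq gcong_refl)
  qed
  show "sm ?P x = sm ?P y"
    if x: "range x \<subseteq> carr ?P" and y: "range y \<subseteq> carr ?P" and \<sigma>: "bij_betw \<sigma> (- I) (- J)"
      and I: "\<And>i. i \<in> I \<Longrightarrow> x i = zer ?P" and J: "\<And>j. j \<in> J \<Longrightarrow> y j = zer ?P"
      and eq: "\<And>i. i \<notin> I \<Longrightarrow> x i = y (\<sigma> i)" for x y I J and \<sigma> :: "nat \<Rightarrow> nat"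
  proof -
    obtain t where t: "\<And>k. gcong z R (t k) (t k)" "y = (\<lambda>k. cls z R (t k))"
      using presented_rep [OF y] by blast
    \<comment> \<open>The representatives of \<open>x\<close> are copied from those of
      \<open>y\<close> along \<open>\<sigma>\<close>. Independently chosen ones would make the
      flattenings congruent row by row, but not reindexings of each other.\<close>
    let ?t = "\<lambda>j. if j \<in> J then (\<lambda>_. z) else t j"
    let ?s = "\<lambda>i. if i \<in> I then (\<lambda>_. z) else t (\<sigma> i)"
    have r: "gcong z R (?t k) (?t k)" "gcong z R (?s k) (?s k)" for k
      using t by (auto intro: gcong.zero)
    have yt: "y = (\<lambda>k. cls z R (?t k))" 
    proof
      show "y k = cls z R (?t k)" for k using t(2) J [of k] by (simp add: zer_presented)
    qed
    have xs: "x = (\<lambda>k. cls z R (?s k))" 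
    proof
      show "x k = cls z R (?s k)" for k using t(2) I [of k] eq [of k] by (simp add: zer_presented)
    qed
    have "reindex z (flat ?s) (flat ?t)"
      by (rule reindex_flat [OF \<sigma>]) (use \<sigma> in \<open>auto simp: bij_betw_def\<close>)
    then show ?thesis
      unfolding xs yt sm_presented [of z R ?s, OF r(2)] sm_presented [of z R ?t, OF r(1)]
      by (rule cls_reindex)
  qed
  show "sm ?P x = dsum ?P (\<lambda>j k. x (\<sigma> (j, k)))"
    if x: "range x \<subseteq> carr ?P" and \<sigma>: "bij \<sigma>" for x and \<sigma> :: "nat \<times> nat \<Rightarrow> nat"
  proof -
    obtain s where s: "\<And>k. gcong z R (s k) (s k)" "x = (\<lambda>k. cls z R (s k))"
      using presented_rep [OF x] by blast
    let ?row = "\<lambda>j. flat (\<lambda>k. s (\<sigma> (j, k)))"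
    have "reindex z (flat ?row) (flat s)" by (rule reindex_flat_flat [OF \<sigma>])
    then have eq: "sm ?P x = (if gcong z R (flat ?row) (flat ?row) then Some (cls z R (flat ?row)) else None)"
      unfolding s(2) sm_presented [of z R s, OF s(1)] by (rule cls_reindex [symmetric])
    have inner: "sm ?P (\<lambda>k. x (\<sigma> (j, k))) =
        (if gcong z R (?row j) (?row j) then Some (cls z R (?row j)) else None)" for j
      unfolding s(2) by (rule sm_presented) (rule s(1))
    show ?thesis
    proof (cases "\<forall>j. gcong z R (?row j) (?row j)")
      case True
      then have "dsum ?P (\<lambda>j k. x (\<sigma> (j, k))) =
          (if gcong z R (flat ?row) (flat ?row) then Some (cls z R (flat ?row)) else None)"
        using sm_presented [of z R ?row] by (simp add: dsum_def inner)
      with eq show ?thesis by simp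
    next
      case False
      \<comment> \<open>An undefined inner sum must make the whole sum undefined; this is the
        purpose of the rule \<open>row\<close>.\<close>
      have "\<forall>j. gcong z R (?row j) (?row j)" if "gcong z R (flat ?row) (flat ?row)"
        using gcong.row [OF that] by (rule allI)
      with False have "\<not> gcong z R (flat ?row) (flat ?row)" by argo
      then have "sm ?P x = None" using eq by simp
      moreover from False have "dsum ?P (\<lambda>j k. x (\<sigma> (j, k))) = None"
        by (auto simp: dsum_def inner)
      ultimately show ?thesis by simp
    qed
  qed
qed

section \<open>Linear maps out of a presented Sigma-monoid\<close>

definition satisfies :: "'l smon \<Rightarrow> ('g \<Rightarrow> 'l) \<Rightarrow> ((nat \<Rightarrow> 'g) \<Rightarrow> (nat \<Rightarrow> 'g) \<Rightarrow> bool) \<Rightarrow> bool" where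
  "satisfies L b R \<longleftrightarrow> (\<forall>s t. R s t \<longrightarrow> (\<exists>v. sm L (b \<circ> s) = Some v \<and> sm L (b \<circ> t) = Some v))"

text \<open>Soundness of the calculus: each rule is a consequence of the Sigma-monoid axioms in
  \<open>L\<close>. The type of \<open>L\<close> is arbitrary, and this is the source of
  universality beyond the carrier type of \<open>presented\<close>.\<close>

lemma satisfies_gcong:
  assumes L: "sigma_monoid L" and R: "satisfies L b R" and z: "b z = zer L"
    and st: "gcong z R s t"
  shows "\<exists>v. sm L (b \<circ> s) = Some v \<and> sm L (b \<circ> t) = Some v"
proof -
  interpret sigma_monoid L by (rule L)
  show ?thesis using st
  proof induction
    case (base s t)
    then show ?case using R by (simp add: satisfies_def comp_def)
  next
    case zero
    then show ?case using z by (simp add: comp_def)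
  next
    case (perm s t)
    then obtain v where v: "sm L (b \<circ> s) = Some v" by blast
    then have s: "range (b \<circ> s) \<subseteq> carr L" using sm_partial by blast
    have "range (b \<circ> t) \<subseteq> insert (zer L) (range (b \<circ> s))"
      using reindex_range [OF reindex_map [OF perm(2), of b]] z by simp
    then have t: "range (b \<circ> t) \<subseteq> carr L" using s zer_closed by (meson insert_subset order.trans)
    show ?case
      using sm_reindexed [OF s t] reindex_map [OF perm(2), of b] v unfolding z by metis
  next
    case (flat_cong s t)
    then obtain v where v: "sm L (b \<circ> flat s) = Some v" by blast
    then have s: "range (flat (\<lambda>j. b \<circ> s j)) \<subseteq> carr L"
      using sm_partial by (fastforce simp: comp_flat)
    from flat_cong(4) obtain r where r: "\<And>k. sm L (b \<circ> s k) = Some (r k)" "\<And>k. sm L (b \<circ> t k) = Some (r k)"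
      by metis
    have t: "range (flat (\<lambda>j. b \<circ> t j)) \<subseteq> carr L"
      using r(2) sm_partial unfolding range_flat by fast
    show ?case
      using v r sm_flat_Some [OF s, of v] sm_flat_Some [OF t, of v] by (auto simp: comp_flat)
  next
    case (row s k)
    then obtain v where v: "sm L (b \<circ> flat s) = Some v" by blast
    then have s: "range (flat (\<lambda>j. b \<circ> s j)) \<subseteq> carr L"
      using sm_partial by (fastforce simp: comp_flat)
    show ?case
      using v sm_flat_Some [OF s, of v] unfolding comp_flat by blast
  qed auto
qed

lemma linear_mapD:
  assumes "linear_map M N f"
  shows "x \<in> carr M \<Longrightarrow> f x \<in> carr N" "f (zer M) = zer N" "x \<notin> carr M \<Longrightarrow> f x = undefined"
    "sm M X = Some s \<Longrightarrow> sm N (f \<circ> X) = Some (f s)" "sm M X = Some s \<Longrightarrow> sm N (\<lambda>i. f (X i)) = Some (f s)"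
  using assms by (auto simp: linear_map_def comp_def extensional_def PiE_def)

lemma linear_map_ext:
  "linear_map M N f \<Longrightarrow> linear_map M N g \<Longrightarrow> (\<And>x. x \<in> carr M \<Longrightarrow> f x = g x) \<Longrightarrow> f = g"
  by (auto simp: linear_map_def intro: PiE_ext)

lemma linear_map_restrictI:
  assumes "sigma_monoid M" "\<And>x. x \<in> carr M \<Longrightarrow> f x \<in> carr N" "f (zer M) = zer N"
    "\<And>X s. sm M X = Some s \<Longrightarrow> sm N (\<lambda>i. f (X i)) = Some (f s)"
  shows "linear_map M N (\<lambda>x\<in>carr M. f x)"
proof -
  interpret sigma_monoid M by fact
  have "sm N (restrict f (carr M) \<circ> X) = Some (restrict f (carr M) s)" if X: "sm M X = Some s" for X s
  proof -
    have "restrict f (carr M) \<circ> X = (\<lambda>i. f (X i))" using sm_carr(1) [OF X] by auto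
    then show ?thesis using assms(4) [OF X] sm_carr(2) [OF X] by simp
  qed
  then show ?thesis using assms zer_closed by (auto simp: linear_map_def)
qed

text \<open>\<open>b\<close> is a bare function on the generator type. That it takes values in
  \<open>carr L\<close> on summable generators comes from soundness for \<open>single z g\<close>,
  since a defined sum has all its entries in the carrier.\<close>

lemma presented_lift:
  assumes L: "sigma_monoid L" and R: "satisfies L b R" and z: "b z = zer L"
  defines "h \<equiv> (\<lambda>c\<in>carr (presented z R). the (sm L (b \<circ> rep c)))"
  shows "linear_map (presented z R) L h"
    and "\<And>s. gcong z R s s \<Longrightarrow> sm L (b \<circ> s) = Some (h (cls z R s))"
    and "\<And>g. gcong z R (single z g) (single z g) \<Longrightarrow> b g \<in> carr L \<and> h (cls z R (single z g)) = b g"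
proof -
  interpret L: sigma_monoid L by (rule L)
  interpret P: sigma_monoid "presented z R" by (rule sigma_monoid_presented)
  have h: "sm L (b \<circ> s) = Some (h (cls z R s))" if s: "gcong z R s s" for s
    using satisfies_gcong [OF L R z gcong_rep [OF s]] s by (auto simp: h_def carr_presented)
  then show "\<And>s. gcong z R s s \<Longrightarrow> sm L (b \<circ> s) = Some (h (cls z R s))" .
  show "linear_map (presented z R) L h"
    unfolding h_def
  proof (rule linear_map_restrictI)
    show "the (sm L (b \<circ> rep x)) \<in> carr L" if x: "x \<in> carr (presented z R)" for x
    proof -
      obtain s where s: "gcong z R s s" "x = cls z R s" using x by (auto simp: carr_presented)
      then have "h x \<in> carr L" using L.sm_carr(2) [OF h] by simp
      then show ?thesis using x by (simp add: h_def)
    qed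
    show "the (sm L (b \<circ> rep (zer (presented z R)))) = zer L"
    proof -
      have "sm L (b \<circ> (\<lambda>_. z)) = Some (h (cls z R (\<lambda>_. z)))" by (rule h [OF gcong.zero])
      then have "h (zer (presented z R)) = zer L" using z by (simp add: comp_def zer_presented)
      then show ?thesis using P.zer_closed by (simp add: h_def)
    qed
    fix F v assume F: "sm (presented z R) F = Some v"
    then obtain s where s: "\<And>k. gcong z R (s k) (s k)" "F = (\<lambda>k. cls z R (s k))"
      using presented_rep P.sm_partial by metis
    then have v: "gcong z R (flat s) (flat s)" "v = cls z R (flat s)"
      using F sm_presented [of z R s, OF s(1)] by (auto split: if_splits)
    have hF: "the (sm L (b \<circ> rep (F i))) = h (F i)" for i
      using s by (auto simp: h_def carr_presented)
    have hv: "the (sm L (b \<circ> rep v)) = h v"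
      using v by (auto simp: h_def carr_presented)
    have flat: "sm L (flat (\<lambda>j. b \<circ> s j)) = Some (h v)"
      using h [OF v(1)] v(2) by (simp add: comp_flat)
    then have "sm L (\<lambda>i. h (F i)) = Some (h v)"
      using L.sm_flat_Some [of "\<lambda>j. b \<circ> s j" "h v"] L.sm_partial [OF flat] h [OF s(1)]
      by (auto simp: s(2))
    then show "sm L (\<lambda>i. the (sm L (b \<circ> rep (F i)))) = Some (the (sm L (b \<circ> rep v)))"
      by (simp add: hF hv)
  qed (rule P.sigma_monoid_axioms)
  show "b g \<in> carr L \<and> h (cls z R (single z g)) = b g"
    if g: "gcong z R (single z g) (single z g)" for g
  proof -
    have "sm L (single (zer L) (b g)) = Some (h (cls z R (single z g)))"
      using h [OF g] by (simp add: comp_single z)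
    moreover from L.sm_carr(1) [OF this, of 0] have "b g \<in> carr L" by simp
    ultimately show ?thesis by simp
  qed
qed

subsection \<open>Arrows\<close>

text \<open>Membership in \<open>Hom\<close> says nothing about the end objects. With their axioms
  bundled in, rewriting of composites leaves only equations between sources and targets as side
  conditions.\<close>

definition arr :: "('a, 'b) arrow \<Rightarrow> bool" where
  "arr f \<longleftrightarrow> sigma_monoid (src f) \<and> sigma_monoid (tgt f) \<and> f \<in> Hom (src f) (tgt f)"

lemma Hom_arr: "sigma_monoid M \<Longrightarrow> sigma_monoid N \<Longrightarrow> f \<in> Hom M N \<longleftrightarrow> arr f \<and> src f = M \<and> tgt f = N"
  by (auto simp: arr_def Hom_def)

lemma arrD:
  assumes "arr f"
  shows "sigma_monoid (src f)" "sigma_monoid (tgt f)" "linear_map (src f) (tgt f) (fn f)"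
    "x \<in> carr (src f) \<Longrightarrow> fn f x \<in> carr (tgt f)"
  using assms by (auto simp: arr_def Hom_def linear_map_def)

lemma arr_eqI:
  assumes "arr f" "arr g" "src f = src g" "tgt f = tgt g" "\<And>x. x \<in> carr (src f) \<Longrightarrow> fn f x = fn g x"
  shows "f = g"
proof -
  have "fn f = fn g" using assms by (intro linear_map_ext) (auto dest: arrD)
  with assms show ?thesis by simp
qed

lemma arr_mk: "sigma_monoid M \<Longrightarrow> sigma_monoid N \<Longrightarrow> linear_map M N f \<Longrightarrow> arr \<lparr>src = M, tgt = N, fn = f\<rparr>"
  by (auto simp: arr_def Hom_def)

lemma src_comp [simp]: "src (g \<odot> f) = src f" and tgt_comp [simp]: "tgt (g \<odot> f) = tgt g"
  and fn_comp: "x \<in> carr (src f) \<Longrightarrow> fn (g \<odot> f) x = fn g (fn f x)"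
  by (auto simp: arrow_comp_def compose_def)

lemma src_ident [simp]: "src (ident M) = M" and tgt_ident [simp]: "tgt (ident M) = M"
  and fn_ident: "x \<in> carr M \<Longrightarrow> fn (ident M) x = x"
  by (auto simp: ident_def)

lemma linear_map_ident: "sigma_monoid M \<Longrightarrow> linear_map M M (\<lambda>x\<in>carr M. x)"
  by (rule linear_map_restrictI) (auto intro: sigma_monoid.zer_closed)

lemma linear_map_compose:
  assumes "sigma_monoid L" "linear_map L M f" "linear_map M N g"
  shows "linear_map L N (compose (carr L) g f)"
  unfolding compose_def using assms
  by (intro linear_map_restrictI) (auto dest: linear_mapD simp: linear_mapD(2))

lemma arr_ident [simp]: "sigma_monoid M \<Longrightarrow> arr (ident M)"
  unfolding ident_def by (intro arr_mk linear_map_ident)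

lemma arr_comp [simp]: "arr f \<Longrightarrow> arr g \<Longrightarrow> src g = tgt f \<Longrightarrow> arr (g \<odot> f)"
  unfolding arrow_comp_def by (intro arr_mk linear_map_compose) (auto dest: arrD)

lemma comp_assoc: "arr f \<Longrightarrow> arr g \<Longrightarrow> src g = tgt f \<Longrightarrow> (h \<odot> g) \<odot> f = h \<odot> (g \<odot> f)"
  by (auto simp: arrow_comp_def compose_def fun_eq_iff dest: arrD(4))

lemma comp_ident [simp]: "arr f \<Longrightarrow> src f = M \<Longrightarrow> f \<odot> ident M = f"
  by (rule arr_eqI) (auto simp: fn_comp fn_ident arrD)

lemma ident_comp [simp]: "arr f \<Longrightarrow> tgt f = M \<Longrightarrow> ident M \<odot> f = f"
  by (rule arr_eqI) (auto simp: fn_comp fn_ident arrD)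

lemma sm_arr: "arr f \<Longrightarrow> sm (src f) X = Some s \<Longrightarrow> sm (tgt f) (\<lambda>i. fn f (X i)) = Some (fn f s)"
  by (rule linear_mapD(5) [OF arrD(3)])

lemma zer_arr: "arr f \<Longrightarrow> fn f (zer (src f)) = zer (tgt f)"
  by (rule linear_mapD(2) [OF arrD(3)])


subsection \<open>Internal hom and unit\<close>

text \<open>The initial structure for a family of maps \<open>\<pi> a\<close> that jointly reflect
  sums. It is used with all evaluations for \<open>ihom\<close> and with a single injection for
  \<open>pull\<close>. In the associativity axiom the row sums are known only coordinate by
  coordinate, and \<open>closed\<close> assembles them into elements of \<open>X\<close>.\<close>

lemma sigma_monoid_initial:
  assumes N: "sigma_monoid N"
    and zer: "zer X \<in> carr X" "\<And>a. a \<in> A \<Longrightarrow> \<pi> a (zer X) = zer N"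
    and \<pi>: "\<And>a v. a \<in> A \<Longrightarrow> v \<in> carr X \<Longrightarrow> \<pi> a v \<in> carr N"
    and iff: "\<And>x v. sm X x = Some v \<longleftrightarrow>
      range x \<subseteq> carr X \<and> v \<in> carr X \<and> (\<forall>a\<in>A. sm N (\<lambda>i. \<pi> a (x i)) = Some (\<pi> a v))"
    and closed: "\<And>x g. range x \<subseteq> carr X \<Longrightarrow> (\<And>a. a \<in> A \<Longrightarrow> sm N (\<lambda>i. \<pi> a (x i)) = Some (g a)) \<Longrightarrow>
      \<exists>v\<in>carr X. \<forall>a\<in>A. \<pi> a v = g a"
  shows "sigma_monoid X"
proof
  interpret N: sigma_monoid N by (rule N)
  show "zer X \<in> carr X" by (rule zer)
  show "range x \<subseteq> carr X \<and> s \<in> carr X" if "sm X x = Some s" for x s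
    using that iff by blast
  show "sm X x = Some (x j)" if x: "range x \<subseteq> carr X" and 0: "\<And>i. i \<noteq> j \<Longrightarrow> x i = zer X" for x j
  proof -
    have "sm N (\<lambda>i. \<pi> a (x i)) = Some (\<pi> a (x j))" if "a \<in> A" for a
      by (rule N.sm_single) (use x 0 zer(2) \<pi> that in auto)
    then show ?thesis using x by (auto simp: iff)
  qed
  show "sm X x = sm X y"
    if x: "range x \<subseteq> carr X" and y: "range y \<subseteq> carr X" and \<sigma>: "bij_betw \<sigma> (- I) (- J)"
      and I: "\<And>i. i \<in> I \<Longrightarrow> x i = zer X" and J: "\<And>j. j \<in> J \<Longrightarrow> y j = zer X"
      and eq: "\<And>i. i \<notin> I \<Longrightarrow> x i = y (\<sigma> i)" for x y I J and \<sigma> :: "nat \<Rightarrow> nat"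
  proof -
    have "sm N (\<lambda>i. \<pi> a (x i)) = sm N (\<lambda>i. \<pi> a (y i))" if "a \<in> A" for a
      by (rule N.sm_reindex [OF _ _ \<sigma>]) (use x y I J eq zer(2) \<pi> that in auto)
    then show ?thesis using x y by (intro option_eqI) (simp add: iff)
  qed
  show "sm X x = dsum X (\<lambda>j k. x (\<sigma> (j, k)))"
    if x: "range x \<subseteq> carr X" and \<sigma>: "bij \<sigma>" for x and \<sigma> :: "nat \<times> nat \<Rightarrow> nat"
  proof (rule option_eqI)
    fix v
    have xc: "range (\<lambda>k. x (\<sigma> (j, k))) \<subseteq> carr X" for j using x by auto
    have *: "sm N (\<lambda>i. \<pi> a (x i)) = dsum N (\<lambda>j k. \<pi> a (x (\<sigma> (j, k))))" if "a \<in> A" for a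
      by (rule N.sm_assoc [OF _ \<sigma>]) (use x \<pi> that in auto)
    show "sm X x = Some v \<longleftrightarrow> dsum X (\<lambda>j k. x (\<sigma> (j, k))) = Some v"
    proof
      assume "sm X x = Some v"
      then have v: "v \<in> carr X" "\<And>a. a \<in> A \<Longrightarrow> dsum N (\<lambda>j k. \<pi> a (x (\<sigma> (j, k)))) = Some (\<pi> a v)"
        by (auto simp: iff *)
      then have "\<forall>a. \<exists>r. a \<in> A \<longrightarrow> (\<forall>j. sm N (\<lambda>k. \<pi> a (x (\<sigma> (j, k)))) = Some (r j)) \<and> sm N r = Some (\<pi> a v)"
        unfolding dsum_Some by blast
      then obtain r where r: "\<And>a j. a \<in> A \<Longrightarrow> sm N (\<lambda>k. \<pi> a (x (\<sigma> (j, k)))) = Some (r a j)"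
        "\<And>a. a \<in> A \<Longrightarrow> sm N (r a) = Some (\<pi> a v)" by metis
      have "\<forall>j. \<exists>q\<in>carr X. \<forall>a\<in>A. \<pi> a q = r a j"
      proof
        show "\<exists>q\<in>carr X. \<forall>a\<in>A. \<pi> a q = r a j" for j by (rule closed [OF xc [of j] r(1)])
      qed
      then obtain q where q: "\<And>j. q j \<in> carr X" "\<And>a j. a \<in> A \<Longrightarrow> \<pi> a (q j) = r a j" by metis
      have "sm X (\<lambda>k. x (\<sigma> (j, k))) = Some (q j)" for j
        unfolding iff using xc q r(1) by simp
      moreover have "sm X q = Some v" using v(1) q r(2) by (auto simp: iff)
      ultimately show "dsum X (\<lambda>j k. x (\<sigma> (j, k))) = Some v" unfolding dsum_Some by blast
    next
      assume "dsum X (\<lambda>j k. x (\<sigma> (j, k))) = Some v"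
      then obtain r where r: "\<And>j. sm X (\<lambda>k. x (\<sigma> (j, k))) = Some (r j)" "sm X r = Some v"
        unfolding dsum_Some by blast
      have "sm N (\<lambda>i. \<pi> a (x i)) = Some (\<pi> a v)" if "a \<in> A" for a
        unfolding * [OF that] dsum_Some using r that by (intro exI [of _ "\<lambda>j. \<pi> a (r j)"]) (simp add: iff)
      then show "sm X x = Some v" using r(2) x by (simp add: iff)
    qed
  qed
qed

text \<open>Linearity on a family \<open>X\<close> is the interchange of the sum over the index of
  \<open>F\<close> with the sum over the index of \<open>X\<close>.\<close>

lemma pointwise_sum_linear:
  assumes "sigma_monoid M" "sigma_monoid N" and F: "\<And>i. linear_map M N (F i)"
    and g: "\<And>x. x \<in> carr M \<Longrightarrow> sm N (\<lambda>i. F i x) = Some (g x)"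
  shows "linear_map M N (\<lambda>x\<in>carr M. g x)"
proof (rule linear_map_restrictI)
  interpret M: sigma_monoid M by fact
  interpret N: sigma_monoid N by fact
  show "sigma_monoid M" by fact
  show "\<And>x. x \<in> carr M \<Longrightarrow> g x \<in> carr N" using g N.sm_carr(2) by blast
  show "g (zer M) = zer N" using g [OF M.zer_closed] by (simp add: linear_mapD(2) [OF F])
  fix X s assume X: "sm M X = Some s"
  have "sm N (\<lambda>i. F i s) = sm N (\<lambda>k. g (X k))"
    by (rule N.sum_swap [of "\<lambda>i k. F i (X k)"]) (auto intro: linear_mapD(5) [OF F X] g M.sm_carr(1) [OF X])
  then show "sm N (\<lambda>k. g (X k)) = Some (g s)" using g M.sm_carr(2) [OF X] by simp
qed

lemma carr_ihom [simp]: "carr (ihom M N) = {f. linear_map M N f}"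
  and zer_ihom [simp]: "zer (ihom M N) = (\<lambda>x\<in>carr M. zer N)"
  by (simp_all add: ihom_def)

lemma sm_ihom_Some:
  assumes "sigma_monoid M" "sigma_monoid N"
  shows "sm (ihom M N) F = Some g \<longleftrightarrow> (\<forall>i. linear_map M N (F i)) \<and> linear_map M N g \<and>
    (\<forall>x\<in>carr M. sm N (\<lambda>i. F i x) = Some (g x))" (is "?l \<longleftrightarrow> ?r")
proof
  assume l: ?l
  then have 1: "\<forall>i. linear_map M N (F i)" "\<forall>x\<in>carr M. sm N (\<lambda>i. F i x) = Some (g x)"
    and 2: "g = (\<lambda>x\<in>carr M. the (sm N (\<lambda>i. F i x)))"
    by (auto simp: ihom_def split: if_splits)
  have "linear_map M N g" unfolding 2 by (rule pointwise_sum_linear) (use assms 1 in auto)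
  with 1 show ?r by blast
next
  assume r: ?r
  then have "g = (\<lambda>x\<in>carr M. the (sm N (\<lambda>i. F i x)))"
    by (auto simp: linear_map_def fun_eq_iff extensional_def)
  with r show ?l by (auto simp: ihom_def)
qed

lemma sigma_monoid_ihom:
  assumes M: "sigma_monoid M" and N: "sigma_monoid N"
  shows "sigma_monoid (ihom M N)"
proof (rule sigma_monoid_initial [where \<pi> = "\<lambda>x f. f x" and A = "carr M", OF N])
  have "linear_map M N (\<lambda>x\<in>carr M. zer N)"
    by (rule linear_map_restrictI) (auto intro: M sigma_monoid.zer_closed [OF N] sigma_monoid.sm_const_zer [OF N])
  then show "zer (ihom M N) \<in> carr (ihom M N)" by simp
  show "sm (ihom M N) F = Some g \<longleftrightarrow> range F \<subseteq> carr (ihom M N) \<and> g \<in> carr (ihom M N) \<and>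
    (\<forall>x\<in>carr M. sm N (\<lambda>i. F i x) = Some (g x))" for F g
    by (auto simp: sm_ihom_Some M N)
  fix F g assume F: "range F \<subseteq> carr (ihom M N)" "\<And>x. x \<in> carr M \<Longrightarrow> sm N (\<lambda>i. F i x) = Some (g x)"
  have "linear_map M N (\<lambda>x\<in>carr M. g x)"
    by (rule pointwise_sum_linear [OF M N, of F]) (use F in auto)
  then show "\<exists>h\<in>carr (ihom M N). \<forall>x\<in>carr M. h x = g x" by (intro bexI [of _ "\<lambda>x\<in>carr M. g x"]) simp_all
qed (auto dest: linear_mapD(1))

lemma carr_unitI [simp]: "carr unitI = {0, 1}" and zer_unitI [simp]: "zer unitI = 0"
  by (simp_all add: unitI_def)

text \<open>Summability is expressed by the set of positions of ones having at most one element, a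
  condition that bijections of indices visibly respect.\<close>

lemma sm_unitI_Some:
  "sm unitI x = Some v \<longleftrightarrow> range x \<subseteq> {0, 1} \<and>
    ({i. x i = 1} = {} \<and> v = 0 \<or> (\<exists>j. {i. x i = 1} = {j}) \<and> v = 1)"
proof -
  have "(\<forall>i j. P i \<and> P j \<longrightarrow> i = j) \<longleftrightarrow> {i. P i} = {} \<or> (\<exists>j. {i. P i} = {j})" for P :: "nat \<Rightarrow> bool"
    unfolding set_eq_iff mem_Collect_eq singleton_iff empty_iff by metis
  note u1 = this [of "\<lambda>i. x i = 1"]
  have u2: "(\<exists>i. x i = 1) \<longleftrightarrow> {i. x i = 1} \<noteq> {}" by blast
  define S where "S = {i. x i = 1}"
  show ?thesis
    unfolding unitI_def smon.select_convs u1 u2 S_def [symmetric] by auto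
qed

lemma sigma_monoid_unitI: "sigma_monoid unitI"
proof
  show "zer unitI \<in> carr unitI" by simp
  show "range x \<subseteq> carr unitI \<and> s \<in> carr unitI" if "sm unitI x = Some s" for x s
    using that unfolding sm_unitI_Some by auto
  show "sm unitI x = Some (x j)"
    if x: "range x \<subseteq> carr unitI" and 0: "\<And>i. i \<noteq> j \<Longrightarrow> x i = zer unitI" for x j
  proof -
    have "{i. x i = 1} \<subseteq> {j}"
    proof
      fix i assume "i \<in> {i. x i = 1}"
      then have "x i \<noteq> zer unitI" by simp
      then show "i \<in> {j}" using 0 [of i] by blast
    qed
    then have "{i. x i = 1} = {} \<or> {i. x i = 1} = {j}" by blast
    moreover have "x j \<in> {0, 1}" using x by (auto simp: image_subset_iff)
    ultimately have "{i. x i = 1} = {} \<and> x j = 0 \<or> {i. x i = 1} = {j} \<and> x j = 1" by blast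
    then show ?thesis unfolding sm_unitI_Some using x by auto
  qed
  show "sm unitI x = sm unitI y"
    if x: "range x \<subseteq> carr unitI" and y: "range y \<subseteq> carr unitI" and \<sigma>: "bij_betw \<sigma> (- I) (- J)"
      and I: "\<And>i. i \<in> I \<Longrightarrow> x i = zer unitI" and J: "\<And>j. j \<in> J \<Longrightarrow> y j = zer unitI"
      and eq: "\<And>i. i \<notin> I \<Longrightarrow> x i = y (\<sigma> i)" for x y I J and \<sigma> :: "nat \<Rightarrow> nat"
  proof -
    have xI: "{i. x i = 1} \<subseteq> - I" using I by fastforce
    have "{j. y j = 1} = \<sigma> ` {i. x i = 1}"
    proof
      show "\<sigma> ` {i. x i = 1} \<subseteq> {j. y j = 1}" using xI eq by auto
      show "{j. y j = 1} \<subseteq> \<sigma> ` {i. x i = 1}"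
      proof
        fix j assume j: "j \<in> {j. y j = 1}"
        then have "j \<notin> J" using J by fastforce
        then obtain i where "i \<notin> I" "j = \<sigma> i" using bij_betw_imp_surj_on [OF \<sigma>] by blast
        then show "j \<in> \<sigma> ` {i. x i = 1}" using eq j by auto
      qed
    qed
    moreover have "inj_on \<sigma> {i. x i = 1}" using \<sigma> xI by (auto simp: bij_betw_def intro: inj_on_subset)
    ultimately have "(\<exists>j. {i. y i = 1} = {j}) \<longleftrightarrow> (\<exists>j. {i. x i = 1} = {j})" "{i. y i = 1} = {} \<longleftrightarrow> {i. x i = 1} = {}"
      by (simp_all flip: card_1_singleton_iff One_nat_def add: card_image)
    then show ?thesis using x y by (intro option_eqI) (simp only: sm_unitI_Some carr_unitI)
  qed
  show "sm unitI x = dsum unitI (\<lambda>j k. x (\<sigma> (j, k)))"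
    if x: "range x \<subseteq> carr unitI" and \<sigma>: "bij \<sigma>" for x and \<sigma> :: "nat \<times> nat \<Rightarrow> nat"
  proof (rule option_eqI)
    fix v
    have s: "\<exists>j k. i = \<sigma> (j, k)" for i using \<sigma> by (metis bij_pointE surj_pair)
    have inj: "\<sigma> p = \<sigma> q \<longleftrightarrow> p = q" for p q using \<sigma> by (simp add: bij_def inj_eq)
    have rows: "range (\<lambda>k. x (\<sigma> (j, k))) \<subseteq> {0, 1}" for j using x by (auto simp: image_subset_iff)
    show "sm unitI x = Some v \<longleftrightarrow> dsum unitI (\<lambda>j k. x (\<sigma> (j, k))) = Some v"
    proof
      assume "sm unitI x = Some v"
      then consider "{i. x i = 1} = {}" "v = 0" | i where "{i. x i = 1} = {i}" "v = 1"
        unfolding sm_unitI_Some by blast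
      then show "dsum unitI (\<lambda>j k. x (\<sigma> (j, k))) = Some v"
      proof cases
        case 1
        then show ?thesis unfolding dsum_Some sm_unitI_Some using rows by (intro exI [of _ "\<lambda>_. 0"]) auto
      next
        case 2
        \<comment> \<open>The only one sits in row \<open>a\<close>, so the row sums are the
          indicator of \<open>a\<close>.\<close>
        obtain a b where i: "i = \<sigma> (a, b)" using s by blast
        have "x (\<sigma> (j, k)) = 1 \<longleftrightarrow> j = a \<and> k = b" for j k using 2 i inj by blast
        then have "sm unitI (\<lambda>k. x (\<sigma> (j, k))) = Some (if j = a then 1 else 0)" for j
          unfolding sm_unitI_Some using rows [of j] by (cases "j = a") auto
        moreover have "sm unitI (\<lambda>j. if j = a then 1 else 0) = Some v"
          unfolding sm_unitI_Some using 2 by auto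
        ultimately show ?thesis unfolding dsum_Some by (intro exI [of _ "\<lambda>j. if j = a then 1 else 0"]) auto
      qed
    next
      assume "dsum unitI (\<lambda>j k. x (\<sigma> (j, k))) = Some v"
      then obtain r where r: "\<And>j. sm unitI (\<lambda>k. x (\<sigma> (j, k))) = Some (r j)" "sm unitI r = Some v"
        unfolding dsum_Some by blast
      have row: "r j = 1 \<longleftrightarrow> (\<exists>k. {k. x (\<sigma> (j, k)) = 1} = {k})" "r j \<noteq> 1 \<Longrightarrow> {k. x (\<sigma> (j, k)) = 1} = {}" for j
        using r(1) [of j, unfolded sm_unitI_Some] by auto
      from r(2) consider "{j. r j = 1} = {}" "v = 0" | j where "{j. r j = 1} = {j}" "v = 1"
        unfolding sm_unitI_Some by blast
      then show "sm unitI x = Some v"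
      proof cases
        case 1
        then have "x (\<sigma> (j, k)) \<noteq> 1" for j k using row(2) [of j] by blast
        then have "x i \<noteq> 1" for i using s [of i] by auto
        then have "{i. x i = 1} = {}" by blast
        then show ?thesis unfolding sm_unitI_Some using x 1 by simp
      next
        case 2
        then obtain k where k: "{k. x (\<sigma> (j, k)) = 1} = {k}" using row(1) by blast
        have "x (\<sigma> (j', k')) = 1 \<longleftrightarrow> j' = j \<and> k' = k" for j' k'
        proof (cases "j' = j")
          case True
          then show ?thesis using k by blast
        next
          case False
          then have "{k. x (\<sigma> (j', k)) = 1} = {}" using 2(1) by (intro row(2)) blast
          then show ?thesis using False by blast
        qed
        then have "x i = 1 \<longleftrightarrow> i = \<sigma> (j, k)" for i using s [of i] inj by auto
        then have "{i. x i = 1} = {\<sigma> (j, k)}" by blast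
        then show ?thesis unfolding sm_unitI_Some using x 2 by simp
      qed
    qed
  qed
qed


subsection \<open>Bilinear maps and the tensor product\<close>

lemma bilinearD:
  assumes "bilinear M N L b"
  shows "x \<in> carr M \<Longrightarrow> y \<in> carr N \<Longrightarrow> b (x, y) \<in> carr L"
    and "sigma_monoid M \<Longrightarrow> y \<in> carr N \<Longrightarrow> b (zer M, y) = zer L"
    and "sigma_monoid N \<Longrightarrow> x \<in> carr M \<Longrightarrow> b (x, zer N) = zer L"
    and "sigma_monoid M \<Longrightarrow> y \<in> carr N \<Longrightarrow> sm M X = Some s \<Longrightarrow> sm L (\<lambda>i. b (X i, y)) = Some (b (s, y))"
    and "sigma_monoid N \<Longrightarrow> x \<in> carr M \<Longrightarrow> sm N Y = Some t \<Longrightarrow> sm L (\<lambda>i. b (x, Y i)) = Some (b (x, t))"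
proof -
  have l: "linear_map N L (\<lambda>y\<in>carr N. b (x, y))" if "x \<in> carr M" for x
    using assms that by (simp add: bilinear_def)
  have r: "linear_map M L (\<lambda>x\<in>carr M. b (x, y))" if "y \<in> carr N" for y
    using assms that by (simp add: bilinear_def)
  show "x \<in> carr M \<Longrightarrow> y \<in> carr N \<Longrightarrow> b (x, y) \<in> carr L"
    using assms by (auto simp: bilinear_def PiE_iff)
  show "sigma_monoid M \<Longrightarrow> y \<in> carr N \<Longrightarrow> b (zer M, y) = zer L"
    using linear_mapD(2) [OF r, of y] by (simp add: sigma_monoid.zer_closed)
  show "sigma_monoid N \<Longrightarrow> x \<in> carr M \<Longrightarrow> b (x, zer N) = zer L"
    using linear_mapD(2) [OF l, of x] by (simp add: sigma_monoid.zer_closed)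
  show "sm L (\<lambda>i. b (X i, y)) = Some (b (s, y))"
    if "sigma_monoid M" "y \<in> carr N" "sm M X = Some s"
    using linear_mapD(5) [OF r [OF that(2)] that(3)] sigma_monoid.sm_carr [OF that(1,3)]
    by simp
  show "sm L (\<lambda>i. b (x, Y i)) = Some (b (x, t))"
    if "sigma_monoid N" "x \<in> carr M" "sm N Y = Some t"
    using linear_mapD(5) [OF l [OF that(2)] that(3)] sigma_monoid.sm_carr [OF that(1,3)]
    by simp
qed

lemma bilinear_restrictI:
  assumes "sigma_monoid M" "sigma_monoid N"
    and "\<And>x y. x \<in> carr M \<Longrightarrow> y \<in> carr N \<Longrightarrow> f x y \<in> carr L"
    and "\<And>y. y \<in> carr N \<Longrightarrow> f (zer M) y = zer L"
    and "\<And>x. x \<in> carr M \<Longrightarrow> f x (zer N) = zer L"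
    and "\<And>X s y. y \<in> carr N \<Longrightarrow> sm M X = Some s \<Longrightarrow> sm L (\<lambda>i. f (X i) y) = Some (f s y)"
    and "\<And>x Y t. x \<in> carr M \<Longrightarrow> sm N Y = Some t \<Longrightarrow> sm L (\<lambda>i. f x (Y i)) = Some (f x t)"
  shows "bilinear M N L (\<lambda>(x, y)\<in>carr M \<times> carr N. f x y)"
  unfolding bilinear_def
proof (intro conjI ballI)
  fix x assume x: "x \<in> carr M"
  have "linear_map N L (\<lambda>y\<in>carr N. f x y)" by (rule linear_map_restrictI) (use assms x in auto)
  then show "linear_map N L (\<lambda>y\<in>carr N. (\<lambda>(x, y)\<in>carr M \<times> carr N. f x y) (x, y))"
    using x by (simp cong: restrict_cong)
next
  fix y assume y: "y \<in> carr N"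
  have "linear_map M L (\<lambda>x\<in>carr M. f x y)" by (rule linear_map_restrictI) (use assms y in auto)
  then show "linear_map M L (\<lambda>x\<in>carr M. (\<lambda>(x, y)\<in>carr M \<times> carr N. f x y) (x, y))"
    using y by (simp cong: restrict_cong)
qed (use assms in auto)

text \<open>The pair of zeros doubles as the padding symbol, so the generators are plain pairs and
  the classes have the type \<open>tens\<close> that was fixed in advance. \<open>zer_left\<close>
  and \<open>zer_right\<close> identify every pair with a zero component with it.\<close>

inductive tens_rel :: "'a smon \<Rightarrow> 'b smon \<Rightarrow> (nat \<Rightarrow> 'a \<times> 'b) \<Rightarrow> (nat \<Rightarrow> 'a \<times> 'b) \<Rightarrow> bool"
  for M N where
  zer_left: "y \<in> carr N \<Longrightarrow> tens_rel M N (single (zer M, zer N) (zer M, y)) (\<lambda>_. (zer M, zer N))"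
| zer_right: "x \<in> carr M \<Longrightarrow> tens_rel M N (single (zer M, zer N) (x, zer N)) (\<lambda>_. (zer M, zer N))"
| sum_left: "sm M X = Some s \<Longrightarrow> y \<in> carr N \<Longrightarrow>
    tens_rel M N (\<lambda>i. (X i, y)) (single (zer M, zer N) (s, y))"
| sum_right: "x \<in> carr M \<Longrightarrow> sm N Y = Some t \<Longrightarrow>
    tens_rel M N (\<lambda>i. (x, Y i)) (single (zer M, zer N) (x, t))"

abbreviation teq :: "'a smon \<Rightarrow> 'b smon \<Rightarrow> (nat \<Rightarrow> 'a \<times> 'b) \<Rightarrow> (nat \<Rightarrow> 'a \<times> 'b) \<Rightarrow> bool" where
  "teq M N \<equiv> gcong (zer M, zer N) (tens_rel M N)"

text \<open>The explicit model that provides a value for \<open>tensor_choice\<close>; its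
  properties are later carried over to \<open>M \<otimes> N\<close>.\<close>

definition tensor0 :: "'a smon \<Rightarrow> 'b smon \<Rightarrow> ('a, 'b) tens smon" where
  "tensor0 M N = presented (zer M, zer N) (tens_rel M N)"

definition pure0 :: "'a smon \<Rightarrow> 'b smon \<Rightarrow> 'a \<times> 'b \<Rightarrow> ('a, 'b) tens" where
  "pure0 M N = (\<lambda>p\<in>carr M \<times> carr N. cls (zer M, zer N) (tens_rel M N) (single (zer M, zer N) p))"

lemma bilinear_satisfies:
  assumes "sigma_monoid M" "sigma_monoid N" "sigma_monoid L" "bilinear M N L b"
  shows "satisfies L b (tens_rel M N)" "b (zer M, zer N) = zer L"
proof -
  interpret M: sigma_monoid M by fact
  interpret N: sigma_monoid N by fact
  interpret L: sigma_monoid L by fact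
  note b = bilinearD [OF assms(4)]
  show z: "b (zer M, zer N) = zer L" using b M.zer_closed assms by blast
  show "satisfies L b (tens_rel M N)"
    unfolding satisfies_def
  proof (intro allI impI)
    fix s t assume "tens_rel M N s t"
    then show "\<exists>v. sm L (b \<circ> s) = Some v \<and> sm L (b \<circ> t) = Some v"
    proof cases
      case (zer_left y)
      then show ?thesis using b assms z L.zer_closed by (simp add: comp_single) (simp add: comp_def)
    next
      case (zer_right x)
      then show ?thesis using b assms z L.zer_closed by (simp add: comp_single) (simp add: comp_def)
    next
      case (sum_left X s y)
      then show ?thesis using b(1,4) M.sm_carr(2) assms z by (auto simp: comp_single) (auto simp: comp_def)
    next
      case (sum_right x Y t)
      then show ?thesis using b(1,5) N.sm_carr(2) assms z by (auto simp: comp_single) (auto simp: comp_def)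
    qed
  qed
qed

lemma tens_rel_range:
  assumes "sigma_monoid M" "sigma_monoid N" "tens_rel M N s t"
  shows "range s \<subseteq> carr M \<times> carr N \<and> range t \<subseteq> carr M \<times> carr N"
  using assms(3)
proof cases
  case (sum_left X s y)
  then show ?thesis using sigma_monoid.zer_closed [OF assms(1)] sigma_monoid.zer_closed [OF assms(2)]
      sigma_monoid.sm_carr [OF assms(1) sum_left(3)] by (auto simp: range_single)
next
  case (sum_right x Y t)
  then show ?thesis using sigma_monoid.zer_closed [OF assms(1)] sigma_monoid.zer_closed [OF assms(2)]
      sigma_monoid.sm_carr [OF assms(2) sum_right(4)] by (auto simp: range_single)
qed (use sigma_monoid.zer_closed [OF assms(1)] sigma_monoid.zer_closed [OF assms(2)] in \<open>auto simp: range_single\<close>)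

lemma teq_range:
  assumes "sigma_monoid M" "sigma_monoid N" "teq M N s t"
  shows "range s \<subseteq> carr M \<times> carr N" "range t \<subseteq> carr M \<times> carr N"
  using gcong_range [OF assms(3), of "carr M \<times> carr N"] tens_rel_range [OF assms(1,2)]
    sigma_monoid.zer_closed [OF assms(1)] sigma_monoid.zer_closed [OF assms(2)] by auto

lemma teq_single:
  assumes "sigma_monoid M" "sigma_monoid N" "x \<in> carr M" "y \<in> carr N"
  shows "teq M N (single (zer M, zer N) (x, y)) (single (zer M, zer N) (x, y))"
  by (rule gcong_refl(2), rule gcong.base, rule tens_rel.sum_left)
    (use assms sigma_monoid.sm_sing in auto)

lemma tensor0_lift:
  assumes "sigma_monoid M" "sigma_monoid N" "sigma_monoid L" "bilinear M N L b"
  shows "\<exists>h. linear_map (tensor0 M N) L h \<and> (\<forall>x\<in>carr M. \<forall>y\<in>carr N. h (pure0 M N (x, y)) = b (x, y))"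
  using presented_lift [OF assms(3) bilinear_satisfies [OF assms]] teq_single [OF assms(1,2)]
  unfolding tensor0_def pure0_def by (intro exI conjI) (auto simp del: split_paired_All)

lemma sm_pure0:
  assumes "sigma_monoid M" "sigma_monoid N" "range s \<subseteq> carr M \<times> carr N"
  shows "sm (tensor0 M N) (pure0 M N \<circ> s) =
    (if teq M N s s then Some (cls (zer M, zer N) (tens_rel M N) s) else None)"
proof -
  have s: "s i \<in> carr M \<times> carr N" for i using assms(3) by auto
  then have "teq M N (single (zer M, zer N) (s i)) (single (zer M, zer N) (s i))" for i
    using teq_single [OF assms(1,2)] by (metis mem_Sigma_iff prod.collapse)
  from sm_presented_gen [OF this] s show ?thesis by (simp add: tensor0_def pure0_def comp_def)
qed

lemma tensor0_gen:
  assumes "sigma_monoid M" "sigma_monoid N" "u \<in> carr (tensor0 M N)"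
  shows "\<exists>s. range s \<subseteq> carr M \<times> carr N \<and> sm (tensor0 M N) (pure0 M N \<circ> s) = Some u"
proof -
  obtain s where s: "teq M N s s" "u = cls (zer M, zer N) (tens_rel M N) s"
    using assms(3) by (auto simp: tensor0_def carr_presented)
  then show ?thesis using teq_range [OF assms(1,2) s(1)] sm_pure0 [OF assms(1,2), of s] by auto
qed

lemma bilinear_pure0:
  assumes "sigma_monoid M" "sigma_monoid N"
  shows "bilinear M N (tensor0 M N) (pure0 M N)"
proof -
  interpret M: sigma_monoid M by fact
  interpret N: sigma_monoid N by fact
  let ?z = "(zer M, zer N)"
  let ?f = "\<lambda>x y. cls ?z (tens_rel M N) (single ?z (x, y))"
  note tsing = teq_single [OF assms]
  have eq: "teq M N s t \<Longrightarrow> cls ?z (tens_rel M N) s = cls ?z (tens_rel M N) t" for s t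
    using cls_eq gcong_refl by metis
  have "bilinear M N (tensor0 M N) (\<lambda>(x, y)\<in>carr M \<times> carr N. ?f x y)"
  proof (rule bilinear_restrictI)
    show "?f x y \<in> carr (tensor0 M N)" if "x \<in> carr M" "y \<in> carr N" for x y
      using tsing that by (auto simp: tensor0_def carr_presented)
    show "?f (zer M) y = zer (tensor0 M N)" if "y \<in> carr N" for y
      unfolding tensor0_def zer_presented using that by (intro eq gcong.base tens_rel.intros)
    show "?f x (zer N) = zer (tensor0 M N)" if "x \<in> carr M" for x
      unfolding tensor0_def zer_presented using that by (intro eq gcong.base tens_rel.intros)
    show "sm (tensor0 M N) (\<lambda>i. ?f (X i) y) = Some (?f s y)"
      if y: "y \<in> carr N" and X: "sm M X = Some s" for X s y
    proof -
      have t: "teq M N (\<lambda>i. (X i, y)) (single ?z (s, y))"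
        using that by (intro gcong.base tens_rel.intros)
      show ?thesis
        unfolding tensor0_def
        by (subst sm_presented_gen) (use tsing y M.sm_carr(1) [OF X] t gcong_refl(1) [OF t] eq in auto)
    qed
    show "sm (tensor0 M N) (\<lambda>i. ?f x (Y i)) = Some (?f x t)"
      if x: "x \<in> carr M" and Y: "sm N Y = Some t" for Y t x
    proof -
      have t: "teq M N (\<lambda>i. (x, Y i)) (single ?z (x, t))"
        using that by (intro gcong.base tens_rel.intros)
      show ?thesis
        unfolding tensor0_def
        by (subst sm_presented_gen) (use tsing x N.sm_carr(1) [OF Y] t gcong_refl(1) [OF t] eq in auto)
    qed
  qed (rule assms)+
  moreover have "(\<lambda>(x, y)\<in>carr M \<times> carr N. ?f x y) = pure0 M N"
    by (auto simp: pure0_def fun_eq_iff restrict_def)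
  ultimately show ?thesis by simp
qed

lemma linear_map_ext_gen:
  assumes f: "linear_map T L f" and g: "linear_map T L g"
    and "sm T (t \<circ> s) = Some u" and "\<And>i. f (t (s i)) = g (t (s i))"
  shows "f u = g u"
proof -
  have "f \<circ> (t \<circ> s) = g \<circ> (t \<circ> s)" using assms(4) by auto
  then show ?thesis
    using linear_mapD(4) [OF f assms(3)] linear_mapD(4) [OF g assms(3)] by simp
qed

lemma tensor_ext_gen:
  assumes gen: "\<And>u. u \<in> carr T \<Longrightarrow> \<exists>s. range s \<subseteq> carr M \<times> carr N \<and> sm T (t \<circ> s) = Some u"
    and f: "linear_map T L f" and g: "linear_map T L g"
    and eq: "\<And>x y. x \<in> carr M \<Longrightarrow> y \<in> carr N \<Longrightarrow> f (t (x, y)) = g (t (x, y))"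
    and u: "u \<in> carr T"
  shows "f u = g u"
proof -
  obtain s where s: "range s \<subseteq> carr M \<times> carr N" "sm T (t \<circ> s) = Some u" using gen [OF u] by blast
  then have "s i \<in> carr M \<times> carr N" for i by auto
  then have "f (t (s i)) = g (t (s i))" for i using eq by (metis mem_Sigma_iff prod.collapse)
  then show ?thesis by (rule linear_map_ext_gen [OF f g s(2)])
qed

text \<open>Uniqueness follows from generation by pure tensors; only existence has to be supplied
  separately for each type of targets.\<close>

lemma represents_bilinearI:
  assumes T: "sigma_monoid T" "bilinear M N T t"
    and gen: "\<And>u. u \<in> carr T \<Longrightarrow> \<exists>s. range s \<subseteq> carr M \<times> carr N \<and> sm T (t \<circ> s) = Some u"
    and lift: "\<And>(L :: 'l smon) b. sigma_monoid L \<Longrightarrow> bilinear M N L b \<Longrightarrow>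
      \<exists>h. linear_map T L h \<and> (\<forall>x\<in>carr M. \<forall>y\<in>carr N. h (t (x, y)) = b (x, y))"
  shows "represents_bilinear TYPE('l) M N T t"
  unfolding represents_bilinear_def
proof (intro conjI allI impI T)
  fix L :: "'l smon" and b assume "sigma_monoid L \<and> bilinear M N L b"
  with lift obtain h where h: "linear_map T L h"
    "\<And>x y. x \<in> carr M \<Longrightarrow> y \<in> carr N \<Longrightarrow> h (t (x, y)) = b (x, y)" by blast
  show "\<exists>!h. h \<in> Hom T L \<and> (\<forall>p\<in>carr M \<times> carr N. fn h (t p) = b p)"
  proof (rule ex1I [of _ "\<lparr>src = T, tgt = L, fn = h\<rparr>"])
    show "\<lparr>src = T, tgt = L, fn = h\<rparr> \<in> Hom T L \<and>
      (\<forall>p\<in>carr M \<times> carr N. fn \<lparr>src = T, tgt = L, fn = h\<rparr> (t p) = b p)"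
      using h by (auto simp: Hom_def)
    fix k assume k: "k \<in> Hom T L \<and> (\<forall>p\<in>carr M \<times> carr N. fn k (t p) = b p)"
    have "fn k u = h u" if u: "u \<in> carr T" for u
      by (rule tensor_ext_gen [OF gen _ h(1) _ u]) (use k h(2) in \<open>auto simp: Hom_def\<close>)
    then have "fn k = h" using k h by (intro linear_map_ext) (auto simp: Hom_def)
    then show "k = \<lparr>src = T, tgt = L, fn = h\<rparr>" using k by (auto simp: Hom_def)
  qed
qed

lemma represents_tensor0:
  assumes "sigma_monoid M" "sigma_monoid N"
  shows "represents_bilinear TYPE('l) M N (tensor0 M N) (pure0 M N)"
  by (rule represents_bilinearI)
    (use bilinear_pure0 tensor0_gen tensor0_lift assms in \<open>auto simp: tensor0_def sigma_monoid_presented\<close>)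

section \<open>Comparison of the chosen tensor product with the explicit model\<close>

lemma represents_tensor_same_type:
  assumes "sigma_monoid M" "sigma_monoid N"
  shows "represents_bilinear TYPE(('a, 'b) tens) (M :: 'a smon) (N :: 'b smon) (M \<otimes> N) (pure_tensor M N)"
  unfolding tensor_def pure_tensor_def tensor_choice_def
  by (rule someI [of "\<lambda>p. represents_bilinear TYPE(('a, 'b) tens) M N (fst p) (snd p)" "(tensor0 M N, pure0 M N)"])
    (use represents_tensor0 [OF assms] in simp)

text \<open>Both objects live on the type \<open>tens\<close>, so each is an admissible target for
  the universal property of the other, although at this point the chosen one is known to be
  universal for that type only.\<close>

lemma tensor_tensor0_iso:
  assumes M: "sigma_monoid M" and N: "sigma_monoid N"
  obtains \<phi> \<psi> where "arr \<phi>" "src \<phi> = tensor0 M N" "tgt \<phi> = M \<otimes> N" "arr \<psi>" "src \<psi> = M \<otimes> N" "tgt \<psi> = tensor0 M N"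
    "\<phi> \<odot> \<psi> = ident (M \<otimes> N)"
    "\<And>p. p \<in> carr M \<times> carr N \<Longrightarrow> fn \<phi> (pure0 M N p) = pure_tensor M N p"
    "\<And>p. p \<in> carr M \<times> carr N \<Longrightarrow> fn \<psi> (pure_tensor M N p) = pure0 M N p"
    "sigma_monoid (M \<otimes> N)" "bilinear M N (M \<otimes> N) (pure_tensor M N)"
proof -
  note r0 = represents_tensor0 [OF assms, unfolded represents_bilinear_def]
  note r1 = represents_tensor_same_type [OF assms, unfolded represents_bilinear_def]
  have T0: "sigma_monoid (tensor0 M N)" "bilinear M N (tensor0 M N) (pure0 M N)" using r0 by blast+
  have T1: "sigma_monoid (M \<otimes> N)" "bilinear M N (M \<otimes> N) (pure_tensor M N)" using r1 by blast+
  obtain \<phi> where \<phi>: "\<phi> \<in> Hom (tensor0 M N) (M \<otimes> N)"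
    "\<And>p. p \<in> carr M \<times> carr N \<Longrightarrow> fn \<phi> (pure0 M N p) = pure_tensor M N p"
    using r0 T1 by blast
  obtain \<psi> where \<psi>: "\<psi> \<in> Hom (M \<otimes> N) (tensor0 M N)"
    "\<And>p. p \<in> carr M \<times> carr N \<Longrightarrow> fn \<psi> (pure_tensor M N p) = pure0 M N p"
    using r1 T0 by blast
  note a = Hom_arr [OF T0(1) T1(1)] Hom_arr [OF T1(1) T0(1)] Hom_arr [OF T0(1) T0(1)] Hom_arr [OF T1(1) T1(1)]
  have p1: "pure_tensor M N p \<in> carr (M \<otimes> N)" if "p \<in> carr M \<times> carr N" for p
    using bilinearD(1) [OF T1(2)] that by (cases p) auto
  have u1: "f = g" if "f \<in> Hom (M \<otimes> N) (M \<otimes> N)" "\<forall>p\<in>carr M \<times> carr N. fn f (pure_tensor M N p) = pure_tensor M N p"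
    "g \<in> Hom (M \<otimes> N) (M \<otimes> N)" "\<forall>p\<in>carr M \<times> carr N. fn g (pure_tensor M N p) = pure_tensor M N p" for f g
    using that r1 T1 by blast
  have 2: "\<phi> \<odot> \<psi> = ident (M \<otimes> N)"
    by (rule u1) (use \<phi> \<psi> T0 T1 p1 in \<open>auto simp: a fn_ident fn_comp\<close>)
  show thesis
    by (rule that [of \<phi> \<psi>]) (use \<phi> \<psi> T1 2 in \<open>auto simp: a\<close>)
qed

lemma sigma_monoid_tensor [simp]: "sigma_monoid M \<Longrightarrow> sigma_monoid N \<Longrightarrow> sigma_monoid (M \<otimes> N)"
  by (erule (1) tensor_tensor0_iso)

lemma bilinear_pure: "sigma_monoid M \<Longrightarrow> sigma_monoid N \<Longrightarrow> bilinear M N (M \<otimes> N) (pure_tensor M N)"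
  by (erule (1) tensor_tensor0_iso)

text \<open>A decomposition is found for the image under \<open>\<psi>\<close> and brought back by
  \<open>\<phi>\<close>, of which \<open>\<psi>\<close> is a section.\<close>

lemma tensor_gen:
  assumes "sigma_monoid M" "sigma_monoid N" "u \<in> carr (M \<otimes> N)"
  shows "\<exists>s. range s \<subseteq> carr M \<times> carr N \<and> sm (M \<otimes> N) (pure_tensor M N \<circ> s) = Some u"
proof -
  obtain \<phi> \<psi> where *: "arr \<phi>" "src \<phi> = tensor0 M N" "tgt \<phi> = M \<otimes> N" "arr \<psi>" "src \<psi> = M \<otimes> N" "tgt \<psi> = tensor0 M N"
    "\<phi> \<odot> \<psi> = ident (M \<otimes> N)" "\<And>p. p \<in> carr M \<times> carr N \<Longrightarrow> fn \<phi> (pure0 M N p) = pure_tensor M N p"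
    by (rule tensor_tensor0_iso [OF assms(1,2)]) blast
  have "fn \<psi> u \<in> carr (tensor0 M N)" using arrD(4) [OF *(4)] assms(3) * by simp
  then obtain s where s: "range s \<subseteq> carr M \<times> carr N" "sm (tensor0 M N) (pure0 M N \<circ> s) = Some (fn \<psi> u)"
    using tensor0_gen [OF assms(1,2)] by blast
  have "sm (M \<otimes> N) (\<lambda>i. fn \<phi> (pure0 M N (s i))) = Some (fn \<phi> (fn \<psi> u))"
    using sm_arr [OF *(1)] s(2) * by (simp add: comp_def)
  moreover have "fn \<phi> (fn \<psi> u) = u" using fn_comp [of u \<psi> \<phi>] * assms(3) by (simp add: fn_ident)
  moreover have "fn \<phi> (pure0 M N (s i)) = pure_tensor M N (s i)" for i using *(8) s(1) by blast
  ultimately show ?thesis using s(1) by (auto simp: comp_def)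
qed

text \<open>From left to right this is soundness; from right to left the equation is transported to
  \<open>tensor0\<close>, whose equality is derivability by construction. Thus an equation in the
  abstractly chosen tensor product comes with a derivation that can be analysed.\<close>

lemma teq_pure:
  assumes "sigma_monoid M" "sigma_monoid N" "range s \<subseteq> carr M \<times> carr N" "range t \<subseteq> carr M \<times> carr N"
  shows "teq M N s t \<longleftrightarrow>
    (\<exists>u. sm (M \<otimes> N) (pure_tensor M N \<circ> s) = Some u \<and> sm (M \<otimes> N) (pure_tensor M N \<circ> t) = Some u)"
proof
  assume "teq M N s t"
  then show "\<exists>u. sm (M \<otimes> N) (pure_tensor M N \<circ> s) = Some u \<and> sm (M \<otimes> N) (pure_tensor M N \<circ> t) = Some u"
    using bilinear_satisfies [OF assms(1,2) sigma_monoid_tensor [OF assms(1,2)] bilinear_pure [OF assms(1,2)]]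
    by (intro satisfies_gcong sigma_monoid_tensor assms)
next
  assume "\<exists>u. sm (M \<otimes> N) (pure_tensor M N \<circ> s) = Some u \<and> sm (M \<otimes> N) (pure_tensor M N \<circ> t) = Some u"
  then obtain u where u: "sm (M \<otimes> N) (pure_tensor M N \<circ> s) = Some u" "sm (M \<otimes> N) (pure_tensor M N \<circ> t) = Some u" by blast
  obtain \<phi> \<psi> where *: "arr \<psi>" "src \<psi> = M \<otimes> N" "tgt \<psi> = tensor0 M N"
    "\<And>p. p \<in> carr M \<times> carr N \<Longrightarrow> fn \<psi> (pure_tensor M N p) = pure0 M N p"
    by (rule tensor_tensor0_iso [OF assms(1,2)]) blast
  have "sm (tensor0 M N) (pure0 M N \<circ> r) = Some (fn \<psi> u)"
    if "range r \<subseteq> carr M \<times> carr N" "sm (M \<otimes> N) (pure_tensor M N \<circ> r) = Some u" for r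
  proof -
    have "fn \<psi> (pure_tensor M N (r i)) = pure0 M N (r i)" for i using *(4) that(1) by blast
    then show ?thesis using sm_arr [OF *(1), of "pure_tensor M N \<circ> r" u] that(2) * by (simp add: comp_def)
  qed
  from this [OF assms(3) u(1)] this [OF assms(4) u(2)] show "teq M N s t"
    using sm_pure0 [OF assms(1,2,3)] sm_pure0 [OF assms(1,2,4)] by (metis cls_eq option.distinct(1) option.inject)
qed

lemma tensor_lift:
  assumes "sigma_monoid M" "sigma_monoid N" "sigma_monoid L" "bilinear M N L b"
  shows "\<exists>h. linear_map (M \<otimes> N) L h \<and> (\<forall>x\<in>carr M. \<forall>y\<in>carr N. h (pure_tensor M N (x, y)) = b (x, y))"
proof -
  obtain h where h: "linear_map (tensor0 M N) L h"
    "\<And>x y. x \<in> carr M \<Longrightarrow> y \<in> carr N \<Longrightarrow> h (pure0 M N (x, y)) = b (x, y)"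
    using tensor0_lift [OF assms] by blast
  obtain \<phi> \<psi> where *: "arr \<psi>" "src \<psi> = M \<otimes> N" "tgt \<psi> = tensor0 M N"
    "\<And>p. p \<in> carr M \<times> carr N \<Longrightarrow> fn \<psi> (pure_tensor M N p) = pure0 M N p"
    by (rule tensor_tensor0_iso [OF assms(1,2)]) blast
  have "linear_map (M \<otimes> N) L (compose (carr (M \<otimes> N)) h (fn \<psi>))"
    using arrD(3) [OF *(1)] * h(1) assms by (intro linear_map_compose) auto
  moreover have "pure_tensor M N (x, y) \<in> carr (M \<otimes> N)" if "x \<in> carr M" "y \<in> carr N" for x y
    by (rule bilinearD(1) [OF bilinear_pure [OF assms(1,2)] that])
  ultimately show ?thesis using h(2) * by (intro exI conjI) (auto simp: compose_def)
qed

lemma pure_closed [simp]: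
  "sigma_monoid M \<Longrightarrow> sigma_monoid N \<Longrightarrow> x \<in> carr M \<Longrightarrow> y \<in> carr N \<Longrightarrow> pure_tensor M N (x, y) \<in> carr (M \<otimes> N)"
  by (rule bilinearD(1) [OF bilinear_pure])

lemma tensor_ext:
  assumes "sigma_monoid M" "sigma_monoid N" "linear_map (M \<otimes> N) L f" "linear_map (M \<otimes> N) L g"
    and "\<And>x y. x \<in> carr M \<Longrightarrow> y \<in> carr N \<Longrightarrow> f (pure_tensor M N (x, y)) = g (pure_tensor M N (x, y))"
    and "u \<in> carr (M \<otimes> N)"
  shows "f u = g u"
  by (rule tensor_ext_gen [OF tensor_gen [OF assms(1,2)] assms(3-6)])

lemma represents_tensor:
  assumes "sigma_monoid M" "sigma_monoid N"
  shows "represents_bilinear TYPE('l) M N (M \<otimes> N) (pure_tensor M N)"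
  by (rule represents_bilinearI) (use bilinear_pure tensor_gen tensor_lift assms in auto)

subsection \<open>The monoidal structure\<close>

text \<open>Keeps the element \<open>1\<close> of \<open>unitI\<close> from turning into
  \<open>Suc 0\<close>, so that the rules about pure tensors with scalar \<open>1\<close> keep
  matching.\<close>

declare One_nat_def [simp del]

lemma arr_closed: "arr f \<Longrightarrow> tgt f = N \<Longrightarrow> x \<in> carr (src f) \<Longrightarrow> fn f x \<in> carr N"
  using arrD(4) [of f x] by simp

text \<open>Fixing one factor gives an arrow out of the other. Equality of arrows on an iterated
  tensor product is thereby checked one tensor sign at a time: the inner argument is reduced to pure
  tensors while the outer one stays fixed.\<close>

definition lpart :: "'a smon \<Rightarrow> 'b smon \<Rightarrow> (('a, 'b) tens, 'c) arrow \<Rightarrow> 'b \<Rightarrow> ('a, 'c) arrow" where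
  "lpart M N f y = \<lparr>src = M, tgt = tgt f, fn = (\<lambda>x\<in>carr M. fn f (pure_tensor M N (x, y)))\<rparr>"

definition rpart :: "'a smon \<Rightarrow> 'b smon \<Rightarrow> (('a, 'b) tens, 'c) arrow \<Rightarrow> 'a \<Rightarrow> ('b, 'c) arrow" where
  "rpart M N f x = \<lparr>src = N, tgt = tgt f, fn = (\<lambda>y\<in>carr N. fn f (pure_tensor M N (x, y)))\<rparr>"

lemma part_simps [simp]:
  "src (lpart M N f y) = M" "tgt (lpart M N f y) = tgt f"
  "x \<in> carr M \<Longrightarrow> fn (lpart M N f y) x = fn f (pure_tensor M N (x, y))"
  "src (rpart M N f x) = N" "tgt (rpart M N f x) = tgt f"
  "y \<in> carr N \<Longrightarrow> fn (rpart M N f x) y = fn f (pure_tensor M N (x, y))"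
  by (simp_all add: lpart_def rpart_def)

lemma arr_lpart [simp]:
  assumes M: "sigma_monoid M" and N: "sigma_monoid N" and f: "arr f" "src f = M \<otimes> N" and y: "y \<in> carr N"
  shows "arr (lpart M N f y)"
  unfolding lpart_def
proof (rule arr_mk)
  note b = bilinearD [OF bilinear_pure [OF M N]]
  show "linear_map M (tgt f) (\<lambda>x\<in>carr M. fn f (pure_tensor M N (x, y)))"
    by (rule linear_map_restrictI)
      (use assms b(2,4) zer_arr [OF f(1)] sm_arr [OF f(1)] in \<open>auto intro!: arr_closed\<close>)
qed (use assms arrD in auto)

lemma arr_rpart [simp]:
  assumes M: "sigma_monoid M" and N: "sigma_monoid N" and f: "arr f" "src f = M \<otimes> N" and x: "x \<in> carr M"
  shows "arr (rpart M N f x)"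
  unfolding rpart_def
proof (rule arr_mk)
  note b = bilinearD [OF bilinear_pure [OF M N]]
  show "linear_map N (tgt f) (\<lambda>y\<in>carr N. fn f (pure_tensor M N (x, y)))"
    by (rule linear_map_restrictI)
      (use assms b(3,5) zer_arr [OF f(1)] sm_arr [OF f(1)] in \<open>auto intro!: arr_closed\<close>)
qed (use assms arrD in auto)

lemma arr_ext2:
  assumes M: "sigma_monoid M" and N: "sigma_monoid N"
    and f: "arr f" "src f = M \<otimes> N" and g: "arr g" "src g = M \<otimes> N" "tgt f = tgt g"
    and "\<And>x y. x \<in> carr M \<Longrightarrow> y \<in> carr N \<Longrightarrow> fn f (pure_tensor M N (x, y)) = fn g (pure_tensor M N (x, y))"
  shows "f = g"
  by (rule arr_eqI) (use assms arrD(3) [OF f(1)] arrD(3) [OF g(1)] in \<open>auto intro: tensor_ext\<close>)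

lemma arr_ext3_left:
  assumes L: "sigma_monoid L" and M: "sigma_monoid M" and N: "sigma_monoid N"
    and f: "arr f" "src f = (L \<otimes> M) \<otimes> N" and g: "arr g" "src g = (L \<otimes> M) \<otimes> N" "tgt f = tgt g"
    and eq: "\<And>x y z. x \<in> carr L \<Longrightarrow> y \<in> carr M \<Longrightarrow> z \<in> carr N \<Longrightarrow>
      fn f (pure_tensor (L \<otimes> M) N (pure_tensor L M (x, y), z)) = fn g (pure_tensor (L \<otimes> M) N (pure_tensor L M (x, y), z))"
  shows "f = g"
proof (rule arr_ext2 [OF sigma_monoid_tensor [OF L M] N])
  fix u z assume u: "u \<in> carr (L \<otimes> M)" and z: "z \<in> carr N"
  have "lpart (L \<otimes> M) N f z = lpart (L \<otimes> M) N g z"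
    by (rule arr_ext2 [OF L M]) (use assms z in auto)
  then have "fn (lpart (L \<otimes> M) N f z) u = fn (lpart (L \<otimes> M) N g z) u" by simp
  then show "fn f (pure_tensor (L \<otimes> M) N (u, z)) = fn g (pure_tensor (L \<otimes> M) N (u, z))"
    using u by simp
qed (use assms in auto)

lemma arr_ext3_right:
  assumes L: "sigma_monoid L" and M: "sigma_monoid M" and N: "sigma_monoid N"
    and f: "arr f" "src f = L \<otimes> (M \<otimes> N)" and g: "arr g" "src g = L \<otimes> (M \<otimes> N)" "tgt f = tgt g"
    and eq: "\<And>x y z. x \<in> carr L \<Longrightarrow> y \<in> carr M \<Longrightarrow> z \<in> carr N \<Longrightarrow>
      fn f (pure_tensor L (M \<otimes> N) (x, pure_tensor M N (y, z))) = fn g (pure_tensor L (M \<otimes> N) (x, pure_tensor M N (y, z)))"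
  shows "f = g"
proof (rule arr_ext2 [OF L sigma_monoid_tensor [OF M N]])
  fix u x assume u: "u \<in> carr (M \<otimes> N)" and x: "x \<in> carr L"
  have "rpart L (M \<otimes> N) f x = rpart L (M \<otimes> N) g x"
    by (rule arr_ext2 [OF M N]) (use assms x in auto)
  then have "fn (rpart L (M \<otimes> N) f x) u = fn (rpart L (M \<otimes> N) g x) u" by simp
  then show "fn f (pure_tensor L (M \<otimes> N) (x, u)) = fn g (pure_tensor L (M \<otimes> N) (x, u))"
    using u by simp
qed (use assms in auto)

lemma arr_ext4:
  assumes K: "sigma_monoid K" and L: "sigma_monoid L" and M: "sigma_monoid M" and N: "sigma_monoid N"
    and f: "arr f" "src f = ((K \<otimes> L) \<otimes> M) \<otimes> N" and g: "arr g" "src g = ((K \<otimes> L) \<otimes> M) \<otimes> N" "tgt f = tgt g"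
    and eq: "\<And>w x y z. w \<in> carr K \<Longrightarrow> x \<in> carr L \<Longrightarrow> y \<in> carr M \<Longrightarrow> z \<in> carr N \<Longrightarrow>
      fn f (pure_tensor ((K \<otimes> L) \<otimes> M) N (pure_tensor (K \<otimes> L) M (pure_tensor K L (w, x), y), z)) =
      fn g (pure_tensor ((K \<otimes> L) \<otimes> M) N (pure_tensor (K \<otimes> L) M (pure_tensor K L (w, x), y), z))"
  shows "f = g"
proof (rule arr_ext2 [OF sigma_monoid_tensor [OF sigma_monoid_tensor [OF K L] M] N])
  let ?T = "(K \<otimes> L) \<otimes> M"
  fix u z assume u: "u \<in> carr ?T" and z: "z \<in> carr N"
  have "lpart ?T N f z = lpart ?T N g z"
    by (rule arr_ext3_left [OF K L M]) (use assms z in auto)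
  then have "fn (lpart ?T N f z) u = fn (lpart ?T N g z) u" by simp
  then show "fn f (pure_tensor ?T N (u, z)) = fn g (pure_tensor ?T N (u, z))"
    using u by simp
qed (use assms in auto)

section \<open>Structure maps from the universal property\<close>

lemma tensor_univ:
  assumes "sigma_monoid M" "sigma_monoid N" "sigma_monoid L"
    and "\<And>x y. x \<in> carr M \<Longrightarrow> y \<in> carr N \<Longrightarrow> f x y \<in> carr L"
    and "\<And>y. y \<in> carr N \<Longrightarrow> f (zer M) y = zer L"
    and "\<And>x. x \<in> carr M \<Longrightarrow> f x (zer N) = zer L"
    and "\<And>X s y. y \<in> carr N \<Longrightarrow> sm M X = Some s \<Longrightarrow> sm L (\<lambda>i. f (X i) y) = Some (f s y)"
    and "\<And>x Y t. x \<in> carr M \<Longrightarrow> sm N Y = Some t \<Longrightarrow> sm L (\<lambda>i. f x (Y i)) = Some (f x t)"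
  shows "\<exists>!h. h \<in> Hom (M \<otimes> N) L \<and> (\<forall>x\<in>carr M. \<forall>y\<in>carr N. fn h (pure_tensor M N (x, y)) = f x y)"
proof -
  have "bilinear M N L (\<lambda>(x, y)\<in>carr M \<times> carr N. f x y)"
    by (rule bilinear_restrictI) (use assms in auto)
  with represents_tensor [OF assms(1,2)] assms(3)
  have "\<exists>!h. h \<in> Hom (M \<otimes> N) L \<and> (\<forall>p\<in>carr M \<times> carr N.
      fn h (pure_tensor M N p) = (\<lambda>(x, y)\<in>carr M \<times> carr N. f x y) p)"
    unfolding represents_bilinear_def by blast
  then show ?thesis by simp
qed

lemma tmap_props:
  assumes f: "arr f" and g: "arr g"
  shows "f \<otimes>\<^sub>m g \<in> Hom (src f \<otimes> src g) (tgt f \<otimes> tgt g)"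
    and "x \<in> carr (src f) \<Longrightarrow> y \<in> carr (src g) \<Longrightarrow>
      fn (f \<otimes>\<^sub>m g) (pure_tensor (src f) (src g) (x, y)) = pure_tensor (tgt f) (tgt g) (fn f x, fn g y)"
proof -
  note s = arrD(1,2) [OF f] arrD(1,2) [OF g]
  note b = bilinearD [OF bilinear_pure [OF s(2,4)]]
  have "\<exists>!h. h \<in> Hom (src f \<otimes> src g) (tgt f \<otimes> tgt g) \<and> (\<forall>x\<in>carr (src f). \<forall>y\<in>carr (src g).
      fn h (pure_tensor (src f) (src g) (x, y)) = pure_tensor (tgt f) (tgt g) (fn f x, fn g y))"
    by (rule tensor_univ)
      (use s b f g in \<open>auto simp: zer_arr sm_arr arr_closed\<close>)
  from theI' [OF this] show "f \<otimes>\<^sub>m g \<in> Hom (src f \<otimes> src g) (tgt f \<otimes> tgt g)"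
    and "x \<in> carr (src f) \<Longrightarrow> y \<in> carr (src g) \<Longrightarrow>
      fn (f \<otimes>\<^sub>m g) (pure_tensor (src f) (src g) (x, y)) = pure_tensor (tgt f) (tgt g) (fn f x, fn g y)"
    by (auto simp: tmap_def)
qed

lemma arr_tmap [simp]: "arr f \<Longrightarrow> arr g \<Longrightarrow> arr (f \<otimes>\<^sub>m g)"
  and src_tmap [simp]: "arr f \<Longrightarrow> arr g \<Longrightarrow> src (f \<otimes>\<^sub>m g) = src f \<otimes> src g"
  and tgt_tmap [simp]: "arr f \<Longrightarrow> arr g \<Longrightarrow> tgt (f \<otimes>\<^sub>m g) = tgt f \<otimes> tgt g"
proof -
  assume f: "arr f" "arr g"
  note s = arrD(1,2) [OF f(1)] arrD(1,2) [OF f(2)]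
  from tmap_props(1) [OF f] show "arr (f \<otimes>\<^sub>m g)" "src (f \<otimes>\<^sub>m g) = src f \<otimes> src g" "tgt (f \<otimes>\<^sub>m g) = tgt f \<otimes> tgt g"
    using s by (auto simp: Hom_arr)
qed

lemma tmap_pure [simp]:
  "arr f \<Longrightarrow> arr g \<Longrightarrow> src f = M \<Longrightarrow> src g = N \<Longrightarrow> x \<in> carr M \<Longrightarrow> y \<in> carr N \<Longrightarrow>
    fn (f \<otimes>\<^sub>m g) (pure_tensor M N (x, y)) = pure_tensor (tgt f) (tgt g) (fn f x, fn g y)"
  using tmap_props(2) [of f g x y] by simp

lemma tmap_comp:
  assumes "arr f" "arr g" "arr f'" "arr g'" "src f' = tgt f" "src g' = tgt g"
  shows "(f' \<otimes>\<^sub>m g') \<odot> (f \<otimes>\<^sub>m g) = (f' \<odot> f) \<otimes>\<^sub>m (g' \<odot> g)"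
  by (rule arr_ext2 [of "src f" "src g"])
    (use assms in \<open>auto simp: arrD fn_comp arr_closed\<close>)

lemma tmap_ident:
  assumes "sigma_monoid M" "sigma_monoid N"
  shows "ident M \<otimes>\<^sub>m ident N = ident (M \<otimes> N)"
  by (rule arr_ext2 [of M N]) (use assms in \<open>auto simp: fn_ident\<close>)

text \<open>A map that is linear in \<open>u\<close>, and linear in \<open>z\<close> for pure \<open>u\<close>, is linear in \<open>z\<close> for all \<open>u\<close>,
  because the two summations can be interchanged.\<close>

lemma param_linear:
  assumes M: "sigma_monoid M" and N: "sigma_monoid N" and Z: "sigma_monoid Z" and P: "sigma_monoid P"
    and lin: "\<And>z. z \<in> carr Z \<Longrightarrow> linear_map (M \<otimes> N) P (H z)"
    and pure: "\<And>x y. x \<in> carr M \<Longrightarrow> y \<in> carr N \<Longrightarrow> linear_map Z P (\<lambda>z\<in>carr Z. H z (pure_tensor M N (x, y)))"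
    and u: "u \<in> carr (M \<otimes> N)"
  shows "linear_map Z P (\<lambda>z\<in>carr Z. H z u)"
proof (rule linear_map_restrictI [OF Z])
  interpret Z: sigma_monoid Z by (rule Z)
  interpret P: sigma_monoid P by (rule P)
  obtain s where s: "range s \<subseteq> carr M \<times> carr N" "sm (M \<otimes> N) (pure_tensor M N \<circ> s) = Some u"
    using tensor_gen [OF M N u] by blast
  have si: "s i \<in> carr M \<times> carr N" for i using s(1) by auto
  then have pi: "linear_map Z P (\<lambda>z\<in>carr Z. H z (pure_tensor M N (s i)))" for i
    using pure by (metis mem_Sigma_iff prod.collapse)
  have Hu: "sm P (\<lambda>i. H z (pure_tensor M N (s i))) = Some (H z u)" if "z \<in> carr Z" for z
    using linear_mapD(5) [OF lin [OF that] s(2)] by simp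
  show "H z u \<in> carr P" if "z \<in> carr Z" for z using lin [OF that] u by (rule linear_mapD(1))
  have "H (zer Z) (pure_tensor M N (s i)) = zer P" for i
    using linear_mapD(2) [OF pi, of i] Z.zer_closed by simp
  then show "H (zer Z) u = zer P" using Hu [OF Z.zer_closed] by simp
  fix X z assume X: "sm Z X = Some z"
  note Xc = Z.sm_carr(1) [OF X] and zc = Z.sm_carr(2) [OF X]
  have "sm P (\<lambda>i. H z (pure_tensor M N (s i))) = sm P (\<lambda>k. H (X k) u)"
  proof (rule P.sum_swap [of "\<lambda>i k. H (X k) (pure_tensor M N (s i))"])
    show "sm P (\<lambda>k. H (X k) (pure_tensor M N (s i))) = Some (H z (pure_tensor M N (s i)))" for i
      using linear_mapD(5) [OF pi X, of i] Xc zc by simp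
    show "sm P (\<lambda>i. H (X k) (pure_tensor M N (s i))) = Some (H (X k) u)" for k
      by (rule Hu [OF Xc])
  qed
  then show "sm P (\<lambda>k. H (X k) u) = Some (H z u)" using Hu [OF zc] by simp
qed

definition ltensor :: "'a smon \<Rightarrow> 'b smon \<Rightarrow> 'a \<Rightarrow> ('b, ('a, 'b) tens) arrow" where
  "ltensor M N x = rpart M N (ident (M \<otimes> N)) x"

definition rtensor :: "'a smon \<Rightarrow> 'b smon \<Rightarrow> 'b \<Rightarrow> ('a, ('a, 'b) tens) arrow" where
  "rtensor M N y = lpart M N (ident (M \<otimes> N)) y"

lemma ltensor_simps [simp]:
  assumes "sigma_monoid M" "sigma_monoid N" "x \<in> carr M"
  shows "arr (ltensor M N x)" "src (ltensor M N x) = N" "tgt (ltensor M N x) = M \<otimes> N"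
    "y \<in> carr N \<Longrightarrow> fn (ltensor M N x) y = pure_tensor M N (x, y)"
  using assms by (simp_all add: ltensor_def fn_ident)

lemma rtensor_simps [simp]:
  assumes "sigma_monoid M" "sigma_monoid N" "y \<in> carr N"
  shows "arr (rtensor M N y)" "src (rtensor M N y) = M" "tgt (rtensor M N y) = M \<otimes> N"
    "x \<in> carr M \<Longrightarrow> fn (rtensor M N y) x = pure_tensor M N (x, y)"
  using assms by (simp_all add: rtensor_def fn_ident)

text \<open>For fixed \<open>z\<close> the candidate is \<open>?H z\<close>, the identity tensored
  with the map that appends \<open>z\<close>, hence linear in \<open>u\<close>. Linearity in
  \<open>z\<close> is visible only for pure \<open>u\<close>, where the value is obtained by
  tensoring \<open>z\<close> with \<open>y\<close> and then with \<open>x\<close> on the left;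
  \<open>param_linear\<close> extends it to all \<open>u\<close>.\<close>

lemma assoc_ex1:
  assumes [simp]: "sigma_monoid L" "sigma_monoid M" "sigma_monoid N"
  shows "\<exists>!h. h \<in> Hom ((L \<otimes> M) \<otimes> N) (L \<otimes> (M \<otimes> N)) \<and>
     (\<forall>x\<in>carr L. \<forall>y\<in>carr M. \<forall>z\<in>carr N.
        fn h (pure_tensor (L \<otimes> M) N (pure_tensor L M (x, y), z)) = pure_tensor L (M \<otimes> N) (x, pure_tensor M N (y, z)))"
    (is "\<exists>!h. ?P h")
proof -
  let ?T = "L \<otimes> (M \<otimes> N)"
  let ?H = "\<lambda>z. ident L \<otimes>\<^sub>m rtensor M N z"
  interpret N: sigma_monoid N by simp
  have H: "arr (?H z)" "src (?H z) = L \<otimes> M" "tgt (?H z) = ?T" if "z \<in> carr N" for z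
    using that by simp_all
  have lin: "linear_map N ?T (\<lambda>z\<in>carr N. fn (?H z) u)" if u: "u \<in> carr (L \<otimes> M)" for u
  proof (rule param_linear [OF _ _ _ _ _ _ u])
    show "linear_map (L \<otimes> M) ?T (fn (?H z))" if "z \<in> carr N" for z using arrD(3) [OF H(1)] H that by simp
    fix x y assume xy: "x \<in> carr L" "y \<in> carr M"
    have "linear_map N ?T (\<lambda>z\<in>carr N. fn (ltensor L (M \<otimes> N) x) (fn (ltensor M N y) z))"
      using arrD(3) [of "ltensor L (M \<otimes> N) x \<odot> ltensor M N y", OF arr_comp] xy by (simp add: arrow_comp_def compose_def)
    moreover have "fn (ltensor L (M \<otimes> N) x) (fn (ltensor M N y) z) = fn (?H z) (pure_tensor L M (x, y))"
      if "z \<in> carr N" for z using that xy by (simp add: fn_ident)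
    ultimately show "linear_map N ?T (\<lambda>z\<in>carr N. fn (?H z) (pure_tensor L M (x, y)))"
      by (simp cong: restrict_cong)
  qed simp_all
  have "\<exists>!h. h \<in> Hom ((L \<otimes> M) \<otimes> N) ?T \<and>
      (\<forall>u\<in>carr (L \<otimes> M). \<forall>z\<in>carr N. fn h (pure_tensor (L \<otimes> M) N (u, z)) = fn (?H z) u)"
  proof (rule tensor_univ)
    show "fn (?H z) u \<in> carr ?T" if "u \<in> carr (L \<otimes> M)" "z \<in> carr N" for u z
      using that by (simp add: arr_closed)
    show "fn (?H z) (zer (L \<otimes> M)) = zer ?T" if "z \<in> carr N" for z
      using zer_arr [OF H(1) [OF that]] that by simp
    show "sm ?T (\<lambda>i. fn (?H z) (X i)) = Some (fn (?H z) s)" if "z \<in> carr N" "sm (L \<otimes> M) X = Some s" for X s z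
      using sm_arr [OF H(1) [OF that(1)]] that by simp
    show "fn (?H (zer N)) u = zer ?T" if "u \<in> carr (L \<otimes> M)" for u
      using linear_mapD(2) [OF lin [OF that]] N.zer_closed by simp
    show "sm ?T (\<lambda>i. fn (?H (Y i)) u) = Some (fn (?H t) u)" if "u \<in> carr (L \<otimes> M)" "sm N Y = Some t" for u Y t
      using linear_mapD(5) [OF lin [OF that(1)] that(2)] N.sm_carr [OF that(2)] by simp
  qed simp_all
  then obtain h where h: "h \<in> Hom ((L \<otimes> M) \<otimes> N) ?T"
    "\<And>u z. u \<in> carr (L \<otimes> M) \<Longrightarrow> z \<in> carr N \<Longrightarrow> fn h (pure_tensor (L \<otimes> M) N (u, z)) = fn (?H z) u"
    by blast
  show ?thesis
  proof (rule ex1I [of _ h])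
    show "?P h" using h by (simp add: fn_ident)
    fix k assume k: "?P k"
    show "k = h"
      by (rule arr_ext3_left [of L M N]) (use h k in \<open>auto simp: Hom_arr fn_ident\<close>)
  qed
qed

lemma assoc_simps [simp]:
  assumes [simp]: "sigma_monoid L" "sigma_monoid M" "sigma_monoid N"
  shows "arr (assoc L M N)" "src (assoc L M N) = (L \<otimes> M) \<otimes> N" "tgt (assoc L M N) = L \<otimes> (M \<otimes> N)"
    "x \<in> carr L \<Longrightarrow> y \<in> carr M \<Longrightarrow> z \<in> carr N \<Longrightarrow>
      fn (assoc L M N) (pure_tensor (L \<otimes> M) N (pure_tensor L M (x, y), z)) = pure_tensor L (M \<otimes> N) (x, pure_tensor M N (y, z))"
  using theI' [OF assoc_ex1 [OF assms]] unfolding assoc_def [symmetric] by (auto simp: Hom_arr)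

lemma unit_pure_zero:
  assumes "sigma_monoid M" "x \<in> carr M"
  shows "pure_tensor unitI M (0, x) = zer (unitI \<otimes> M)" "pure_tensor M unitI (x, 0) = zer (M \<otimes> unitI)"
  using bilinearD(2) [OF bilinear_pure [OF sigma_monoid_unitI assms(1)]]
    bilinearD(3) [OF bilinear_pure [OF assms(1) sigma_monoid_unitI]] assms sigma_monoid_unitI by auto

lemma arr_ext_unit_left:
  assumes M: "sigma_monoid M" and "arr f" "src f = unitI \<otimes> M" "arr g" "src g = unitI \<otimes> M" "tgt f = tgt g"
    and "\<And>x. x \<in> carr M \<Longrightarrow> fn f (pure_tensor unitI M (1, x)) = fn g (pure_tensor unitI M (1, x))"
  shows "f = g"
  by (rule arr_ext2 [OF sigma_monoid_unitI M])
    (use assms zer_arr [of f] zer_arr [of g] in \<open>auto simp: unit_pure_zero\<close>)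

lemma arr_ext_unit_right:
  assumes M: "sigma_monoid M" and "arr f" "src f = M \<otimes> unitI" "arr g" "src g = M \<otimes> unitI" "tgt f = tgt g"
    and "\<And>x. x \<in> carr M \<Longrightarrow> fn f (pure_tensor M unitI (x, 1)) = fn g (pure_tensor M unitI (x, 1))"
  shows "f = g"
  by (rule arr_ext2 [OF M sigma_monoid_unitI])
    (use assms zer_arr [of f] zer_arr [of g] in \<open>auto simp: unit_pure_zero\<close>)

text \<open>A summable family in the unit has at most one nonzero entry, so scalar multiplication by
  \<open>0\<close> and \<open>1\<close> is linear in the scalar.\<close>

lemma unit_action_sum:
  assumes "sigma_monoid M" "x \<in> carr M" "sm unitI X = Some s"
  shows "sm M (\<lambda>i. if X i = 1 then x else zer M) = Some (if s = 1 then x else zer M)"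
proof -
  interpret sigma_monoid M by fact
  from assms(3) consider "\<forall>i. X i = 0" "s = 0" | j where "X j = 1" "\<forall>i. i \<noteq> j \<longrightarrow> X i = 0" "s = 1"
    unfolding sm_unitI_Some by blast
  then show ?thesis
  proof cases
    case 1
    then show ?thesis by simp
  next
    case 2
    then show ?thesis
      using sm_single [of "\<lambda>i. if X i = 1 then x else zer M" j] assms(2) zer_closed by auto
  qed
qed

lemma lunit_ex1:
  assumes M: "sigma_monoid M"
  shows "\<exists>!h. h \<in> Hom (unitI \<otimes> M) M \<and> (\<forall>x\<in>carr M. fn h (pure_tensor unitI M (1, x)) = x)"
proof -
  interpret sigma_monoid M by fact
  have "\<exists>!h. h \<in> Hom (unitI \<otimes> M) M \<and>
      (\<forall>i\<in>carr unitI. \<forall>x\<in>carr M. fn h (pure_tensor unitI M (i, x)) = (if i = 1 then x else zer M))"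
    by (rule tensor_univ) (use M zer_closed unit_action_sum [OF M] in \<open>auto simp: sigma_monoid_unitI\<close>)
  then obtain h where h: "h \<in> Hom (unitI \<otimes> M) M" "\<And>x. x \<in> carr M \<Longrightarrow> fn h (pure_tensor unitI M (1, x)) = x"
    by auto
  show ?thesis
    by (rule ex1I [of _ h]) (use h M in \<open>auto simp: Hom_arr sigma_monoid_unitI intro: arr_ext_unit_left\<close>)
qed

lemma swap_ex1:
  assumes M: "sigma_monoid M" and N: "sigma_monoid N"
  shows "\<exists>!h. h \<in> Hom (M \<otimes> N) (N \<otimes> M) \<and>
     (\<forall>x\<in>carr M. \<forall>y\<in>carr N. fn h (pure_tensor M N (x, y)) = pure_tensor N M (y, x))"
  by (rule tensor_univ) (use M N bilinearD [OF bilinear_pure [OF N M]] in auto)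

lemma lunit_simps [simp]:
  assumes "sigma_monoid M"
  shows "arr (lunit M)" "src (lunit M) = unitI \<otimes> M" "tgt (lunit M) = M"
    "x \<in> carr M \<Longrightarrow> fn (lunit M) (pure_tensor unitI M (1, x)) = x"
  using theI' [OF lunit_ex1 [OF assms]] unfolding lunit_def [symmetric]
  by (simp_all add: Hom_arr sigma_monoid_unitI assms)

lemma swap_simps [simp]:
  assumes "sigma_monoid M" "sigma_monoid N"
  shows "arr (swap M N)" "src (swap M N) = M \<otimes> N" "tgt (swap M N) = N \<otimes> M"
    "x \<in> carr M \<Longrightarrow> y \<in> carr N \<Longrightarrow> fn (swap M N) (pure_tensor M N (x, y)) = pure_tensor N M (y, x)"
  using theI' [OF swap_ex1 [OF assms]] unfolding swap_def [symmetric]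
  by (simp_all add: Hom_arr assms)

lemma runit_ex1:
  assumes M: "sigma_monoid M"
  shows "\<exists>!h. h \<in> Hom (M \<otimes> unitI) M \<and> (\<forall>x\<in>carr M. fn h (pure_tensor M unitI (x, 1)) = x)"
  by (rule ex1I [of _ "lunit M \<odot> swap M unitI"])
    (use M in \<open>auto simp: Hom_arr sigma_monoid_unitI fn_comp intro: arr_ext_unit_right\<close>)

lemma runit_simps [simp]:
  assumes "sigma_monoid M"
  shows "arr (runit M)" "src (runit M) = M \<otimes> unitI" "tgt (runit M) = M"
    "x \<in> carr M \<Longrightarrow> fn (runit M) (pure_tensor M unitI (x, 1)) = x"
  using theI' [OF runit_ex1 [OF assms]] unfolding runit_def [symmetric]
  by (simp_all add: Hom_arr sigma_monoid_unitI assms)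

declare sigma_monoid_unitI [simp]

section \<open>Isomorphisms, naturality and coherence\<close>

lemma isoI:
  assumes "arr f" "src f = M" "tgt f = N" "arr g" "src g = N" "tgt g = M" "g \<odot> f = ident M" "f \<odot> g = ident N"
  shows "iso M N f"
  unfolding iso_def using assms arrD(1,2) [OF assms(1)] by (auto simp: Hom_arr)

lemma category_SMon: "sigma_monoid K \<Longrightarrow> sigma_monoid L \<Longrightarrow> sigma_monoid M \<Longrightarrow> sigma_monoid N \<Longrightarrow> category_laws K L M N"
  by (auto simp: category_laws_def Hom_arr comp_assoc)

lemma bifunctor:
  assumes "sigma_monoid M" "sigma_monoid M'" "sigma_monoid M''" "sigma_monoid N" "sigma_monoid N'" "sigma_monoid N''"
  shows "tensor_bifunctor M M' M'' N N' N''"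
  using assms by (auto simp: tensor_bifunctor_def Hom_arr tmap_ident tmap_comp)

lemma assoc_natural:
  assumes "arr f" "arr g" "arr h" "src f = L" "src g = M" "src h = N" "tgt f = L'" "tgt g = M'" "tgt h = N'"
  shows "assoc L' M' N' \<odot> ((f \<otimes>\<^sub>m g) \<otimes>\<^sub>m h) = (f \<otimes>\<^sub>m (g \<otimes>\<^sub>m h)) \<odot> assoc L M N"
proof -
  have [simp]: "sigma_monoid L" "sigma_monoid M" "sigma_monoid N" "sigma_monoid L'" "sigma_monoid M'" "sigma_monoid N'"
    using assms arrD(1,2) by metis+
  show ?thesis
    by (rule arr_ext3_left [of L M N]) (use assms in \<open>auto simp: fn_comp arr_closed\<close>)
qed

lemma lunit_natural:
  assumes "arr f" "src f = M" "tgt f = M'"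
  shows "lunit M' \<odot> (ident unitI \<otimes>\<^sub>m f) = f \<odot> lunit M"
proof -
  have [simp]: "sigma_monoid M" "sigma_monoid M'" using assms arrD(1,2) by metis+
  show ?thesis
    by (rule arr_ext_unit_left [of M]) (use assms in \<open>auto simp: fn_comp fn_ident arr_closed\<close>)
qed

lemma runit_natural:
  assumes "arr f" "src f = M" "tgt f = M'"
  shows "runit M' \<odot> (f \<otimes>\<^sub>m ident unitI) = f \<odot> runit M"
proof -
  have [simp]: "sigma_monoid M" "sigma_monoid M'" using assms arrD(1,2) by metis+
  show ?thesis
    by (rule arr_ext_unit_right [of M]) (use assms in \<open>auto simp: fn_comp fn_ident arr_closed\<close>)
qed

lemma swap_natural:
  assumes "arr f" "arr g" "src f = M" "src g = N" "tgt f = M'" "tgt g = N'"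
  shows "swap M' N' \<odot> (f \<otimes>\<^sub>m g) = (g \<otimes>\<^sub>m f) \<odot> swap M N"
proof -
  have [simp]: "sigma_monoid M" "sigma_monoid N" "sigma_monoid M'" "sigma_monoid N'"
    using assms arrD(1,2) by metis+
  show ?thesis
    by (rule arr_ext2 [of M N]) (use assms in \<open>auto simp: fn_comp arr_closed\<close>)
qed

lemma iso_assoc:
  assumes [simp]: "sigma_monoid L" "sigma_monoid M" "sigma_monoid N"
  shows "iso ((L \<otimes> M) \<otimes> N) (L \<otimes> (M \<otimes> N)) (assoc L M N)"
proof -
  \<comment> \<open>The associator conjugated by symmetries, passing through the bracketings x(yz),
    (yz)x, (zy)x, z(yx), (yx)z and (xy)z.\<close>
  define g where "g = (swap M L \<otimes>\<^sub>m ident N) \<odot> swap N (M \<otimes> L) \<odot> assoc N M L \<odot> (swap M N \<otimes>\<^sub>m ident L) \<odot> swap L (M \<otimes> N)"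
  have g: "arr g" "src g = L \<otimes> (M \<otimes> N)" "tgt g = (L \<otimes> M) \<otimes> N" by (simp_all add: g_def)
  have g_pure: "fn g (pure_tensor L (M \<otimes> N) (x, pure_tensor M N (y, z))) = pure_tensor (L \<otimes> M) N (pure_tensor L M (x, y), z)"
    if "x \<in> carr L" "y \<in> carr M" "z \<in> carr N" for x y z
    using that by (simp add: g_def fn_comp fn_ident)
  show ?thesis
  proof (rule isoI [OF _ _ _ g])
    show "g \<odot> assoc L M N = ident ((L \<otimes> M) \<otimes> N)"
      by (rule arr_ext3_left [of L M N]) (use g g_pure in \<open>auto simp: fn_comp fn_ident\<close>)
    show "assoc L M N \<odot> g = ident (L \<otimes> (M \<otimes> N))"
      by (rule arr_ext3_right [of L M N]) (use g g_pure in \<open>auto simp: fn_comp fn_ident\<close>)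
  qed simp_all
qed

lemma monoidal_structure:
  assumes [simp]: "sigma_monoid L" "sigma_monoid M" "sigma_monoid N" "sigma_monoid L'" "sigma_monoid M'" "sigma_monoid N'"
  shows "structure_isos L M N L' M' N'"
proof -
  have "iso (unitI \<otimes> M) M (lunit M)"
  proof (rule isoI)
    show "ltensor unitI M 1 \<odot> lunit M = ident (unitI \<otimes> M)"
      by (rule arr_ext_unit_left [of M]) (auto simp: fn_comp fn_ident)
    show "lunit M \<odot> ltensor unitI M 1 = ident M"
      by (rule arr_eqI) (auto simp: fn_comp fn_ident)
  qed simp_all
  moreover have "iso (M \<otimes> unitI) M (runit M)"
  proof (rule isoI)
    show "rtensor M unitI 1 \<odot> runit M = ident (M \<otimes> unitI)"
      by (rule arr_ext_unit_right [of M]) (auto simp: fn_comp fn_ident)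
    show "runit M \<odot> rtensor M unitI 1 = ident M"
      by (rule arr_eqI) (auto simp: fn_comp fn_ident)
  qed simp_all
  moreover have "iso (M \<otimes> N) (N \<otimes> M) (swap M N)"
  proof (rule isoI)
    show "swap N M \<odot> swap M N = ident (M \<otimes> N)"
      by (rule arr_ext2 [of M N]) (auto simp: fn_comp fn_ident)
    show "swap M N \<odot> swap N M = ident (N \<otimes> M)"
      by (rule arr_ext2 [of N M]) (auto simp: fn_comp fn_ident)
  qed simp_all
  ultimately show ?thesis
    by (auto simp: structure_isos_def iso_assoc Hom_arr assoc_natural lunit_natural runit_natural swap_natural)
qed

lemma coherent:
  assumes [simp]: "sigma_monoid K" "sigma_monoid L" "sigma_monoid M" "sigma_monoid N"
  shows "coherence K L M N"
  unfolding coherence_def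
proof (intro conjI)
  show "assoc K L (M \<otimes> N) \<odot> assoc (K \<otimes> L) M N =
       (ident K \<otimes>\<^sub>m assoc L M N) \<odot> assoc K (L \<otimes> M) N \<odot> (assoc K L M \<otimes>\<^sub>m ident N)"
    by (rule arr_ext4 [of K L M N]) (auto simp: fn_comp fn_ident)
  show "(ident M \<otimes>\<^sub>m lunit N) \<odot> assoc M unitI N = runit M \<otimes>\<^sub>m ident N"
  proof (rule arr_ext2 [of "M \<otimes> unitI" N])
    fix u z assume u: "u \<in> carr (M \<otimes> unitI)" and z: "z \<in> carr N"
    let ?f = "(ident M \<otimes>\<^sub>m lunit N) \<odot> assoc M unitI N" and ?g = "runit M \<otimes>\<^sub>m ident N"
    \<comment> \<open>\<open>runit\<close> is specified on the scalar \<open>1\<close> only, so the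
      middle factor is reduced to that scalar while \<open>z\<close> is held fixed.\<close>
    have "lpart (M \<otimes> unitI) N ?f z = lpart (M \<otimes> unitI) N ?g z"
      by (rule arr_ext_unit_right [of M]) (use z in \<open>auto simp: fn_comp fn_ident\<close>)
    then have "fn (lpart (M \<otimes> unitI) N ?f z) u = fn (lpart (M \<otimes> unitI) N ?g z) u" by simp
    then show "fn ?f (pure_tensor (M \<otimes> unitI) N (u, z)) = fn ?g (pure_tensor (M \<otimes> unitI) N (u, z))"
      using u by simp
  qed simp_all
  show "assoc M N L \<odot> swap L (M \<otimes> N) \<odot> assoc L M N =
       (ident M \<otimes>\<^sub>m swap L N) \<odot> assoc M L N \<odot> (swap L M \<otimes>\<^sub>m ident N)"
    by (rule arr_ext3_left [of L M N]) (auto simp: fn_comp fn_ident)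
  show "swap N M \<odot> swap M N = ident (M \<otimes> N)"
    by (rule arr_ext2 [of M N]) (auto simp: fn_comp fn_ident)
qed

section \<open>The closed structure\<close>

lemma linear_map_fn_ihom:
  assumes "arr g" "tgt g = ihom M N" "z \<in> carr (src g)"
  shows "linear_map M N (fn g z)"
  using arr_closed [OF assms] by simp

lemma arr_ihom_map:
  assumes M: "sigma_monoid M" and g: "arr g"
  shows "arr (ihom_map M g)" "src (ihom_map M g) = ihom M (src g)" "tgt (ihom_map M g) = ihom M (tgt g)"
    "f \<in> carr (ihom M (src g)) \<Longrightarrow> fn (ihom_map M g) f = compose (carr M) (fn g) f"
proof -
  note s = arrD(1-3) [OF g]
  have "linear_map (ihom M (src g)) (ihom M (tgt g)) (\<lambda>f\<in>carr (ihom M (src g)). compose (carr M) (fn g) f)"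
  proof (rule linear_map_restrictI)
    show "sigma_monoid (ihom M (src g))" by (rule sigma_monoid_ihom [OF M s(1)])
    show "compose (carr M) (fn g) f \<in> carr (ihom M (tgt g))" if "f \<in> carr (ihom M (src g))" for f
      using that linear_map_compose [OF M _ s(3)] by simp
    show "compose (carr M) (fn g) (zer (ihom M (src g))) = zer (ihom M (tgt g))"
      by (auto simp: compose_def fun_eq_iff zer_arr [OF g])
    fix F f assume F: "sm (ihom M (src g)) F = Some f"
    then show "sm (ihom M (tgt g)) (\<lambda>i. compose (carr M) (fn g) (F i)) = Some (compose (carr M) (fn g) f)"
      using linear_map_compose [OF M _ s(3)] sm_arr [OF g]
      by (auto simp: sm_ihom_Some M s compose_def)
  qed
  then show "arr (ihom_map M g)"
    unfolding ihom_map_def by (intro arr_mk sigma_monoid_ihom M s)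
qed (simp_all add: ihom_map_def)

lemma arr_curry:
  assumes [simp]: "sigma_monoid L" "sigma_monoid M" and f: "arr f" "src f = L \<otimes> M"
  shows "arr (curry_arrow L M f)" "src (curry_arrow L M f) = L" "tgt (curry_arrow L M f) = ihom M (tgt f)"
    "z \<in> carr L \<Longrightarrow> x \<in> carr M \<Longrightarrow> fn (curry_arrow L M f) z x = fn f (pure_tensor L M (z, x))"
proof -
  interpret L: sigma_monoid L by simp
  have N: "sigma_monoid (tgt f)" using f by (simp add: arrD)
  have r: "linear_map M (tgt f) (\<lambda>x\<in>carr M. fn f (pure_tensor L M (z, x)))" if "z \<in> carr L" for z
    using arrD(3) [OF arr_rpart [OF _ _ f that]] by (simp add: rpart_def)
  have "linear_map L (ihom M (tgt f)) (\<lambda>z\<in>carr L. \<lambda>x\<in>carr M. fn f (pure_tensor L M (z, x)))"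
  proof (rule linear_map_restrictI)
    show "(\<lambda>x\<in>carr M. fn f (pure_tensor L M (zer L, x))) = zer (ihom M (tgt f))"
      using zer_arr [OF arr_lpart [OF _ _ f]] L.zer_closed by (auto simp: fun_eq_iff)
    fix X s assume X: "sm L X = Some s"
    note Xc = L.sm_carr [OF X]
    have "sm (tgt f) (\<lambda>i. fn f (pure_tensor L M (X i, x))) = Some (fn f (pure_tensor L M (s, x)))"
      if "x \<in> carr M" for x
      using sm_arr [OF arr_lpart [OF _ _ f that], of X s] X Xc by simp
    then show "sm (ihom M (tgt f)) (\<lambda>i. \<lambda>x\<in>carr M. fn f (pure_tensor L M (X i, x))) =
        Some (\<lambda>x\<in>carr M. fn f (pure_tensor L M (s, x)))"
      using r Xc by (auto simp: sm_ihom_Some N)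
  qed (use r in auto)
  then show "arr (curry_arrow L M f)"
    unfolding curry_arrow_def by (intro arr_mk sigma_monoid_ihom N) simp_all
qed (simp_all add: curry_arrow_def)

lemma bij_betw_curry:
  assumes [simp]: "sigma_monoid L" "sigma_monoid M" "sigma_monoid N"
  shows "bij_betw (curry_arrow L M) (Hom (L \<otimes> M) N) (Hom L (ihom M N))"
  unfolding bij_betw_def
proof (intro conjI inj_onI equalityI subsetI)
  have [simp]: "sigma_monoid (ihom M N)" by (simp add: sigma_monoid_ihom)
  fix f g assume f: "f \<in> Hom (L \<otimes> M) N" and g: "g \<in> Hom (L \<otimes> M) N" and eq: "curry_arrow L M f = curry_arrow L M g"
  have f': "arr f" "src f = L \<otimes> M" "tgt f = N" and g': "arr g" "src g = L \<otimes> M" "tgt g = N"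
    using f g by (simp_all add: Hom_arr)
  show "f = g"
  proof (rule arr_ext2 [of L M])
    fix z x assume "z \<in> carr L" "x \<in> carr M"
    then show "fn f (pure_tensor L M (z, x)) = fn g (pure_tensor L M (z, x))"
      using arr_curry(4) [of L M f z x] arr_curry(4) [of L M g z x] f' g' eq by simp
  qed (use f' g' in auto)
next
  have [simp]: "sigma_monoid (ihom M N)" by (simp add: sigma_monoid_ihom)
  fix g assume "g \<in> curry_arrow L M ` Hom (L \<otimes> M) N"
  then show "g \<in> Hom L (ihom M N)" by (auto simp: Hom_arr arr_curry)
next
  have [simp]: "sigma_monoid (ihom M N)" by (simp add: sigma_monoid_ihom)
  fix g assume "g \<in> Hom L (ihom M N)"
  then have g: "arr g" "src g = L" "tgt g = ihom M N" by (simp_all add: Hom_arr)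
  interpret M: sigma_monoid M by simp
  have lin: "linear_map M N (fn g z)" if "z \<in> carr L" for z
    using linear_map_fn_ihom [OF g(1,3)] that g by simp
  \<comment> \<open>Surjectivity of currying: applying \<open>g\<close> to two arguments in turn is
    bilinear, so it factors through the tensor product.\<close>
  have "\<exists>!h. h \<in> Hom (L \<otimes> M) N \<and> (\<forall>z\<in>carr L. \<forall>x\<in>carr M. fn h (pure_tensor L M (z, x)) = fn g z x)"
  proof (rule tensor_univ)
    show "fn g (zer L) x = zer N" if "x \<in> carr M" for x using zer_arr [OF g(1)] g that by simp
    show "sm N (\<lambda>i. fn g (X i) x) = Some (fn g s x)" if "x \<in> carr M" "sm L X = Some s" for X s x
      using sm_arr [OF g(1), of X s] that g by (simp add: sm_ihom_Some)
  qed (simp_all add: linear_mapD(1,2,5) [OF lin])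
  then obtain h where h: "h \<in> Hom (L \<otimes> M) N"
    "\<And>z x. z \<in> carr L \<Longrightarrow> x \<in> carr M \<Longrightarrow> fn h (pure_tensor L M (z, x)) = fn g z x" by blast
  then have h': "arr h" "src h = L \<otimes> M" "tgt h = N" by (simp_all add: Hom_arr)
  have "curry_arrow L M h = g"
  proof (rule arr_eqI)
    fix z assume z: "z \<in> carr (src (curry_arrow L M h))"
    have z': "z \<in> carr L" using z by (simp add: arr_curry h')
    show "fn (curry_arrow L M h) z = fn g z"
    proof (rule linear_map_ext)
      show "linear_map M N (fn (curry_arrow L M h) z)"
        using linear_map_fn_ihom [of "curry_arrow L M h" M N z] z' by (simp add: arr_curry h')
      show "linear_map M N (fn g z)" by (rule lin [OF z'])
    qed (use z' h h' in \<open>simp add: arr_curry\<close>)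
  qed (use g h' in \<open>auto simp: arr_curry\<close>)
  then show "g \<in> curry_arrow L M ` Hom (L \<otimes> M) N" using h(1) by blast
qed

lemma hom_adjunction:
  assumes [simp]: "sigma_monoid L" "sigma_monoid L'" "sigma_monoid M" "sigma_monoid N" "sigma_monoid N'" "sigma_monoid N''"
  shows "tensor_hom_adjunction L L' M N N' N''"
  unfolding tensor_hom_adjunction_def
proof (intro conjI ballI)
  show [simp]: "sigma_monoid (ihom M N)" by (simp add: sigma_monoid_ihom)
  have [simp]: "sigma_monoid (ihom M N')" by (simp add: sigma_monoid_ihom)
  show "ihom_map M g \<in> Hom (ihom M N) (ihom M N')" if "g \<in> Hom N N'" for g
    using that by (simp add: Hom_arr arr_ihom_map)
  show "ihom_map M (ident N) = ident (ihom M N)"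
  proof (rule arr_eqI)
    fix f assume "f \<in> carr (src (ihom_map M (ident N)))"
    then have f: "linear_map M N f" by (simp add: arr_ihom_map)
    then have "compose (carr M) (fn (ident N)) f = f"
      by (auto simp: compose_def fun_eq_iff fn_ident linear_mapD(1,3) [OF f])
    then show "fn (ihom_map M (ident N)) f = fn (ident (ihom M N)) f"
      using f by (simp add: arr_ihom_map fn_ident)
  qed (simp_all add: arr_ihom_map)
  show "ihom_map M (g' \<odot> g) = ihom_map M g' \<odot> ihom_map M g" if "g \<in> Hom N N'" "g' \<in> Hom N' N''" for g g'
  proof (rule arr_eqI)
    have g: "arr g" "src g = N" "tgt g = N'" "arr g'" "src g' = N'" "tgt g' = N''"
      using that by (simp_all add: Hom_arr)
    show "arr (ihom_map M (g' \<odot> g))" "arr (ihom_map M g' \<odot> ihom_map M g)"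
      "src (ihom_map M (g' \<odot> g)) = src (ihom_map M g' \<odot> ihom_map M g)"
      "tgt (ihom_map M (g' \<odot> g)) = tgt (ihom_map M g' \<odot> ihom_map M g)"
      using g by (simp_all add: arr_ihom_map)
    fix f assume "f \<in> carr (src (ihom_map M (g' \<odot> g)))"
    then have f: "linear_map M N f" using g by (simp add: arr_ihom_map)
    have "linear_map M N' (compose (carr M) (fn g) f)"
      using linear_map_compose [OF _ f arrD(3) [OF g(1), unfolded g]] by simp
    then show "fn (ihom_map M (g' \<odot> g)) f = fn (ihom_map M g' \<odot> ihom_map M g) f"
      using f g by (auto simp: arr_ihom_map fn_comp compose_def fun_eq_iff linear_mapD(1) [OF f])
  qed
  show "bij_betw (curry_arrow L M) (Hom (L \<otimes> M) N) (Hom L (ihom M N))" by (simp add: bij_betw_curry)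
  show "curry_arrow L' M (v \<odot> f \<odot> (u \<otimes>\<^sub>m ident M)) = ihom_map M v \<odot> curry_arrow L M f \<odot> u"
    if "u \<in> Hom L' L" "f \<in> Hom (L \<otimes> M) N" "v \<in> Hom N N'" for u f v
  proof (rule arr_eqI)
    have u: "arr u" "src u = L'" "tgt u = L" and f: "arr f" "src f = L \<otimes> M" "tgt f = N"
      and v: "arr v" "src v = N" "tgt v = N'" using that by (simp_all add: Hom_arr)
    let ?l = "curry_arrow L' M (v \<odot> f \<odot> (u \<otimes>\<^sub>m ident M))" and ?r = "ihom_map M v \<odot> curry_arrow L M f \<odot> u"
    show "arr ?l" "arr ?r" "src ?l = src ?r" "tgt ?l = tgt ?r"
      using u f v by (simp_all add: arr_curry arr_ihom_map)
    fix z assume "z \<in> carr (src ?l)"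
    then have z: "z \<in> carr L'" using u f v by (simp add: arr_curry)
    then have uz: "fn u z \<in> carr L" using u by (simp add: arr_closed)
    then have c: "linear_map M N (fn (curry_arrow L M f) (fn u z))"
      using linear_map_fn_ihom [of "curry_arrow L M f" M N "fn u z"] f by (simp add: arr_curry)
    show "fn ?l z = fn ?r z"
    proof
      fix x
      show "fn ?l z x = fn ?r z x"
      proof (cases "x \<in> carr M")
        case True
        then show ?thesis
          using z uz u f v c by (simp add: arr_curry arr_ihom_map fn_comp fn_ident compose_def)
      next
        case False
        have "linear_map M N' (fn ?l z)"
          using linear_map_fn_ihom [of ?l M N' z] z u f v by (simp add: arr_curry)
        then have "fn ?l z x = undefined" using False by (rule linear_mapD(3))
        then show ?thesis
          using z uz u f v c False by (simp add: arr_curry arr_ihom_map fn_comp compose_def)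
      qed
    qed
  qed
qed

subsection \<open>Comonoids\<close>

text \<open>Composites are normalised to the right by \<open>comp_assoc\<close>, so each law is also
  needed with a further arrow \<open>k\<close> composed on the right; the \<open>_comp\<close>
  lemmas are these forms.\<close>

lemma tmap_comp_comp:
  assumes "arr f" "arr g" "arr f'" "arr g'" "src f' = tgt f" "src g' = tgt g" "arr k" "tgt k = src f \<otimes> src g"
  shows "(f' \<otimes>\<^sub>m g') \<odot> ((f \<otimes>\<^sub>m g) \<odot> k) = ((f' \<odot> f) \<otimes>\<^sub>m (g' \<odot> g)) \<odot> k"
  using assms comp_assoc [of k "f \<otimes>\<^sub>m g" "f' \<otimes>\<^sub>m g'"] by (simp add: tmap_comp)

lemma natural_comp:
  assumes "a' \<odot> f = g \<odot> a" "arr a" "arr a'" "arr f" "arr g" "src g = tgt a" "src a' = tgt f"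
    "arr k" "tgt k = src f" "src a = src f"
  shows "g \<odot> (a \<odot> k) = a' \<odot> (f \<odot> k)"
  using assms comp_assoc [of k a g] comp_assoc [of k f a'] by simp

lemma assoc_natural_comp:
  assumes "arr f" "arr g" "arr h" "arr k" "src f = L" "src g = M" "src h = N" "tgt k = (L \<otimes> M) \<otimes> N"
  shows "(f \<otimes>\<^sub>m (g \<otimes>\<^sub>m h)) \<odot> (assoc L M N \<odot> k) = assoc (tgt f) (tgt g) (tgt h) \<odot> (((f \<otimes>\<^sub>m g) \<otimes>\<^sub>m h) \<odot> k)"
  by (rule natural_comp [OF assoc_natural]) (use assms in \<open>auto simp: arrD(1,2)\<close>)

lemma lunit_natural_comp:
  assumes "arr f" "arr k" "src f = M" "tgt k = unitI \<otimes> M"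
  shows "f \<odot> (lunit M \<odot> k) = lunit (tgt f) \<odot> ((ident unitI \<otimes>\<^sub>m f) \<odot> k)"
  by (rule natural_comp [OF lunit_natural]) (use assms in \<open>auto simp: arrD(1,2)\<close>)

lemma runit_natural_comp:
  assumes "arr f" "arr k" "src f = M" "tgt k = M \<otimes> unitI"
  shows "f \<odot> (runit M \<odot> k) = runit (tgt f) \<odot> ((f \<otimes>\<^sub>m ident unitI) \<odot> k)"
  by (rule natural_comp [OF runit_natural]) (use assms in \<open>auto simp: arrD(1,2)\<close>)

lemma swap_natural_comp:
  assumes "arr f" "arr g" "arr k" "src f = M" "src g = N" "tgt k = M \<otimes> N"
  shows "(g \<otimes>\<^sub>m f) \<odot> (swap M N \<odot> k) = swap (tgt f) (tgt g) \<odot> ((f \<otimes>\<^sub>m g) \<odot> k)"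
  by (rule natural_comp [OF swap_natural]) (use assms in \<open>auto simp: arrD(1,2)\<close>)

text \<open>A comonoid without its laws. Morphisms and the transfer lemmas are available at this
  level, hence before a subobject or the colimit is known to satisfy the laws.\<close>

definition comonoid_data :: "'a comonoid \<Rightarrow> bool" where
  "comonoid_data C \<longleftrightarrow> sigma_monoid (und C) \<and> arr (comult C) \<and> arr (counit C) \<and>
     src (comult C) = und C \<and> tgt (comult C) = und C \<otimes> und C \<and> src (counit C) = und C \<and> tgt (counit C) = unitI"

lemma comonoid_dataD [simp]:
  assumes "comonoid_data C"
  shows "sigma_monoid (und C)" "arr (comult C)" "arr (counit C)" "src (comult C) = und C"
    "tgt (comult C) = und C \<otimes> und C" "src (counit C) = und C" "tgt (counit C) = unitI"
  using assms by (auto simp: comonoid_data_def)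

lemma cocomm_comonoid_iff:
  "cocomm_comonoid C \<longleftrightarrow> comonoid_data C \<and>
     assoc (und C) (und C) (und C) \<odot> (comult C \<otimes>\<^sub>m ident (und C)) \<odot> comult C =
       (ident (und C) \<otimes>\<^sub>m comult C) \<odot> comult C \<and>
     lunit (und C) \<odot> (counit C \<otimes>\<^sub>m ident (und C)) \<odot> comult C = ident (und C) \<and>
     runit (und C) \<odot> (ident (und C) \<otimes>\<^sub>m counit C) \<odot> comult C = ident (und C) \<and>
     swap (und C) (und C) \<odot> comult C = comult C"
  unfolding cocomm_comonoid_def comonoid_data_def by (auto simp: Hom_arr)

lemma cocomm_comonoid_data [simp]: "cocomm_comonoid C \<Longrightarrow> comonoid_data C"
  by (simp add: cocomm_comonoid_iff)

lemma CHom_iff: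
  assumes "comonoid_data C" "comonoid_data D"
  shows "f \<in> CHom C D \<longleftrightarrow> arr f \<and> src f = und C \<and> tgt f = und D \<and>
    comult D \<odot> f = (f \<otimes>\<^sub>m f) \<odot> comult C \<and> counit D \<odot> f = counit C"
  using assms by (auto simp: CHom_def Hom_arr)

lemma ident_CHom:
  assumes [simp]: "comonoid_data C"
  shows "ident (und C) \<in> CHom C C"
  by (simp add: CHom_iff tmap_ident)

context
  fixes D :: "'d comonoid" and C :: "'c comonoid" and j :: "('d, 'c) arrow"
  assumes data [simp]: "comonoid_data D" "comonoid_data C" and j: "j \<in> CHom D C"
begin

lemma CHomD [simp]:
  "arr j" "src j = und D" "tgt j = und C"
  and CHom_comult: "comult C \<odot> j = (j \<otimes>\<^sub>m j) \<odot> comult D" and CHom_counit: "counit C \<odot> j = counit D"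
  using j by (auto simp: CHom_iff)

lemma CHom_comult_comp: "arr k \<Longrightarrow> tgt k = und D \<Longrightarrow> comult C \<odot> (j \<odot> k) = (j \<otimes>\<^sub>m j) \<odot> (comult D \<odot> k)"
  using comp_assoc [of k j "comult C"] comp_assoc [of k "comult D" "j \<otimes>\<^sub>m j"] by (simp add: CHom_comult)

text \<open>The two sides of each comonoid law are natural in comonoid morphisms. The transfer
  lemmas serve in both directions: an embedding reflects the laws of \<open>C\<close> to
  \<open>D\<close>, and the colimit injections carry the laws of their sources to the
  colimit.\<close>

lemma transfer_assoc_left:
  "(assoc (und C) (und C) (und C) \<odot> (comult C \<otimes>\<^sub>m ident (und C)) \<odot> comult C) \<odot> j =
    (j \<otimes>\<^sub>m (j \<otimes>\<^sub>m j)) \<odot> (assoc (und D) (und D) (und D) \<odot> (comult D \<otimes>\<^sub>m ident (und D)) \<odot> comult D)"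
  by (simp add: comp_assoc CHom_comult tmap_comp tmap_comp_comp assoc_natural_comp)

lemma transfer_assoc_right:
  "((ident (und C) \<otimes>\<^sub>m comult C) \<odot> comult C) \<odot> j =
    (j \<otimes>\<^sub>m (j \<otimes>\<^sub>m j)) \<odot> ((ident (und D) \<otimes>\<^sub>m comult D) \<odot> comult D)"
  by (simp add: comp_assoc CHom_comult tmap_comp_comp)

lemma transfer_lunit:
  "(lunit (und C) \<odot> (counit C \<otimes>\<^sub>m ident (und C)) \<odot> comult C) \<odot> j =
    j \<odot> (lunit (und D) \<odot> (counit D \<otimes>\<^sub>m ident (und D)) \<odot> comult D)"
  by (simp add: comp_assoc CHom_comult CHom_counit tmap_comp_comp lunit_natural_comp)

lemma transfer_runit:
  "(runit (und C) \<odot> (ident (und C) \<otimes>\<^sub>m counit C) \<odot> comult C) \<odot> j =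
    j \<odot> (runit (und D) \<odot> (ident (und D) \<otimes>\<^sub>m counit D) \<odot> comult D)"
  by (simp add: comp_assoc CHom_comult CHom_counit tmap_comp_comp runit_natural_comp)

lemma transfer_swap:
  "(swap (und C) (und C) \<odot> comult C) \<odot> j = (j \<otimes>\<^sub>m j) \<odot> (swap (und D) (und D) \<odot> comult D)"
  by (simp add: comp_assoc CHom_comult swap_natural_comp)

end

lemma comp_CHom:
  assumes d [simp]: "comonoid_data C" "comonoid_data D" "comonoid_data E"
    and f: "f \<in> CHom C D" and g: "g \<in> CHom D E"
  shows "g \<odot> f \<in> CHom C E"
proof -
  note [simp] = CHomD [OF d(1,2) f] CHomD [OF d(2,3) g]
  have "counit E \<odot> (g \<odot> f) = (counit E \<odot> g) \<odot> f"
    by (rule comp_assoc [symmetric]) simp_all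
  then show ?thesis
    by (simp add: CHom_iff CHom_comult_comp [OF d(2,3) g] CHom_comult [OF d(1,2) f]
        CHom_counit [OF d(1,2) f] CHom_counit [OF d(2,3) g] tmap_comp_comp)
qed

lemma comonoid_category:
  assumes "cocomm_comonoid C" "cocomm_comonoid C'" "cocomm_comonoid C''"
  shows "comonoid_category_laws C C' C''"
  unfolding comonoid_category_laws_def using assms
  by (auto intro: ident_CHom comp_CHom [of C C' C''])


subsection \<open>Embeddings\<close>

text \<open>Injectivity alone would not make the inverse on the image linear. The second clause
  reflects sums computed in the target, so that the source carries exactly the structure induced on
  its image.\<close>

definition emb :: "('a, 'b) arrow \<Rightarrow> bool" where
  "emb j \<longleftrightarrow> arr j \<and> inj_on (fn j) (carr (src j)) \<and>
     (\<forall>x v. range x \<subseteq> carr (src j) \<and> sm (tgt j) (\<lambda>i. fn j (x i)) = Some v \<longrightarrow> sm (src j) x \<noteq> None)"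

lemma emb_arr [simp]: "emb j \<Longrightarrow> arr j"
  by (simp add: emb_def)

lemma emb_inj: "emb j \<Longrightarrow> x \<in> carr (src j) \<Longrightarrow> y \<in> carr (src j) \<Longrightarrow> fn j x = fn j y \<Longrightarrow> x = y"
  by (auto simp: emb_def inj_on_def)

lemma emb_sm:
  assumes "emb j" "\<And>i. x i \<in> carr (src j)" "sm (tgt j) (\<lambda>i. fn j (x i)) = Some v"
  obtains u where "sm (src j) x = Some u" "fn j u = v" "u \<in> carr (src j)"
proof -
  from assms obtain u where u: "sm (src j) x = Some u" unfolding emb_def by blast
  then have "fn j u = v" using sm_arr [of j x u] assms by simp
  then show thesis using that u sigma_monoid.sm_carr(2) [OF arrD(1) u] assms by simp
qed

lemma emb_cancel:
  assumes "emb j" "arr f" "arr g" "src f = src g" "tgt f = src j" "tgt g = src j" "j \<odot> f = j \<odot> g"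
  shows "f = g"
proof (rule arr_eqI)
  fix x assume x: "x \<in> carr (src f)"
  have "fn (j \<odot> f) x = fn (j \<odot> g) x" using assms(7) by simp
  then have "fn j (fn f x) = fn j (fn g x)" using x assms(4) fn_comp [of x f j] fn_comp [of x g j] by simp
  then show "fn f x = fn g x"
    using emb_inj [OF assms(1)] x assms arr_closed by metis
qed (use assms in auto)

text \<open>The set-theoretic factor is linear because \<open>k\<close> is injective and reflects
  sums.\<close>

lemma emb_factor:
  assumes k: "emb k" and f: "arr f" "tgt f = tgt k" and im: "fn f ` carr (src f) \<subseteq> fn k ` carr (src k)"
  obtains g where "arr g" "src g = src f" "tgt g = src k" "k \<odot> g = f"
proof -
  let ?g = "\<lambda>x. inv_into (carr (src k)) (fn k) (fn f x)"
  have s: "sigma_monoid (src f)" "sigma_monoid (src k)" using f k by (simp_all add: arrD)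
  interpret F: sigma_monoid "src f" by (rule s)
  interpret K: sigma_monoid "src k" by (rule s)
  have g: "?g x \<in> carr (src k)" "fn k (?g x) = fn f x" if "x \<in> carr (src f)" for x
  proof -
    have "fn f x \<in> fn k ` carr (src k)" using im that by blast
    then show "?g x \<in> carr (src k)" "fn k (?g x) = fn f x"
      by (simp_all add: inv_into_into f_inv_into_f)
  qed
  have "linear_map (src f) (src k) (\<lambda>x\<in>carr (src f). ?g x)"
  proof (rule linear_map_restrictI [OF s(1)])
    show "?g x \<in> carr (src k)" if "x \<in> carr (src f)" for x by (rule g [OF that])
    show "?g (zer (src f)) = zer (src k)"
      by (rule emb_inj [OF k])
        (use g [OF F.zer_closed] K.zer_closed zer_arr [OF f(1)] zer_arr [of k] k f in auto)
    fix X s assume X: "sm (src f) X = Some s"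
    note Xc = F.sm_carr [OF X]
    have "sm (tgt k) (\<lambda>i. fn k (?g (X i))) = Some (fn f s)"
      using sm_arr [OF f(1) X] g(2) [OF Xc(1)] f by simp
    then obtain u where u: "sm (src k) (\<lambda>i. ?g (X i)) = Some u" "fn k u = fn f s" "u \<in> carr (src k)"
      using emb_sm [OF k, of "\<lambda>i. ?g (X i)"] g(1) [OF Xc(1)] by blast
    then have "u = ?g s" using emb_inj [OF k] g [OF Xc(2)] by metis
    with u show "sm (src k) (\<lambda>i. ?g (X i)) = Some (?g s)" by simp
  qed
  then have a: "arr \<lparr>src = src f, tgt = src k, fn = (\<lambda>x\<in>carr (src f). ?g x)\<rparr>" by (rule arr_mk [OF s])
  have "k \<odot> \<lparr>src = src f, tgt = src k, fn = (\<lambda>x\<in>carr (src f). ?g x)\<rparr> = f"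
    by (rule arr_eqI) (use a f g k in \<open>auto simp: fn_comp\<close>)
  with a show thesis by (intro that) auto
qed

section \<open>Closed subsets and transported structure\<close>

definition closed_sub :: "'a smon \<Rightarrow> 'a set \<Rightarrow> bool" where
  "closed_sub M A \<longleftrightarrow> A \<subseteq> carr M \<and> zer M \<in> A \<and> (\<forall>x s. range x \<subseteq> A \<and> sm M x = Some s \<longrightarrow> s \<in> A)"

text \<open>Structure transported along an injection \<open>j\<close> of \<open>A\<close> into
  \<open>M\<close>. The identity gives restriction to a subset; an enumeration by sets of naturals
  gives a copy, on the type \<open>nat set\<close>, of a small subset of a comonoid.\<close>

definition pull :: "'a smon \<Rightarrow> ('b \<Rightarrow> 'a) \<Rightarrow> 'b set \<Rightarrow> 'b smon" where
  "pull M j A = \<lparr>carr = A, zer = inv_into A j (zer M),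
     sm = (\<lambda>x. if range x \<subseteq> A then map_option (inv_into A j) (sm M (\<lambda>i. j (x i))) else None)\<rparr>"

abbreviation restr :: "'a smon \<Rightarrow> 'a set \<Rightarrow> 'a smon" where
  "restr M A \<equiv> pull M (\<lambda>x. x) A"

lemma carr_pull [simp]: "carr (pull M j A) = A"
  by (simp add: pull_def)

lemma zer_pull:
  assumes "closed_sub M (j ` A)"
  shows "zer (pull M j A) \<in> A" "j (zer (pull M j A)) = zer M"
proof -
  have "zer M \<in> j ` A" using assms by (simp add: closed_sub_def)
  then show "zer (pull M j A) \<in> A" "j (zer (pull M j A)) = zer M"
    by (simp_all add: pull_def inv_into_into f_inv_into_f)
qed

lemma sm_pull_Some:
  assumes c: "closed_sub M (j ` A)" and i: "inj_on j A"
  shows "sm (pull M j A) x = Some v \<longleftrightarrow> range x \<subseteq> A \<and> v \<in> A \<and> sm M (\<lambda>i. j (x i)) = Some (j v)"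
proof
  assume "sm (pull M j A) x = Some v"
  then obtain w where x: "range x \<subseteq> A" and w: "sm M (\<lambda>i. j (x i)) = Some w" "v = inv_into A j w"
    by (auto simp: pull_def split: if_splits)
  have "range (\<lambda>i. j (x i)) \<subseteq> j ` A" using x by auto
  then have "w \<in> j ` A" using c w(1) unfolding closed_sub_def by blast
  then show "range x \<subseteq> A \<and> v \<in> A \<and> sm M (\<lambda>i. j (x i)) = Some (j v)"
    using x w by (simp add: inv_into_into f_inv_into_f)
next
  assume "range x \<subseteq> A \<and> v \<in> A \<and> sm M (\<lambda>i. j (x i)) = Some (j v)"
  then show "sm (pull M j A) x = Some v" using i by (simp add: pull_def)
qed

lemma sigma_monoid_pull:
  assumes M: "sigma_monoid M" and c: "closed_sub M (j ` A)" and i: "inj_on j A"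
  shows "sigma_monoid (pull M j A)"
proof (rule sigma_monoid_initial [where \<pi> = "\<lambda>_. j" and A = "UNIV :: unit set", OF M])
  show "zer (pull M j A) \<in> carr (pull M j A)" "j (zer (pull M j A)) = zer M"
    using zer_pull [OF c] by simp_all
  show "j v \<in> carr M" if "v \<in> carr (pull M j A)" for v
    using c that by (auto simp: closed_sub_def)
  show "sm (pull M j A) x = Some v \<longleftrightarrow> range x \<subseteq> carr (pull M j A) \<and> v \<in> carr (pull M j A) \<and>
    (\<forall>_\<in>(UNIV :: unit set). sm M (\<lambda>i. j (x i)) = Some (j v))" for x v
    by (simp add: sm_pull_Some [OF c i])
  fix x g assume x: "range x \<subseteq> carr (pull M j A)" and g: "\<And>a. a \<in> (UNIV :: unit set) \<Longrightarrow> sm M (\<lambda>i. j (x i)) = Some (g a)"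
  have "range (\<lambda>i. j (x i)) \<subseteq> j ` A" using x by auto
  then have "g a \<in> j ` A" for a using c g unfolding closed_sub_def by blast
  moreover have "g a = g ()" for a by simp
  ultimately show "\<exists>v\<in>carr (pull M j A). \<forall>a\<in>(UNIV :: unit set). j v = g a" by (metis carr_pull imageE)
qed

lemma emb_pull:
  assumes M: "sigma_monoid M" and c: "closed_sub M (j ` A)" and i: "inj_on j A"
  shows "emb \<lparr>src = pull M j A, tgt = M, fn = (\<lambda>x\<in>A. j x)\<rparr>"
proof -
  note iff = sm_pull_Some [OF c i]
  have s: "sigma_monoid (pull M j A)" by (rule sigma_monoid_pull [OF assms])
  have "linear_map (pull M j A) M (\<lambda>x\<in>carr (pull M j A). j x)"
    by (rule linear_map_restrictI [OF s]) (use c zer_pull [OF c] iff in \<open>auto simp: closed_sub_def\<close>)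
  then have "arr \<lparr>src = pull M j A, tgt = M, fn = (\<lambda>x\<in>A. j x)\<rparr>"
    by (intro arr_mk s M) simp
  moreover have "sm (pull M j A) x \<noteq> None" if x: "range x \<subseteq> A" and v: "sm M (\<lambda>i. (\<lambda>x\<in>A. j x) (x i)) = Some v" for x v
  proof -
    have xA: "x i \<in> A" for i using x by auto
    then have v': "sm M (\<lambda>i. j (x i)) = Some v" using v by simp
    have "range (\<lambda>i. j (x i)) \<subseteq> j ` A" using xA by auto
    then have "v \<in> j ` A" using c v' unfolding closed_sub_def by blast
    then obtain u where "u \<in> A" "v = j u" by blast
    then have "sm (pull M j A) x = Some u" using x v' iff by simp
    then show ?thesis by simp
  qed
  ultimately show ?thesis using i by (auto simp: emb_def inj_on_def)
qed

lemma emb_image_closed: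
  assumes "emb j"
  shows "closed_sub (tgt j) (fn j ` carr (src j))"
  unfolding closed_sub_def
proof (intro conjI allI impI)
  have a: "arr j" using assms by simp
  show "fn j ` carr (src j) \<subseteq> carr (tgt j)" using a by (auto simp: arr_closed)
  show "zer (tgt j) \<in> fn j ` carr (src j)"
    using zer_arr [OF a] sigma_monoid.zer_closed [OF arrD(1) [OF a]] by (metis imageI)
  fix x s assume x: "range x \<subseteq> fn j ` carr (src j) \<and> sm (tgt j) x = Some s"
  then have "\<forall>i. \<exists>y. y \<in> carr (src j) \<and> x i = fn j y" by blast
  then obtain y where y: "\<And>i. y i \<in> carr (src j)" "x = (\<lambda>i. fn j (y i))" by (metis ext)
  then show "s \<in> fn j ` carr (src j)" using emb_sm [OF assms, of y s] x by blast
qed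


subsection \<open>Countable witnesses for equations in a tensor product\<close>

text \<open>All closed sets above \<open>V\<close> and \<open>W\<close> are quantified over, not a
  single pair. Witnesses may therefore be enlarged, and those of countably many subderivations can
  be united in the induction.\<close>

definition witness :: "'a smon \<Rightarrow> 'b smon \<Rightarrow> (nat \<Rightarrow> 'a \<times> 'b) \<Rightarrow> (nat \<Rightarrow> 'a \<times> 'b) \<Rightarrow> 'a set \<Rightarrow> 'b set \<Rightarrow> bool" where
  "witness M N s t V W \<longleftrightarrow> countable V \<and> V \<subseteq> carr M \<and> countable W \<and> W \<subseteq> carr N \<and>
     (\<forall>A B. closed_sub M A \<and> V \<subseteq> A \<and> closed_sub N B \<and> W \<subseteq> B \<longrightarrow> teq (restr M A) (restr N B) s t)"

lemma zer_restr: "closed_sub M A \<Longrightarrow> zer (restr M A) = zer M"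
  using zer_pull(2) [of M "\<lambda>x. x" A] by simp

lemma sm_restr:
  assumes "closed_sub M A" "range x \<subseteq> A" "sm M x = Some s"
  shows "sm (restr M A) x = Some s"
  using sm_pull_Some [of M "\<lambda>x. x" A x s] assms by (auto simp: closed_sub_def)

lemma witnessI:
  assumes "countable V" "V \<subseteq> carr M" "countable W" "W \<subseteq> carr N"
    and "\<And>A B. closed_sub M A \<Longrightarrow> V \<subseteq> A \<Longrightarrow> closed_sub N B \<Longrightarrow> W \<subseteq> B \<Longrightarrow> teq (restr M A) (restr N B) s t"
  shows "\<exists>V W. witness M N s t V W"
  by (intro exI [of _ V] exI [of _ W]) (use assms in \<open>simp add: witness_def\<close>)

text \<open>A derivation of an equation between countable sums of pure tensors is a well-founded tree
  with countable branching, so it involves only countably many elements.\<close>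

lemma teq_witness:
  assumes M: "sigma_monoid M" and N: "sigma_monoid N" and "teq M N s t"
  shows "\<exists>V W. witness M N s t V W"
  using assms(3)
proof induction
  case (base s t)
  then show ?case
  proof cases
    case (zer_left y)
    show ?thesis
    proof (rule witnessI [of "{}" _ "{y}"])
      fix A B assume "closed_sub M A" "closed_sub N B" "{y} \<subseteq> B"
      then show "teq (restr M A) (restr N B) s t"
        using zer_left tens_rel.zer_left [of y "restr N B" "restr M A"]
        by (intro gcong.base) (simp add: zer_restr)
    qed (use zer_left in auto)
  next
    case (zer_right x)
    show ?thesis
    proof (rule witnessI [of "{x}" _ "{}"])
      fix A B assume "closed_sub M A" "{x} \<subseteq> A" "closed_sub N B"
      then show "teq (restr M A) (restr N B) s t"
        using zer_right tens_rel.zer_right [of x "restr M A" "restr N B"]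
        by (intro gcong.base) (simp add: zer_restr)
    qed (use zer_right in auto)
  next
    case (sum_left X v y)
    note Xc = sigma_monoid.sm_carr [OF M sum_left(3)]
    show ?thesis
    proof (rule witnessI [of "insert v (range X)" _ "{y}"])
      fix A B assume *: "closed_sub M A" "insert v (range X) \<subseteq> A" "closed_sub N B" "{y} \<subseteq> B"
      then have "sm (restr M A) X = Some v" using sum_left(3) by (intro sm_restr) auto
      then show "teq (restr M A) (restr N B) s t"
        using * sum_left tens_rel.sum_left [of "restr M A" X v y "restr N B"]
        by (intro gcong.base) (simp add: zer_restr)
    qed (use Xc sum_left in auto)
  next
    case (sum_right x Y v)
    note Yc = sigma_monoid.sm_carr [OF N sum_right(4)]
    show ?thesis
    proof (rule witnessI [of "{x}" _ "insert v (range Y)"])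
      fix A B assume *: "closed_sub M A" "{x} \<subseteq> A" "closed_sub N B" "insert v (range Y) \<subseteq> B"
      then have "sm (restr N B) Y = Some v" using sum_right(4) by (intro sm_restr) auto
      then show "teq (restr M A) (restr N B) s t"
        using * sum_right tens_rel.sum_right [of x "restr M A" "restr N B" Y v]
        by (intro gcong.base) (simp add: zer_restr)
    qed (use Yc sum_right in auto)
  qed
next
  case zero
  show ?case
  proof (rule witnessI [of "{}" _ "{}"])
    fix A B assume *: "closed_sub M A" "closed_sub N B"
    then show "teq (restr M A) (restr N B) (\<lambda>_. (zer M, zer N)) (\<lambda>_. (zer M, zer N))"
      using gcong.zero [of "(zer (restr M A), zer (restr N B))" "tens_rel (restr M A) (restr N B)"]
      by (simp add: zer_restr)
  qed auto
next
  case (sym s t)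
  then obtain V W where "witness M N s t V W" by blast
  then have "witness M N t s V W" by (simp add: witness_def gcong.sym)
  then show ?case by blast
next
  case (trans s t u)
  then obtain V W V' W' where "witness M N s t V W" "witness M N t u V' W'" by blast
  then have "witness M N s u (V \<union> V') (W \<union> W')"
    unfolding witness_def by (meson Un_subset_iff countable_Un gcong.trans)
  then show ?case by blast
next
  case (perm s t)
  then obtain V W where w: "witness M N s s V W" by blast
  show ?case
  proof (rule witnessI [of V _ W])
    fix A B assume *: "closed_sub M A" "V \<subseteq> A" "closed_sub N B" "W \<subseteq> B"
    then have "teq (restr M A) (restr N B) s s" using w by (simp only: witness_def)
    moreover have "reindex (zer (restr M A), zer (restr N B)) s t" using perm(2) * by (simp add: zer_restr)
    ultimately show "teq (restr M A) (restr N B) s t" by (rule gcong.perm)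
  qed (use w in \<open>auto simp: witness_def\<close>)
next
  case (flat_cong s t)
  obtain V0 W0 where w0: "witness M N (flat s) (flat s) V0 W0" using flat_cong by blast
  have "\<forall>k. \<exists>V W. witness M N (s k) (t k) V W" using flat_cong by blast
  then obtain V W where w: "\<And>k. witness M N (s k) (t k) (V k) (W k)" by metis
  show ?case
  proof (rule witnessI [of "V0 \<union> (\<Union>k. V k)" _ "W0 \<union> (\<Union>k. W k)"])
    fix A B assume *: "closed_sub M A" "V0 \<union> (\<Union>k. V k) \<subseteq> A" "closed_sub N B" "W0 \<union> (\<Union>k. W k) \<subseteq> B"
    show "teq (restr M A) (restr N B) (flat s) (flat t)"
    proof (rule gcong.flat_cong)
      show "teq (restr M A) (restr N B) (flat s) (flat s)" using * w0 by (auto simp: witness_def)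
      have "V k \<subseteq> A" "W k \<subseteq> B" for k using * by blast+
      then show "teq (restr M A) (restr N B) (s k) (t k)" for k
        using * w [of k] by (simp add: witness_def)
    qed
  next
    show "V0 \<union> (\<Union>k. V k) \<subseteq> carr M" "W0 \<union> (\<Union>k. W k) \<subseteq> carr N"
      using w0 w unfolding witness_def by blast+
  qed (use w0 w in \<open>simp_all add: witness_def\<close>)
next
  case (row s k)
  then obtain V W where w: "witness M N (flat s) (flat s) V W" by blast
  show ?case
  proof (rule witnessI [of V _ W])
    fix A B assume "closed_sub M A" "V \<subseteq> A" "closed_sub N B" "W \<subseteq> B"
    then show "teq (restr M A) (restr N B) (s k) (s k)"
      using w by (intro gcong.row [of _ _ s]) (simp add: witness_def)
  qed (use w in \<open>auto simp: witness_def\<close>)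
qed

lemma range_map_prod:
  assumes f: "arr f" and g: "arr g" and s: "range s \<subseteq> carr (src f) \<times> carr (src g)"
  shows "range (map_prod (fn f) (fn g) \<circ> s) \<subseteq> carr (tgt f) \<times> carr (tgt g)"
proof (rule image_subsetI)
  fix i
  have "s i \<in> carr (src f) \<times> carr (src g)" using s by auto
  then show "(map_prod (fn f) (fn g) \<circ> s) i \<in> carr (tgt f) \<times> carr (tgt g)"
    using f g by (cases "s i") (simp add: arr_closed)
qed

lemma tmap_sum:
  assumes f: "arr f" and g: "arr g" and s: "range s \<subseteq> carr (src f) \<times> carr (src g)"
    and u: "sm (src f \<otimes> src g) (pure_tensor (src f) (src g) \<circ> s) = Some u"
  shows "sm (tgt f \<otimes> tgt g) (pure_tensor (tgt f) (tgt g) \<circ> (map_prod (fn f) (fn g) \<circ> s)) = Some (fn (f \<otimes>\<^sub>m g) u)"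
proof -
  have "fn (f \<otimes>\<^sub>m g) (pure_tensor (src f) (src g) (s i)) = pure_tensor (tgt f) (tgt g) (map_prod (fn f) (fn g) (s i))" for i
  proof -
    have "s i \<in> carr (src f) \<times> carr (src g)" using s by auto
    then show ?thesis using f g by (cases "s i") simp
  qed
  then show ?thesis
    using sm_arr [OF arr_tmap [OF f g], of "pure_tensor (src f) (src g) \<circ> s" u] u f g by (simp add: comp_def)
qed

text \<open>Follows from linearity of \<open>f \<otimes>\<^sub>m g\<close> through the meaning of
  \<open>teq\<close> in the chosen tensor products.\<close>

lemma teq_map:
  assumes f: "arr f" and g: "arr g" and st: "teq (src f) (src g) s t"
  shows "teq (tgt f) (tgt g) (map_prod (fn f) (fn g) \<circ> s) (map_prod (fn f) (fn g) \<circ> t)"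
proof -
  note sg = arrD(1,2) [OF f] arrD(1,2) [OF g]
  note r = teq_range [OF sg(1,3) st]
  obtain u where u: "sm (src f \<otimes> src g) (pure_tensor (src f) (src g) \<circ> s) = Some u"
    "sm (src f \<otimes> src g) (pure_tensor (src f) (src g) \<circ> t) = Some u"
    using st teq_pure [OF sg(1,3) r] by blast
  show ?thesis
    using teq_pure [OF sg(2,4) range_map_prod [OF f g r(1)] range_map_prod [OF f g r(2)]]
      tmap_sum [OF f g r(1) u(1)] tmap_sum [OF f g r(2) u(2)] by blast
qed

text \<open>Both halves of \<open>emb\<close> reduce to reflecting derivability: injectivity by
  decomposing two elements into pure tensors, and reflection of sums by flattening decompositions of
  the summands, where summability is \<open>teq\<close> of the flattened family with itself.\<close>

lemma emb_tmapI:
  assumes i: "arr i" and j: "arr j"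
    and refl: "\<And>s t. range s \<subseteq> carr (src i) \<times> carr (src j) \<Longrightarrow> range t \<subseteq> carr (src i) \<times> carr (src j) \<Longrightarrow>
      teq (tgt i) (tgt j) (map_prod (fn i) (fn j) \<circ> s) (map_prod (fn i) (fn j) \<circ> t) \<Longrightarrow> teq (src i) (src j) s t"
  shows "emb (i \<otimes>\<^sub>m j)"
proof -
  let ?A = "src i" and ?B = "src j" and ?m = "map_prod (fn i) (fn j)"
  note s = arrD(1,2) [OF i] arrD(1,2) [OF j]
  interpret S: sigma_monoid "?A \<otimes> ?B" using s by simp
  interpret T: sigma_monoid "tgt i \<otimes> tgt j" using s by simp
  note m = range_map_prod [OF i j]
  have "inj_on (fn (i \<otimes>\<^sub>m j)) (carr (?A \<otimes> ?B))"
  proof (rule inj_onI)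
    fix u v assume u: "u \<in> carr (?A \<otimes> ?B)" and v: "v \<in> carr (?A \<otimes> ?B)" and eq: "fn (i \<otimes>\<^sub>m j) u = fn (i \<otimes>\<^sub>m j) v"
    obtain p where p: "range p \<subseteq> carr ?A \<times> carr ?B" "sm (?A \<otimes> ?B) (pure_tensor ?A ?B \<circ> p) = Some u"
      using tensor_gen [OF s(1,3) u] by blast
    obtain q where q: "range q \<subseteq> carr ?A \<times> carr ?B" "sm (?A \<otimes> ?B) (pure_tensor ?A ?B \<circ> q) = Some v"
      using tensor_gen [OF s(1,3) v] by blast
    have "teq (tgt i) (tgt j) (?m \<circ> p) (?m \<circ> q)"
      using teq_pure [OF s(2,4) m [OF p(1)] m [OF q(1)]] tmap_sum [OF i j p] tmap_sum [OF i j q] eq by simp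
    from refl [OF p(1) q(1) this] show "u = v"
      using teq_pure [OF s(1,3) p(1) q(1)] p(2) q(2) by simp
  qed
  moreover have "sm (?A \<otimes> ?B) x \<noteq> None"
    if x: "range x \<subseteq> carr (?A \<otimes> ?B)" and v: "sm (tgt i \<otimes> tgt j) (\<lambda>k. fn (i \<otimes>\<^sub>m j) (x k)) = Some v" for x v
  proof -
    have "\<forall>k. \<exists>p. range p \<subseteq> carr ?A \<times> carr ?B \<and> sm (?A \<otimes> ?B) (pure_tensor ?A ?B \<circ> p) = Some (x k)"
      using x by (intro allI tensor_gen [OF s(1,3)]) auto
    then obtain p where p: "\<And>k. range (p k) \<subseteq> carr ?A \<times> carr ?B"
      "\<And>k. sm (?A \<otimes> ?B) (pure_tensor ?A ?B \<circ> p k) = Some (x k)" by metis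
    have pf: "range (flat p) \<subseteq> carr ?A \<times> carr ?B" unfolding range_flat using p(1) by blast
    have pure1: "pure_tensor ?A ?B q \<in> carr (?A \<otimes> ?B)" if "q \<in> carr ?A \<times> carr ?B" for q
      using that s by (cases q) simp
    have pure2: "pure_tensor (tgt i) (tgt j) q \<in> carr (tgt i \<otimes> tgt j)" if "q \<in> carr (tgt i) \<times> carr (tgt j)" for q
      using that s by (cases q) simp
    have r1: "range (flat (\<lambda>k. pure_tensor ?A ?B \<circ> p k)) \<subseteq> carr (?A \<otimes> ?B)"
      unfolding comp_flat [symmetric] image_comp [symmetric] using pf by (auto intro!: pure1 simp: image_subset_iff)
    have r2: "range (flat (\<lambda>k. pure_tensor (tgt i) (tgt j) \<circ> (?m \<circ> p k))) \<subseteq> carr (tgt i \<otimes> tgt j)"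
      unfolding comp_flat [symmetric] image_comp [symmetric] using m [OF pf] by (auto intro!: pure2 simp: image_subset_iff)
    have "sm (tgt i \<otimes> tgt j) (flat (\<lambda>k. pure_tensor (tgt i) (tgt j) \<circ> (?m \<circ> p k))) = Some v"
      unfolding T.sm_flat_Some [OF r2]
      by (intro exI [of _ "\<lambda>k. fn (i \<otimes>\<^sub>m j) (x k)"]) (use tmap_sum [OF i j p] v in auto)
    then have "teq (tgt i) (tgt j) (?m \<circ> flat p) (?m \<circ> flat p)"
      using teq_pure [OF s(2,4) m [OF pf] m [OF pf]] by (simp add: comp_flat)
    then have "teq ?A ?B (flat p) (flat p)" by (rule refl [OF pf pf])
    then obtain u where "sm (?A \<otimes> ?B) (flat (\<lambda>k. pure_tensor ?A ?B \<circ> p k)) = Some u"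
      using teq_pure [OF s(1,3) pf pf] by (auto simp: comp_flat)
    then obtain r where "\<And>k. sm (?A \<otimes> ?B) (pure_tensor ?A ?B \<circ> p k) = Some (r k)" "sm (?A \<otimes> ?B) r = Some u"
      unfolding S.sm_flat_Some [OF r1] by blast
    moreover from this p(2) have "r = x" by (intro ext) simp
    ultimately show ?thesis by simp
  qed
  ultimately show ?thesis using i j by (auto simp: emb_def)
qed

text \<open>The inverse of an embedding as an arrow defined on the image; it brings derivations over
  the image back to the source.\<close>

lemma emb_retract:
  assumes j: "emb j"
  obtains r where "arr r" "src r = restr (tgt j) (fn j ` carr (src j))" "tgt r = src j"
    "\<And>x. x \<in> carr (src j) \<Longrightarrow> fn r (fn j x) = x"
proof -
  let ?A = "fn j ` carr (src j)"
  have c: "closed_sub (tgt j) ?A" by (rule emb_image_closed [OF j])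
  have T: "sigma_monoid (tgt j)" using j by (simp add: arrD)
  let ?e = "\<lparr>src = restr (tgt j) ?A, tgt = tgt j, fn = (\<lambda>x\<in>?A. x)\<rparr>"
  have e: "emb ?e" by (rule emb_pull [OF T]) (use c in auto)
  obtain r where r: "arr r" "src r = src ?e" "tgt r = src j" "j \<odot> r = ?e"
    using emb_factor [OF j, of ?e] e emb_arr [OF e] by auto
  have "fn r (fn j x) = x" if x: "x \<in> carr (src j)" for x
  proof (rule emb_inj [OF j _ x])
    have jx: "fn j x \<in> carr (src r)" using r x by simp
    then show "fn r (fn j x) \<in> carr (src j)" using r(1,3) by (simp add: arr_closed)
    have "fn j (fn r (fn j x)) = fn (j \<odot> r) (fn j x)" using jx by (simp add: fn_comp)
    then show "fn j (fn r (fn j x)) = fn j x" using r(4) x by simp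
  qed
  with r show thesis by (intro that [of r]) auto
qed

text \<open>A derivation whose witnesses lie in the images takes place over the images, and
  \<open>teq_map\<close> along the two inverses turns it into a derivation over the sources.\<close>

lemma emb_tmap_witness:
  assumes i: "emb i" and j: "emb j"
    and wit: "\<And>s t. range s \<subseteq> carr (src i) \<times> carr (src j) \<Longrightarrow> range t \<subseteq> carr (src i) \<times> carr (src j) \<Longrightarrow>
      teq (tgt i) (tgt j) (map_prod (fn i) (fn j) \<circ> s) (map_prod (fn i) (fn j) \<circ> t) \<Longrightarrow>
      \<exists>V W. witness (tgt i) (tgt j) (map_prod (fn i) (fn j) \<circ> s) (map_prod (fn i) (fn j) \<circ> t) V W \<and>
        V \<subseteq> fn i ` carr (src i) \<and> W \<subseteq> fn j ` carr (src j)"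
  shows "emb (i \<otimes>\<^sub>m j)"
proof (rule emb_tmapI)
  let ?m = "map_prod (fn i) (fn j)"
  show "arr i" "arr j" using i j by simp_all
  fix s t assume s: "range s \<subseteq> carr (src i) \<times> carr (src j)" and t: "range t \<subseteq> carr (src i) \<times> carr (src j)"
    and eq: "teq (tgt i) (tgt j) (?m \<circ> s) (?m \<circ> t)"
  obtain ri where ri: "arr ri" "src ri = restr (tgt i) (fn i ` carr (src i))" "tgt ri = src i"
    "\<And>x. x \<in> carr (src i) \<Longrightarrow> fn ri (fn i x) = x" using emb_retract [OF i] by blast
  obtain rj where rj: "arr rj" "src rj = restr (tgt j) (fn j ` carr (src j))" "tgt rj = src j"
    "\<And>x. x \<in> carr (src j) \<Longrightarrow> fn rj (fn j x) = x" using emb_retract [OF j] by blast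
  have "teq (src ri) (src rj) (?m \<circ> s) (?m \<circ> t)"
    using wit [OF s t eq] emb_image_closed [OF i] emb_image_closed [OF j] ri(2) rj(2)
    by (auto simp: witness_def)
  from teq_map [OF ri(1) rj(1) this]
  have "teq (src i) (src j) (map_prod (fn ri) (fn rj) \<circ> (?m \<circ> s)) (map_prod (fn ri) (fn rj) \<circ> (?m \<circ> t))"
    using ri rj by simp
  moreover have "map_prod (fn ri) (fn rj) \<circ> (?m \<circ> p) = p" if "range p \<subseteq> carr (src i) \<times> carr (src j)" for p :: "nat \<Rightarrow> _"
  proof
    fix n
    have "p n \<in> carr (src i) \<times> carr (src j)" using that by auto
    then show "(map_prod (fn ri) (fn rj) \<circ> (?m \<circ> p)) n = p n" using ri(4) rj(4) by (cases "p n") simp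
  qed
  ultimately show "teq (src i) (src j) s t" using s t by simp
qed

text \<open>Composed with a tensor power of \<open>j\<close>, each law of \<open>D\<close> becomes a
  law of \<open>C\<close>, and then the embedding is cancelled: \<open>j\<close> itself for the
  counit laws, the square for cocommutativity, the cube for coassociativity.\<close>

lemma cocomm_comonoid_sub:
  assumes D: "comonoid_data D" and C: "cocomm_comonoid C" and j: "j \<in> CHom D C"
    and e: "emb j" "emb (j \<otimes>\<^sub>m j)" "emb (j \<otimes>\<^sub>m (j \<otimes>\<^sub>m j))"
  shows "cocomm_comonoid D"
proof -
  have dC [simp]: "comonoid_data C" using C by simp
  note [simp] = D CHomD [OF D dC j]
  note c = C [unfolded cocomm_comonoid_iff]
  have "j \<odot> (lunit (und D) \<odot> (counit D \<otimes>\<^sub>m ident (und D)) \<odot> comult D) = j \<odot> ident (und D)"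
    using c transfer_lunit [OF D dC j] by simp
  then have 1: "lunit (und D) \<odot> (counit D \<otimes>\<^sub>m ident (und D)) \<odot> comult D = ident (und D)"
    by (rule emb_cancel [OF e(1), rotated 5]) simp_all
  have "j \<odot> (runit (und D) \<odot> (ident (und D) \<otimes>\<^sub>m counit D) \<odot> comult D) = j \<odot> ident (und D)"
    using c transfer_runit [OF D dC j] by simp
  then have 2: "runit (und D) \<odot> (ident (und D) \<otimes>\<^sub>m counit D) \<odot> comult D = ident (und D)"
    by (rule emb_cancel [OF e(1), rotated 5]) simp_all
  have "(j \<otimes>\<^sub>m j) \<odot> (swap (und D) (und D) \<odot> comult D) = (j \<otimes>\<^sub>m j) \<odot> comult D"
    using c transfer_swap [OF D dC j] CHom_comult [OF D dC j] by simp
  then have 3: "swap (und D) (und D) \<odot> comult D = comult D"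
    by (rule emb_cancel [OF e(2), rotated 5]) simp_all
  have "(j \<otimes>\<^sub>m (j \<otimes>\<^sub>m j)) \<odot> (assoc (und D) (und D) (und D) \<odot> (comult D \<otimes>\<^sub>m ident (und D)) \<odot> comult D) =
      (j \<otimes>\<^sub>m (j \<otimes>\<^sub>m j)) \<odot> ((ident (und D) \<otimes>\<^sub>m comult D) \<odot> comult D)"
    using c transfer_assoc_left [OF D dC j] transfer_assoc_right [OF D dC j] by simp
  then have "assoc (und D) (und D) (und D) \<odot> (comult D \<otimes>\<^sub>m ident (und D)) \<odot> comult D =
      (ident (und D) \<otimes>\<^sub>m comult D) \<odot> comult D"
    by (rule emb_cancel [OF e(3), rotated 5]) simp_all
  with 1 2 3 D show ?thesis unfolding cocomm_comonoid_iff by (intro conjI)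
qed

subsection \<open>Sets of at most continuum size\<close>

text \<open>\<open>nat set\<close> stands for the continuum. Containment in a range, rather than
  equality with one, covers the empty set and makes passage to subsets immediate.\<close>

definition small :: "'a set \<Rightarrow> bool" where
  "small S \<longleftrightarrow> (\<exists>e :: nat set \<Rightarrow> 'a. S \<subseteq> range e)"

lemma small_subset: "small S \<Longrightarrow> T \<subseteq> S \<Longrightarrow> small T"
  by (auto simp: small_def)

lemma small_image: "small S \<Longrightarrow> small (f ` S)"
proof -
  assume "small S"
  then obtain e :: "nat set \<Rightarrow> 'a" where "S \<subseteq> range e" by (auto simp: small_def)
  then have "f ` S \<subseteq> range (f \<circ> e)" by auto
  then show ?thesis by (auto simp: small_def)
qed

lemma small_UNIV: "small (UNIV :: nat set set)"
  unfolding small_def by (intro exI [of _ "\<lambda>x. x"]) simp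

lemma small_countable:
  assumes "countable S"
  shows "small S"
proof (cases "S = {}")
  case False
  have "(LEAST n. n \<in> {m}) = m" for m :: nat by (rule Least_equality) auto
  \<comment> \<open>The index \<open>n\<close> is coded by the set \<open>{n}\<close> and recovered
    as its least element.\<close>
  then have "S = (\<lambda>A. from_nat_into S (LEAST n. n \<in> A)) ` range (\<lambda>n. {n})"
    using range_from_nat_into [OF False assms] by (simp only: image_image)
  then have "S \<subseteq> range (\<lambda>A :: nat set. from_nat_into S (LEAST n. n \<in> A))" by blast
  then show ?thesis by (auto simp: small_def)
qed (simp add: small_def)

text \<open>The continuum equals its own countable power: a sequence of codes becomes one set whose
  \<open>i\<close>-th section under \<open>prod_encode\<close> is the \<open>i\<close>-th
  code.\<close>

lemma small_seqs:
  assumes "small S"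
  shows "small {s :: nat \<Rightarrow> 'a. range s \<subseteq> S}"
proof -
  obtain e :: "nat set \<Rightarrow> 'a" where e: "S \<subseteq> range e" using assms by (auto simp: small_def)
  let ?e = "\<lambda>A i. e {k. prod_encode (i, k) \<in> A}"
  have "s \<in> range ?e" if "range s \<subseteq> S" for s
  proof -
    have "\<forall>i. s i \<in> range e" using e that by blast
    then have "\<forall>i. \<exists>B. s i = e B" by blast
    then obtain B where B: "\<And>i. s i = e (B i)" by metis
    have "{k. prod_encode (i, k) \<in> {prod_encode (i, k) |i k. k \<in> B i}} = B i" for i by auto
    then have "s = ?e {prod_encode (i, k) |i k. k \<in> B i}" using B by auto
    then show ?thesis by blast
  qed
  then show ?thesis unfolding small_def by (intro exI [of _ ?e]) blast
qed

lemma small_UN: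
  assumes "small I" "\<And>i. i \<in> I \<Longrightarrow> small (F i)"
  shows "small (\<Union>i\<in>I. F i)"
proof -
  obtain e :: "nat set \<Rightarrow> 'a" where e: "I \<subseteq> range e" using assms by (auto simp: small_def)
  have "\<forall>i\<in>I. \<exists>g :: nat set \<Rightarrow> 'b. F i \<subseteq> range g" using assms(2) by (simp add: small_def)
  then obtain g :: "'a \<Rightarrow> nat set \<Rightarrow> 'b" where g: "\<And>i. i \<in> I \<Longrightarrow> F i \<subseteq> range (g i)" by metis
  \<comment> \<open>Even numbers code the index, odd numbers a member of the set at that
    index.\<close>
  let ?h = "\<lambda>A. g (e {n. 2 * n \<in> A}) {n. 2 * n + 1 \<in> A}"
  have "x \<in> range ?h" if x: "x \<in> (\<Union>i\<in>I. F i)" for x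
  proof -
    obtain i where i: "i \<in> I" "x \<in> F i" using x by blast
    then obtain B C where "i = e B" "x = g i C" using e g by blast
    moreover have "{n. 2 * n \<in> (\<lambda>n. 2 * n) ` B \<union> (\<lambda>n. 2 * n + 1) ` C} = B" by (auto, presburger)
    moreover have "{n. 2 * n + 1 \<in> (\<lambda>n. 2 * n) ` B \<union> (\<lambda>n. 2 * n + 1) ` C} = C" by (auto, presburger)
    ultimately have "x = ?h ((\<lambda>n. 2 * n) ` B \<union> (\<lambda>n. 2 * n + 1) ` C)" by simp
    then show ?thesis by blast
  qed
  then show ?thesis unfolding small_def by (intro exI [of _ ?h]) blast
qed

lemma small_Un: "small S \<Longrightarrow> small T \<Longrightarrow> small (S \<union> T)"
  using small_UN [of "{False, True}" "\<lambda>b. if b then T else S"] by (simp add: small_countable split: if_splits)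

lemma small_Times: "small S \<Longrightarrow> small T \<Longrightarrow> small (S \<times> T)"
  unfolding Sigma_def by (intro small_UN) (auto intro: small_countable)

definition code_pair :: "nat set \<Rightarrow> (nat \<Rightarrow> nat set) \<Rightarrow> nat set" where
  "code_pair Y Z = insert 0 {Suc (prod_encode (k, n)) |k n. n \<in> (case k of 0 \<Rightarrow> Y | Suc i \<Rightarrow> Z i)}"

lemma code_pair_eq: "code_pair Y Z = code_pair Y' Z' \<longleftrightarrow> Y = Y' \<and> Z = Z'"
proof
  have *: "{n. Suc (prod_encode (k, n)) \<in> code_pair Y Z} = (case k of 0 \<Rightarrow> Y | Suc i \<Rightarrow> Z i)" for Y Z k
    by (auto simp: code_pair_def)
  assume "code_pair Y Z = code_pair Y' Z'"
  then have "(case k of 0 \<Rightarrow> Y | Suc i \<Rightarrow> Z i) = (case k of 0 \<Rightarrow> Y' | Suc i \<Rightarrow> Z' i)" for k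
    using *[of k Y Z] *[of k Y' Z'] by simp
  from this [of 0] this [of "Suc _"] show "Y = Y' \<and> Z = Z'" by auto
qed simp

text \<open>An element of the closure is described by a well-founded tree with countable branching,
  and such a tree is coded by a set of natural numbers.\<close>

inductive coded :: "('a set \<Rightarrow> 'a set) \<Rightarrow> ('a set \<Rightarrow> nat set \<Rightarrow> 'a) \<Rightarrow> 'a \<Rightarrow> nat set \<Rightarrow> 'a \<Rightarrow> bool"
  for \<Phi> e c0 where
  start: "coded \<Phi> e c0 {} c0"
| step: "(\<And>k. coded \<Phi> e c0 (Z k) (s k)) \<Longrightarrow> e (range s) Y \<in> \<Phi> (range s) \<Longrightarrow>
    coded \<Phi> e c0 (code_pair Y Z) (e (range s) Y)"

text \<open>Decoding is a partial function, so the set of decoded elements is covered by an image of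
  \<open>nat set\<close>.\<close>

lemma coded_unique: "coded \<Phi> e c0 W c \<Longrightarrow> coded \<Phi> e c0 W c' \<Longrightarrow> c = c'"
proof (induction arbitrary: c' rule: coded.induct)
  case start
  then show ?case by (cases rule: coded.cases) (auto simp: code_pair_def)
next
  case (step Z s Y)
  from step.prems show ?case
  proof (cases rule: coded.cases)
    case start
    then show ?thesis by (simp add: code_pair_def)
  next
    case (step Z' s' Y')
    then have eq: "Y = Y'" "Z = Z'" by (simp_all add: code_pair_eq)
    then have "s = s'" using step \<open>\<And>k c'. coded \<Phi> e c0 (Z k) c' \<Longrightarrow> s k = c'\<close> by auto
    then show ?thesis using eq step by simp
  qed
qed

text \<open>Iterating \<Phi> would in general take uncountably many stages. Describing the elements
  by trees instead gives the size bound at once from \<open>coded_unique\<close>.\<close>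

lemma small_closure:
  fixes \<Phi> :: "'a set \<Rightarrow> 'a set"
  assumes S: "small S" "S \<subseteq> U" and c0: "c0 \<in> U"
    and \<Phi>: "\<And>X. countable X \<Longrightarrow> X \<subseteq> U \<Longrightarrow> small (\<Phi> X) \<and> \<Phi> X \<subseteq> U"
  obtains D where "small D" "S \<subseteq> D" "c0 \<in> D" "D \<subseteq> U" "\<And>X. countable X \<Longrightarrow> X \<noteq> {} \<Longrightarrow> X \<subseteq> D \<Longrightarrow> \<Phi> X \<subseteq> D"
proof -
  \<comment> \<open>With \<open>S\<close> added to every value, its elements are reached in one
    step, so the single leaf \<open>c0\<close> suffices to start all trees.\<close>
  let ?\<Phi> = "\<lambda>X. \<Phi> X \<union> S"
  have "\<forall>X. \<exists>g :: nat set \<Rightarrow> 'a. countable X \<and> X \<subseteq> U \<longrightarrow> ?\<Phi> X \<subseteq> range g"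
    using small_Un [OF _ S(1)] \<Phi> unfolding small_def by meson
  then obtain e :: "'a set \<Rightarrow> nat set \<Rightarrow> 'a" where e: "\<And>X. countable X \<Longrightarrow> X \<subseteq> U \<Longrightarrow> ?\<Phi> X \<subseteq> range (e X)"
    by metis
  let ?D = "{c. \<exists>W. coded ?\<Phi> e c0 W c}"
  have DU: "c \<in> U" if "coded ?\<Phi> e c0 W c" for W c
    using that
  proof induction
    case (step Z s Y)
    then show ?case using \<Phi> [of "range s"] S by auto
  qed (rule c0)
  have step: "?\<Phi> X \<subseteq> ?D" if X: "countable X" "X \<noteq> {}" "X \<subseteq> ?D" for X
  proof
    fix c assume c: "c \<in> ?\<Phi> X"
    obtain s :: "nat \<Rightarrow> 'a" where s: "range s = X" using range_from_nat_into [OF X(2,1)] by blast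
    have "\<forall>k. \<exists>W. coded ?\<Phi> e c0 W (s k)" using s X(3) by blast
    then obtain Z where Z: "\<And>k. coded ?\<Phi> e c0 (Z k) (s k)" by metis
    have "X \<subseteq> U" using X(3) DU by blast
    then obtain Y where Y: "c = e X Y" using e [OF X(1)] c by blast
    have "coded ?\<Phi> e c0 (code_pair Y Z) (e (range s) Y)"
      by (rule coded.step [OF Z]) (use c Y s in simp)
    then show "c \<in> ?D" using Y s by blast
  qed
  have "small ?D"
  proof -
    have "c \<in> range (\<lambda>W. THE c. coded ?\<Phi> e c0 W c)" if "coded ?\<Phi> e c0 W c" for W c
      using that coded_unique [of ?\<Phi> e c0 W] by (intro range_eqI [of _ _ W]) (rule the_equality [symmetric], auto)
    then show ?thesis unfolding small_def by (intro exI [of _ "\<lambda>W. THE c. coded ?\<Phi> e c0 W c"]) blast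
  qed
  moreover have "c0 \<in> ?D" using coded.start [of ?\<Phi> e c0] by auto
  moreover from this step [of "{c0}"] have "S \<subseteq> ?D" by simp
  ultimately show thesis using step DU by (intro that [of ?D]) blast+
qed


subsection \<open>Every small subset of a comonoid lies in a small subcomonoid\<close>

text \<open>A small subcomonoid of \<open>C\<close>, relabelled by sets of naturals. The embedding
  of the square is recorded because it makes factors through \<open>j\<close> comonoid
  morphisms.\<close>

definition good :: "'c comonoid \<Rightarrow> nat set comonoid \<Rightarrow> (nat set, 'c) arrow \<Rightarrow> bool" where
  "good C D j \<longleftrightarrow> cocomm_comonoid D \<and> j \<in> CHom D C \<and> emb j \<and> emb (j \<otimes>\<^sub>m j)"

text \<open>The linear factor respects comultiplication because the required equation holds after
  composition with \<open>j \<otimes>\<^sub>m j\<close>, which can be cancelled.\<close>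

lemma good_factor:
  assumes C: "cocomm_comonoid C" and g: "good C D j" and E: "cocomm_comonoid E" and k: "k \<in> CHom E C"
    and im: "fn k ` carr (und E) \<subseteq> fn j ` carr (und D)"
  obtains k' where "k' \<in> CHom E D" "j \<odot> k' = k"
proof -
  have D: "cocomm_comonoid D" and j: "j \<in> CHom D C" and e: "emb j" "emb (j \<otimes>\<^sub>m j)" using g by (auto simp: good_def)
  note d [simp] = cocomm_comonoid_data [OF C] cocomm_comonoid_data [OF D] cocomm_comonoid_data [OF E]
  note [simp] = CHomD [OF d(2,1) j] CHomD [OF d(3,1) k]
  obtain k' where k': "arr k'" "src k' = und E" "tgt k' = und D" "j \<odot> k' = k"
    using emb_factor [OF e(1), of k] im by auto
  have "(j \<otimes>\<^sub>m j) \<odot> (comult D \<odot> k') = comult C \<odot> (j \<odot> k')"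
    by (rule CHom_comult_comp [OF d(2,1) j k'(1,3), symmetric])
  also have "\<dots> = (j \<otimes>\<^sub>m j) \<odot> ((k' \<otimes>\<^sub>m k') \<odot> comult E)"
    using k' by (simp add: CHom_comult [OF d(3,1) k] tmap_comp_comp)
  finally have "comult D \<odot> k' = (k' \<otimes>\<^sub>m k') \<odot> comult E"
    by (rule emb_cancel [OF e(2), rotated 5]) (use k' in simp_all)
  moreover have "counit D \<odot> k' = counit E"
  proof -
    have "counit D \<odot> k' = (counit C \<odot> j) \<odot> k'" by (simp add: CHom_counit [OF d(2,1) j])
    also have "\<dots> = counit C \<odot> (j \<odot> k')" by (rule comp_assoc) (use k' in simp_all)
    finally show ?thesis using k'(4) CHom_counit [OF d(3,1) k] by simp
  qed
  ultimately have "k' \<in> CHom E D" using k' by (simp add: CHom_iff)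
  then show thesis using that k'(4) by blast
qed

definition entries :: "('a \<times> 'a) set \<Rightarrow> 'a set" where
  "entries P = fst ` P \<union> snd ` P"

lemma entries_subset: "entries P \<subseteq> X \<longleftrightarrow> P \<subseteq> X \<times> X"
  by (auto simp: entries_def subset_iff)

lemma countable_entries: "countable P \<Longrightarrow> countable (entries P)"
  by (simp add: entries_def)

text \<open>The subset is closed under four operations on countable sets: \<open>\<Phi>1\<close> makes it closed under sums,
  \<open>\<Phi>2\<close> makes its tensor square embed, \<open>\<Phi>3\<close> makes the comultiplication restrict, and \<open>\<Phi>4\<close> makes its
  tensor cube embed.  Coassociativity is inherited only because of \<open>\<Phi>4\<close>.\<close>

lemma good_exists:
  assumes C: "cocomm_comonoid C" and S: "small S" "S \<subseteq> carr (und C)"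
  obtains D j where "good C D j" "S \<subseteq> fn j ` carr (und D)"
proof -
  let ?M = "und C" let ?T = "?M \<otimes> ?M"
  let ?p = "pure_tensor ?M ?M"
  have dC [simp]: "comonoid_data C" using C by simp
  have M [simp]: "sigma_monoid ?M" and T: "sigma_monoid ?T" by simp_all
  interpret M: sigma_monoid ?M by (rule M)
  interpret T: sigma_monoid ?T by (rule T)
  \<comment> \<open>One decomposition into pure tensors is fixed for each element of the tensor
    square. Once its entries lie in \<open>D\<close>, the element lies in the image of the tensor
    square of the subobject.\<close>
  have "\<forall>v. \<exists>r. v \<in> carr ?T \<longrightarrow> range r \<subseteq> carr ?M \<times> carr ?M \<and> sm ?T (?p \<circ> r) = Some v"
    using tensor_gen [OF M M] by blast
  then obtain q where q: "\<And>v. v \<in> carr ?T \<Longrightarrow> range (q v) \<subseteq> carr ?M \<times> carr ?M \<and> sm ?T (?p \<circ> q v) = Some v"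
    by metis
  let ?ents = "\<lambda>v. entries (range (q v))"
  have ents: "countable (?ents v)" "v \<in> carr ?T \<Longrightarrow> ?ents v \<subseteq> carr ?M" for v
    using q by (auto simp: countable_entries entries_subset)
  have "\<forall>s t. \<exists>V W. teq ?M ?M s t \<longrightarrow> witness ?M ?M s t V W"
    using teq_witness [OF M M] by blast
  then obtain V W where VW: "\<And>s t. teq ?M ?M s t \<Longrightarrow> witness ?M ?M s t (V s t) (W s t)" by metis
  have "\<forall>s t. \<exists>V W. teq ?M ?T s t \<longrightarrow> witness ?M ?T s t V W"
    using teq_witness [OF M T] by blast
  then obtain V' W' where VW': "\<And>s t. teq ?M ?T s t \<Longrightarrow> witness ?M ?T s t (V' s t) (W' s t)" by metis
  \<comment> \<open>For the final \<open>D\<close>, the set \<open>E D\<close> contains the image of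
    the tensor square of the subobject (\<open>kE\<close>); this bounds the right factors that occur
    in the cube.\<close>
  define E where "E X = {v. \<exists>r. range r \<subseteq> X \<times> X \<and> sm ?T (?p \<circ> r) = Some v}" for X
  define \<Phi>1 where "\<Phi>1 X = {c. \<exists>x. range x \<subseteq> X \<and> sm ?M x = Some c}" for X
  define \<Phi>2 where "\<Phi>2 X = (\<Union>(s, t) \<in> {s. range s \<subseteq> X \<times> X} \<times> {t. range t \<subseteq> X \<times> X}.
    if teq ?M ?M s t then V s t \<union> W s t else {})" for X
  define \<Phi>3 where "\<Phi>3 X = (\<Union>c\<in>X. ?ents (fn (comult C) c))" for X
  \<comment> \<open>A derivation over the cube has elements of the tensor square as right factors.
    Only elements of \<open>C\<close> can be added to the subset, so the entries of their fixed
    decompositions are added instead.\<close>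
  define \<Phi>4 where "\<Phi>4 X = (\<Union>(s, t) \<in> {s. range s \<subseteq> X \<times> E X} \<times> {t. range t \<subseteq> X \<times> E X}.
    if teq ?M ?T s t then V' s t \<union> (\<Union>v\<in>W' s t. ?ents v) else {})" for X
  define \<Phi> where "\<Phi> X = \<Phi>1 X \<union> \<Phi>2 X \<union> \<Phi>3 X \<union> \<Phi>4 X" for X
  have \<Phi>2I: "V s t \<union> W s t \<subseteq> \<Phi>2 X" if "range s \<subseteq> X \<times> X" "range t \<subseteq> X \<times> X" "teq ?M ?M s t" for X s t
    unfolding \<Phi>2_def by (intro subsetI UN_I [of "(s, t)"]) (use that in auto)
  have \<Phi>4I: "V' s t \<union> (\<Union>v\<in>W' s t. ?ents v) \<subseteq> \<Phi>4 X"
    if "range s \<subseteq> X \<times> E X" "range t \<subseteq> X \<times> E X" "teq ?M ?T s t" for X s t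
    unfolding \<Phi>4_def by (intro subsetI UN_I [of "(s, t)"]) (use that in auto)
  have comult_closed: "fn (comult C) c \<in> carr ?T" if "c \<in> carr ?M" for c
    using that by (simp add: arr_closed)
  have \<Phi>_ok: "small (\<Phi> X) \<and> \<Phi> X \<subseteq> carr ?M" if X: "countable X" "X \<subseteq> carr ?M" for X
  proof
    have sX: "small X" using X by (simp add: small_countable)
    have sXX: "small {s :: nat \<Rightarrow> _. range s \<subseteq> X \<times> X}" by (intro small_seqs small_Times sX)
    have "E X \<subseteq> (\<lambda>r. the (sm ?T (?p \<circ> r))) ` {s. range s \<subseteq> X \<times> X}"
    proof
      fix v assume "v \<in> E X"
      then obtain r where "range r \<subseteq> X \<times> X" "sm ?T (?p \<circ> r) = Some v" unfolding E_def by blast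
      then show "v \<in> (\<lambda>r. the (sm ?T (?p \<circ> r))) ` {s. range s \<subseteq> X \<times> X}"
        by (intro image_eqI [of _ _ r]) simp_all
    qed
    then have "small (E X)" by (rule small_subset [OF small_image [OF sXX]])
    then have sXE: "small {s :: nat \<Rightarrow> _. range s \<subseteq> X \<times> E X}" by (intro small_seqs small_Times sX)
    have "\<Phi>1 X \<subseteq> (\<lambda>x. the (sm ?M x)) ` {s. range s \<subseteq> X}"
    proof
      fix v assume "v \<in> \<Phi>1 X"
      then obtain r where "range r \<subseteq> X" "sm ?M r = Some v" unfolding \<Phi>1_def by blast
      then show "v \<in> (\<lambda>x. the (sm ?M x)) ` {s. range s \<subseteq> X}"
        by (intro image_eqI [of _ _ r]) simp_all
    qed
    then have "small (\<Phi>1 X)" by (rule small_subset [OF small_image [OF small_seqs [OF sX]]])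
    moreover have "small (\<Phi>2 X)"
      unfolding \<Phi>2_def using VW
      by (intro small_UN small_Times sXX) (auto simp: witness_def intro!: small_countable)
    moreover have "small (\<Phi>3 X)"
      unfolding \<Phi>3_def using ents by (intro small_UN sX small_countable)
    moreover have "small (\<Phi>4 X)"
      unfolding \<Phi>4_def using VW' ents
      by (intro small_UN small_Times sXE) (auto simp: witness_def intro!: small_countable)
    ultimately show "small (\<Phi> X)" unfolding \<Phi>_def by (intro small_Un)
    have "\<Phi>1 X \<subseteq> carr ?M" using M.sm_carr(2) by (auto simp: \<Phi>1_def)
    moreover have "\<Phi>2 X \<subseteq> carr ?M"
    proof
      fix c assume "c \<in> \<Phi>2 X"
      then obtain s t where "teq ?M ?M s t" "c \<in> V s t \<union> W s t"
        unfolding \<Phi>2_def by (auto split: if_splits)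
      then show "c \<in> carr ?M" using VW unfolding witness_def by blast
    qed
    moreover have "\<Phi>3 X \<subseteq> carr ?M" using ents(2) comult_closed X(2) unfolding \<Phi>3_def by blast
    moreover have "\<Phi>4 X \<subseteq> carr ?M"
    proof
      fix c assume "c \<in> \<Phi>4 X"
      then obtain s t where st: "teq ?M ?T s t" "c \<in> V' s t \<union> (\<Union>v\<in>W' s t. ?ents v)"
        unfolding \<Phi>4_def by (auto split: if_splits)
      have "V' s t \<subseteq> carr ?M" "W' s t \<subseteq> carr ?T" using VW' [OF st(1)] by (simp_all add: witness_def)
      then show "c \<in> carr ?M" using st(2) ents(2) by blast
    qed
    ultimately show "\<Phi> X \<subseteq> carr ?M" by (simp add: \<Phi>_def)
  qed
  obtain D where D: "small D" "S \<subseteq> D" "zer ?M \<in> D" "D \<subseteq> carr ?M"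
    and cl: "\<And>X. countable X \<Longrightarrow> X \<noteq> {} \<Longrightarrow> X \<subseteq> D \<Longrightarrow> \<Phi> X \<subseteq> D"
    by (rule small_closure [of S "carr ?M" "zer ?M" \<Phi>]) (use S M.zer_closed \<Phi>_ok in auto)
  have clD: "closed_sub ?M D"
    unfolding closed_sub_def
  proof (intro conjI allI impI)
    fix x s assume x: "range x \<subseteq> D \<and> sm ?M x = Some s"
    then have "s \<in> \<Phi> (range x)" by (auto simp: \<Phi>_def \<Phi>1_def)
    then show "s \<in> D" using cl [of "range x"] x by auto
  qed (use D in auto)
  have cl2: "V s t \<subseteq> D \<and> W s t \<subseteq> D" if "range s \<subseteq> D \<times> D" "range t \<subseteq> D \<times> D" "teq ?M ?M s t" for s t
  proof -
    \<comment> \<open>Two sequences of pairs have only countably many entries, so closure under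
      operations on countable subsets reaches them.\<close>
    let ?X = "entries (range s) \<union> entries (range t)"
    have "?X \<subseteq> D" "countable ?X" using that by (auto simp: entries_subset countable_entries)
    moreover have "?X \<noteq> {}" by (auto simp: entries_def)
    moreover have "range s \<subseteq> ?X \<times> ?X" "range t \<subseteq> ?X \<times> ?X" by (simp_all add: entries_subset [symmetric])
    then have "V s t \<union> W s t \<subseteq> \<Phi>2 ?X" using that(3) by (intro \<Phi>2I)
    ultimately show ?thesis using cl [of ?X] unfolding \<Phi>_def by blast
  qed
  have cl3: "?ents (fn (comult C) c) \<subseteq> D" if "c \<in> D" for c
    using cl [of "{c}"] that by (auto simp: \<Phi>_def \<Phi>3_def)
  have cl4: "V' s t \<subseteq> D \<and> (\<forall>v\<in>W' s t. ?ents v \<subseteq> D)"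
    if s: "range s \<subseteq> D \<times> E D" and t: "range t \<subseteq> D \<times> E D" and st: "teq ?M ?T s t" for s t
  proof -
    \<comment> \<open>The right components of \<open>s\<close> and \<open>t\<close> lie in
      \<open>E D\<close>. Decomposing them over \<open>D\<close> yields a countable subset
      \<open>X\<close> of \<open>D\<close> such that they already lie in \<open>E X\<close>.\<close>
    have "\<forall>v. \<exists>r. v \<in> E D \<longrightarrow> range r \<subseteq> D \<times> D \<and> sm ?T (?p \<circ> r) = Some v" by (auto simp: E_def)
    then obtain r where r: "\<And>v. v \<in> E D \<Longrightarrow> range (r v) \<subseteq> D \<times> D \<and> sm ?T (?p \<circ> r v) = Some v" by metis
    define Y where "Y = range s \<union> range t"
    define X where "X = fst ` Y \<union> (\<Union>v\<in>snd ` Y. entries (range (r v)))"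
    have Y: "Y \<subseteq> D \<times> E D" using s t by (simp add: Y_def)
    have YE: "v \<in> E D" if "v \<in> snd ` Y" for v using Y that by auto
    have "entries (range (r v)) \<subseteq> D" if "v \<in> snd ` Y" for v
      using r [OF YE [OF that]] by (simp add: entries_subset)
    moreover have "fst ` Y \<subseteq> D" using Y by auto
    ultimately have XD: "X \<subseteq> D" unfolding X_def by (intro Un_least UN_least)
    have "countable Y" by (simp add: Y_def)
    then have cX: "countable X"
      unfolding X_def by (intro countable_Un countable_UN countable_image countable_entries) simp_all
    have "X \<noteq> {}" by (simp add: X_def Y_def)
    then have XD': "\<Phi> X \<subseteq> D" by (rule cl [OF cX _ XD])
    have "v \<in> E X" if v: "v \<in> snd ` Y" for v
    proof -
      have "entries (range (r v)) \<subseteq> X" using v unfolding X_def by (intro UnI2 le_supI2 UN_upper)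
      then show ?thesis using r [OF YE [OF v]] unfolding E_def entries_subset by blast
    qed
    moreover have "y \<in> X" if "y \<in> fst ` Y" for y using that by (simp add: X_def)
    ultimately have "p \<in> X \<times> E X" if "p \<in> Y" for p
      using that by (simp add: mem_Times_iff)
    then have "range s \<subseteq> X \<times> E X" "range t \<subseteq> X \<times> E X" by (simp_all add: Y_def image_subset_iff)
    then have "V' s t \<union> (\<Union>v\<in>W' s t. ?ents v) \<subseteq> \<Phi>4 X" using st by (rule \<Phi>4I)
    then have "V' s t \<union> (\<Union>v\<in>W' s t. ?ents v) \<subseteq> D" using XD' unfolding \<Phi>_def by blast
    then show ?thesis by blast
  qed
  \<comment> \<open>\<open>D\<close> is relabelled by sets of naturals; \<open>A\<close> contains
    one code for each element.\<close>
  obtain e :: "nat set \<Rightarrow> _" where "D \<subseteq> range e" using D(1) by (auto simp: small_def)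
  then obtain A where A: "inj_on e A" "D = e ` A" by (auto simp: subset_image_inj)
  define N where "N = pull ?M e A"
  define j where "j = \<lparr>src = N, tgt = ?M, fn = (\<lambda>x\<in>A. e x)\<rparr>"
  have ej: "emb j" unfolding j_def N_def by (rule emb_pull [OF M]) (use clD A in auto)
  have N [simp]: "sigma_monoid N" unfolding N_def by (rule sigma_monoid_pull [OF M]) (use clD A in auto)
  have j [simp]: "arr j" "src j = N" "tgt j = ?M" using ej by (simp_all add: j_def)
  have jN: "fn j ` carr N = D" using A by (auto simp: j_def N_def)
  let ?m = "map_prod (fn j) (fn j)"
  have mD: "range (?m \<circ> s) \<subseteq> D \<times> D" if "range s \<subseteq> carr N \<times> carr N" for s :: "nat \<Rightarrow> _"
    using that jN by (fastforce simp: image_subset_iff mem_Times_iff)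
  have ejj: "emb (j \<otimes>\<^sub>m j)"
  proof (rule emb_tmap_witness [OF ej ej])
    fix s t assume s: "range s \<subseteq> carr (src j) \<times> carr (src j)" and t: "range t \<subseteq> carr (src j) \<times> carr (src j)"
      and "teq (tgt j) (tgt j) (?m \<circ> s) (?m \<circ> t)"
    then have st: "teq ?M ?M (?m \<circ> s) (?m \<circ> t)" by simp
    have "range (?m \<circ> s) \<subseteq> D \<times> D" "range (?m \<circ> t) \<subseteq> D \<times> D" using mD s t by simp_all
    from cl2 [OF this st] VW [OF st]
    show "\<exists>V W. witness (tgt j) (tgt j) (?m \<circ> s) (?m \<circ> t) V W \<and> V \<subseteq> fn j ` carr (src j) \<and> W \<subseteq> fn j ` carr (src j)"
      using jN by auto
  qed
  let ?k = "j \<otimes>\<^sub>m j"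
  \<comment> \<open>The embedding \<open>j \<otimes>\<^sub>m j\<close> reflects sums, hence its
    image contains every sum of pure tensors over \<open>D\<close>.\<close>
  have image: "v \<in> fn ?k ` carr (N \<otimes> N)" if v: "sm ?T (?p \<circ> r) = Some v" and r: "range r \<subseteq> D \<times> D" for r v
  proof -
    have "\<forall>i. \<exists>a. a \<in> carr N \<times> carr N \<and> r i = ?m a"
    proof
      fix i
      have "r i \<in> D \<times> D" using r by auto
      then show "\<exists>a. a \<in> carr N \<times> carr N \<and> r i = ?m a" unfolding jN [symmetric] by (cases "r i") auto
    qed
    then obtain a where a: "\<And>i. a i \<in> carr N \<times> carr N" "\<And>i. r i = ?m (a i)" by metis
    have c: "pure_tensor N N (a i) \<in> carr (src ?k)" for i using a(1) [of i] by (cases "a i") simp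
    have "fn ?k (pure_tensor N N (a i)) = ?p (r i)" for i
      using a(1) [of i] a(2) [of i] by (cases "a i") simp
    then have "sm (tgt ?k) (\<lambda>i. fn ?k (pure_tensor N N (a i))) = Some v"
      using v by (simp add: comp_def)
    then obtain u where "fn ?k u = v" "u \<in> carr (src ?k)"
      using emb_sm [OF ejj, of "\<lambda>i. pure_tensor N N (a i)"] c by blast
    then show ?thesis by auto
  qed
  have image_ents: "v \<in> fn ?k ` carr (N \<otimes> N)" if "v \<in> carr ?T" "?ents v \<subseteq> D" for v
    using image [of "q v" v] q [OF that(1)] that(2) by (simp add: entries_subset)
  have kE: "fn ?k u \<in> E D" if u: "u \<in> carr (N \<otimes> N)" for u
  proof -
    obtain r where r: "range r \<subseteq> carr N \<times> carr N" "sm (N \<otimes> N) (pure_tensor N N \<circ> r) = Some u"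
      using tensor_gen [OF N N u] by blast
    then have "sm ?T (?p \<circ> (?m \<circ> r)) = Some (fn ?k u)" using tmap_sum [of j j r u] by simp
    then show ?thesis using mD [OF r(1)] unfolding E_def by blast
  qed
  have ejk: "emb (j \<otimes>\<^sub>m ?k)"
  proof (rule emb_tmap_witness [OF ej ejj])
    let ?n = "map_prod (fn j) (fn ?k)"
    fix s t assume s: "range s \<subseteq> carr (src j) \<times> carr (src ?k)" and t: "range t \<subseteq> carr (src j) \<times> carr (src ?k)"
      and "teq (tgt j) (tgt ?k) (?n \<circ> s) (?n \<circ> t)"
    then have st: "teq ?M ?T (?n \<circ> s) (?n \<circ> t)" by simp
    have nD: "range (?n \<circ> s) \<subseteq> D \<times> E D" if "range s \<subseteq> carr N \<times> carr (N \<otimes> N)" for s :: "nat \<Rightarrow> _"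
    proof (rule image_subsetI)
      fix i
      have "s i \<in> carr N \<times> carr (N \<otimes> N)" using that by auto
      then show "(?n \<circ> s) i \<in> D \<times> E D" using kE jN by (cases "s i") auto
    qed
    have "range (?n \<circ> s) \<subseteq> D \<times> E D" "range (?n \<circ> t) \<subseteq> D \<times> E D" using nD s t by simp_all
    from cl4 [OF this st] have w: "V' (?n \<circ> s) (?n \<circ> t) \<subseteq> D" "\<And>v. v \<in> W' (?n \<circ> s) (?n \<circ> t) \<Longrightarrow> ?ents v \<subseteq> D"
      by blast+
    have "W' (?n \<circ> s) (?n \<circ> t) \<subseteq> carr ?T" using VW' [OF st] by (simp add: witness_def)
    then have "W' (?n \<circ> s) (?n \<circ> t) \<subseteq> fn ?k ` carr (N \<otimes> N)" using w(2) image_ents by blast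
    with w(1) VW' [OF st]
    show "\<exists>V W. witness (tgt j) (tgt ?k) (?n \<circ> s) (?n \<circ> t) V W \<and> V \<subseteq> fn j ` carr (src j) \<and> W \<subseteq> fn ?k ` carr (src ?k)"
      using jN by auto
  qed
  \<comment> \<open>Closure under \<Phi>3 puts the values of the comultiplication on
    \<open>D\<close> into the image of \<open>j \<otimes>\<^sub>m j\<close>, so that it
    factors.\<close>
  obtain \<delta> where \<delta>: "arr \<delta>" "src \<delta> = N" "tgt \<delta> = N \<otimes> N" "?k \<odot> \<delta> = comult C \<odot> j"
  proof -
    have "fn (comult C \<odot> j) ` carr (src (comult C \<odot> j)) \<subseteq> fn ?k ` carr (src ?k)"
    proof (rule image_subsetI)
      fix x assume "x \<in> carr (src (comult C \<odot> j))"
      then have x: "x \<in> carr N" by simp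
      then have "fn j x \<in> D" using jN by blast
      then have "fn (comult C) (fn j x) \<in> fn ?k ` carr (N \<otimes> N)"
        using image_ents cl3 comult_closed D(4) by blast
      then show "fn (comult C \<odot> j) x \<in> fn ?k ` carr (src ?k)" using x by (simp add: fn_comp)
    qed
    then show thesis using emb_factor [OF ejj, of "comult C \<odot> j"] that by auto
  qed
  define B where "B = \<lparr>und = N, comult = \<delta>, counit = counit C \<odot> j\<rparr>"
  have B [simp]: "und B = N" "comult B = \<delta>" "counit B = counit C \<odot> j" by (simp_all add: B_def)
  have dB: "comonoid_data B" unfolding comonoid_data_def B using \<delta>(1-3) by simp
  have jB: "j \<in> CHom B C" using dB \<delta> by (simp add: CHom_iff)
  have "cocomm_comonoid B" by (rule cocomm_comonoid_sub [OF dB C jB ej ejj ejk])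
  then have "good C B j" using jB ej ejj by (simp add: good_def)
  moreover have "S \<subseteq> fn j ` carr (und B)" using D(2) jN by simp
  ultimately show thesis by (rule that)
qed

subsection \<open>The cofree comonoid\<close>

lemma arrow_eta: "\<lparr>src = src f, tgt = tgt f, fn = fn f\<rparr> = f"
  by simp

definition over :: "'m smon \<Rightarrow> nat set comonoid \<Rightarrow> (nat set \<Rightarrow> 'm) \<Rightarrow> bool" where
  "over M D f \<longleftrightarrow> cocomm_comonoid D \<and> linear_map (und D) M f"

text \<open>The first component of \<open>pad\<close> has an empty carrier, so \<open>pad\<close> differs from all genuine generators
  and is free to denote zero.\<close>

definition pad :: "nat set comonoid \<times> (nat set \<Rightarrow> 'm) \<times> nat set" where
  "pad = (\<lparr>und = \<lparr>carr = {}, zer = {}, sm = (\<lambda>_. None)\<rparr>, comult = undefined, counit = undefined\<rparr>, undefined, {})"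

lemma not_over_pad:
  assumes "pad = (D, f, d)"
  shows "\<not> over M D f"
proof
  assume "over M D f"
  then have "sigma_monoid (und D)" by (simp add: over_def)
  then have "carr (und D) \<noteq> {}" using sigma_monoid.zer_closed by blast
  moreover have "carr (und D) = {}" using assms by (auto simp: pad_def)
  ultimately show False by simp
qed

text \<open>\<open>zer\<close> and \<open>sum\<close> make each injection
  \<open>bang_in M D f\<close> linear; \<open>glue\<close> identifies elements along the morphisms
  of the index category, which are the comonoid morphisms over \<open>M\<close>.\<close>

inductive bang_rel :: "'m smon \<Rightarrow> (nat \<Rightarrow> nat set comonoid \<times> (nat set \<Rightarrow> 'm) \<times> nat set) \<Rightarrow>
    (nat \<Rightarrow> nat set comonoid \<times> (nat set \<Rightarrow> 'm) \<times> nat set) \<Rightarrow> bool" for M where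
  zer: "over M D f \<Longrightarrow> bang_rel M (single pad (D, f, zer (und D))) (\<lambda>_. pad)"
| sum: "over M D f \<Longrightarrow> sm (und D) X = Some x \<Longrightarrow> bang_rel M (\<lambda>i. (D, f, X i)) (single pad (D, f, x))"
| glue: "over M D f \<Longrightarrow> over M D' f' \<Longrightarrow> h \<in> CHom D D' \<Longrightarrow> (\<And>d. d \<in> carr (und D) \<Longrightarrow> f' (fn h d) = f d) \<Longrightarrow>
    d \<in> carr (und D) \<Longrightarrow> bang_rel M (single pad (D, f, d)) (single pad (D', f', fn h d))"

definition bang0 :: "'m smon \<Rightarrow> 'm bangt smon" where
  "bang0 M = presented pad (bang_rel M)"

text \<open>The colimit injection at the index \<open>(D, f)\<close>.\<close>

definition bang_in :: "'m smon \<Rightarrow> nat set comonoid \<Rightarrow> (nat set \<Rightarrow> 'm) \<Rightarrow> (nat set, 'm bangt) arrow" where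
  "bang_in M D f = \<lparr>src = und D, tgt = bang0 M, fn = (\<lambda>d\<in>carr (und D). cls pad (bang_rel M) (single pad (D, f, d)))\<rparr>"

lemma overD:
  assumes "over M D f"
  shows "cocomm_comonoid D" "comonoid_data D" "sigma_monoid (und D)" "linear_map (und D) M f"
  using assms by (auto simp: over_def)

lemma sigma_monoid_bang0 [simp]: "sigma_monoid (bang0 M)"
  by (simp add: bang0_def sigma_monoid_presented)

lemma bang_in_simps [simp]: "src (bang_in M D f) = und D" "tgt (bang_in M D f) = bang0 M"
  by (simp_all add: bang_in_def)

lemma bang_single:
  assumes "over M D f" "d \<in> carr (und D)"
  shows "gcong pad (bang_rel M) (single pad (D, f, d)) (single pad (D, f, d))"
proof -
  interpret sigma_monoid "und D" by (rule overD(3) [OF assms(1)])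
  show ?thesis
    by (rule gcong_refl(2), rule gcong.base, rule bang_rel.sum [OF assms(1) sm_sing [OF assms(2)]])
qed

lemma arr_bang_in [simp]:
  assumes o: "over M D f"
  shows "arr (bang_in M D f)"
proof -
  interpret sigma_monoid "und D" by (rule overD(3) [OF o])
  let ?c = "\<lambda>d. cls pad (bang_rel M) (single pad (D, f, d))"
  have eq: "gcong pad (bang_rel M) s t \<Longrightarrow> cls pad (bang_rel M) s = cls pad (bang_rel M) t" for s t
    using cls_eq gcong_refl by metis
  have "linear_map (und D) (bang0 M) (\<lambda>d\<in>carr (und D). ?c d)"
  proof (rule linear_map_restrictI)
    show "?c d \<in> carr (bang0 M)" if "d \<in> carr (und D)" for d
      using bang_single [OF o that] by (auto simp: bang0_def carr_presented)
    show "?c (zer (und D)) = zer (bang0 M)"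
      unfolding bang0_def zer_presented by (intro eq gcong.base bang_rel.zer o)
    fix X x assume X: "sm (und D) X = Some x"
    have t: "gcong pad (bang_rel M) (\<lambda>i. (D, f, X i)) (single pad (D, f, x))"
      by (intro gcong.base bang_rel.sum o X)
    show "sm (bang0 M) (\<lambda>i. ?c (X i)) = Some (?c x)"
      unfolding bang0_def
      by (subst sm_presented_gen) (use bang_single [OF o] sm_carr(1) [OF X] t gcong_refl(1) [OF t] eq in auto)
  qed (rule sigma_monoid_axioms)
  then show ?thesis unfolding bang_in_def by (intro arr_mk sigma_monoid_axioms sigma_monoid_bang0)
qed

lemma bang_in_glue:
  assumes o: "over M D f" "over M D' f'" and h: "h \<in> CHom D D'"
    and eq: "\<And>d. d \<in> carr (und D) \<Longrightarrow> f' (fn h d) = f d"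
  shows "bang_in M D' f' \<odot> h = bang_in M D f"
proof (rule arr_eqI)
  note d [simp] = overD(2) [OF o(1)] overD(2) [OF o(2)]
  note [simp] = CHomD [OF d h]
  show "arr (bang_in M D' f' \<odot> h)" "arr (bang_in M D f)" using o by simp_all
  fix x assume "x \<in> carr (src (bang_in M D' f' \<odot> h))"
  then have x: "x \<in> carr (und D)" by simp
  then have "fn h x \<in> carr (und D')" by (simp add: arr_closed)
  moreover have "gcong pad (bang_rel M) (single pad (D, f, x)) (single pad (D', f', fn h x))"
    by (intro gcong.base bang_rel.glue o h eq x)
  then have "cls pad (bang_rel M) (single pad (D, f, x)) = cls pad (bang_rel M) (single pad (D', f', fn h x))"
    using cls_eq [OF bang_single [OF o(1) x]] by blast
  ultimately show "fn (bang_in M D' f' \<odot> h) x = fn (bang_in M D f) x"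
    using x by (simp add: fn_comp bang_in_def)
qed (use h overD [OF o(1)] overD [OF o(2)] CHomD [OF _ _ h] in simp_all)

text \<open>The universal property of the colimit, for cocones whose vertex may live on any
  type.\<close>

lemma bang_lift:
  fixes M :: "'m smon"
  assumes L: "sigma_monoid L"
    and \<Phi>: "\<And>D f. over M D f \<Longrightarrow> arr (\<Phi> D f) \<and> src (\<Phi> D f) = und D \<and> tgt (\<Phi> D f) = L"
    and glue: "\<And>D f D' f' h. over M D f \<Longrightarrow> over M D' f' \<Longrightarrow> h \<in> CHom D D' \<Longrightarrow>
      (\<And>d. d \<in> carr (und D) \<Longrightarrow> f' (fn h d) = f d) \<Longrightarrow> \<Phi> D' f' \<odot> h = \<Phi> D f"
  obtains k where "arr k" "src k = bang0 M" "tgt k = L" "\<And>D f. over M D f \<Longrightarrow> k \<odot> bang_in M D f = \<Phi> D f"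
proof -
  interpret L: sigma_monoid L by (rule L)
  \<comment> \<open>The default \<open>zer L\<close> is what sends \<open>pad\<close>, which belongs
    to no index, to zero.\<close>
  define b where "b = (\<lambda>(D, f, d). if over M D f then fn (\<Phi> D f) d else zer L)"
  have b: "over M D f \<Longrightarrow> b (D, f, d) = fn (\<Phi> D f) d" for D f d by (simp add: b_def)
  have pad: "b pad = zer L"
  proof -
    obtain D f d where p: "(pad :: nat set comonoid \<times> (nat set \<Rightarrow> 'm) \<times> nat set) = (D, f, d)"
      by (metis surj_pair)
    show ?thesis unfolding p by (simp add: b_def not_over_pad [OF p])
  qed
  have sing: "sm L (single (b pad) (fn (\<Phi> D f) d)) = Some (fn (\<Phi> D f) d)" if "over M D f" "d \<in> carr (und D)" for D f d
    unfolding pad using \<Phi> [OF that(1)] that(2) by (intro L.sm_sing) (simp add: arr_closed)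
  have sat: "satisfies L b (bang_rel M)"
    unfolding satisfies_def
  proof (intro allI impI)
    fix s t assume "bang_rel M s t"
    then show "\<exists>v. sm L (b \<circ> s) = Some v \<and> sm L (b \<circ> t) = Some v"
    proof cases
      case (zer D f)
      have "fn (\<Phi> D f) (zer (und D)) = zer L" using zer_arr [of "\<Phi> D f"] \<Phi> [OF zer(3)] by simp
      then show ?thesis using zer L.sm_sing [OF L.zer_closed] pad
        by (simp add: comp_single b) (simp add: comp_def)
    next
      case (sum D f X x)
      have "sm L (b \<circ> s) = Some (fn (\<Phi> D f) x)"
        using sm_arr [of "\<Phi> D f" X x] \<Phi> [OF sum(3)] sum by (simp add: comp_def b)
      moreover have "x \<in> carr (und D)" using sigma_monoid.sm_carr(2) [OF overD(3) sum(4)] sum(3) .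
      ultimately show ?thesis using sum sing by (simp add: comp_single b)
    next
      case (glue D f D' f' h d)
      note c = CHomD [OF overD(2) [OF glue(3)] overD(2) [OF glue(4)] glue(5)]
      have "\<Phi> D' f' \<odot> h = \<Phi> D f" by (rule assms(3)) (use glue in auto)
      then have "fn (\<Phi> D' f') (fn h d) = fn (\<Phi> D f) d" using fn_comp [of d h "\<Phi> D' f'"] c glue(7) by simp
      then show ?thesis
        using glue sing [OF glue(3,7)] by (simp add: comp_single b)
    qed
  qed
  define k where "k = (\<lambda>c\<in>carr (presented pad (bang_rel M)). the (sm L (b \<circ> rep c)))"
  note lift = presented_lift [where z = pad, OF L sat pad, folded k_def]
  let ?k = "\<lparr>src = bang0 M, tgt = L, fn = k\<rparr>"
  have k: "arr ?k" using lift(1) by (intro arr_mk L) (simp_all add: bang0_def sigma_monoid_presented)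
  have "?k \<odot> bang_in M D f = \<Phi> D f" if o: "over M D f" for D f
  proof (rule arr_eqI)
    fix d assume "d \<in> carr (src (?k \<odot> bang_in M D f))"
    then have d: "d \<in> carr (und D)" by simp
    have "k (cls pad (bang_rel M) (single pad (D, f, d))) = b (D, f, d)"
      using lift(3) [OF bang_single [OF o d]] by blast
    then show "fn (?k \<odot> bang_in M D f) d = fn (\<Phi> D f) d"
      using d o by (simp add: fn_comp b) (simp add: bang_in_def)
  qed (use k o \<Phi> [OF o] in auto)
  with k show thesis by (intro that [of ?k]) auto
qed

lemma bang_rel_range:
  assumes "bang_rel M s t"
  shows "range s \<subseteq> insert pad {(D, f, d). over M D f \<and> d \<in> carr (und D)} \<and>
    range t \<subseteq> insert pad {(D, f, d). over M D f \<and> d \<in> carr (und D)}"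
  using assms
proof cases
  case (zer D f)
  then show ?thesis using sigma_monoid.zer_closed [OF overD(3)] by (auto simp: range_single)
next
  case (sum D f X x)
  then show ?thesis using sigma_monoid.sm_carr [OF overD(3) [OF sum(3)] sum(4)] by (auto simp: range_single)
next
  case (glue D f D' f' h d)
  then show ?thesis using arr_closed [of h "und D'" d] CHomD [OF overD(2) [OF glue(3)] overD(2) [OF glue(4)] glue(5)]
    by (auto simp: range_single)
qed

text \<open>The injections are jointly epic: every entry of a summable formal sum is either
  \<open>pad\<close> or a generator, and the class of a generator is a value of an
  injection.\<close>

lemma bang_ext:
  assumes a: "arr a" "src a = bang0 M" and b: "arr b" "src b = bang0 M" "tgt a = tgt b"
    and eq: "\<And>D f. over M D f \<Longrightarrow> a \<odot> bang_in M D f = b \<odot> bang_in M D f"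
  shows "a = b"
proof (rule arr_eqI [OF a(1) b(1)])
  fix u assume "u \<in> carr (src a)"
  then obtain s where s: "gcong pad (bang_rel M) s s" "u = cls pad (bang_rel M) s"
    using a by (auto simp: bang0_def carr_presented)
  have r: "range s \<subseteq> insert pad {(D, f, d). over M D f \<and> d \<in> carr (und D)}"
    using gcong_range [OF s(1), of "insert pad {(D, f, d). over M D f \<and> d \<in> carr (und D)}"] bang_rel_range by blast
  have "fn a (cls pad (bang_rel M) (single pad (s i))) = fn b (cls pad (bang_rel M) (single pad (s i)))" for i
  proof -
    have "s i \<in> insert pad {(D, f, d). over M D f \<and> d \<in> carr (und D)}" using r by (rule range_subsetD)
    then consider "s i = pad" | D f d where "s i = (D, f, d)" "over M D f" "d \<in> carr (und D)"
      by (cases "s i") auto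
    then show ?thesis
    proof cases
      case 1
      have "single pad pad = (\<lambda>_. pad :: nat set comonoid \<times> (nat set \<Rightarrow> 'a) \<times> nat set)" by (auto simp: single_def)
      then have "cls pad (bang_rel M) (single pad (s i)) = zer (bang0 M)" using 1 by (simp add: bang0_def zer_presented)
      then show ?thesis using zer_arr [OF a(1)] zer_arr [OF b(1)] a b by simp
    next
      case 2
      then show ?thesis using eq [OF 2(2)] fn_comp [of d "bang_in M D f" a] fn_comp [of d "bang_in M D f" b]
        by (simp add: bang_in_def)
    qed
  qed
  moreover have "sm (bang0 M) ((\<lambda>g. cls pad (bang_rel M) (single pad g)) \<circ> s) = Some u"
    using sm_presented_gen [of pad "bang_rel M" s, OF gcong_entry [OF s(1)]] s by (simp add: bang0_def comp_def)
  ultimately show "fn a u = fn b u"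
    using linear_map_ext_gen [OF arrD(3) [OF a(1), unfolded a] arrD(3) [OF b(1), unfolded b(2) b(3) [symmetric]]]
    by blast
qed (use a b in auto)

text \<open>The structure maps are specified by their composites with the injections, which
  determine them by \<open>bang_ext\<close>. The comonoid laws are derived from these
  equations.\<close>

locale bang_comonoid =
  fixes M :: "'m smon" and B :: "'m bangt comonoid" and d :: "('m bangt, 'm) arrow"
  assumes M [simp]: "sigma_monoid M"
    and data [simp]: "comonoid_data B" and und [simp]: "und B = bang0 M"
    and d [simp]: "arr d" "src d = bang0 M" "tgt d = M"
    and comult_in: "\<And>D f. over M D f \<Longrightarrow> comult B \<odot> bang_in M D f = (bang_in M D f \<otimes>\<^sub>m bang_in M D f) \<odot> comult D"
    and counit_in: "\<And>D f. over M D f \<Longrightarrow> counit B \<odot> bang_in M D f = counit D"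
    and d_in: "\<And>D f. over M D f \<Longrightarrow> d \<odot> bang_in M D f = \<lparr>src = und D, tgt = M, fn = f\<rparr>"

text \<open>Each structure map is induced by a cocone. Compatibility with \<open>glue\<close> is the
  defining property of \<open>h\<close>: it commutes with comultiplications and counits, and it lies
  over \<open>M\<close>.\<close>

lemma bang_comonoid_exists:
  fixes M :: "'m smon"
  assumes M: "sigma_monoid M"
  obtains B d where "bang_comonoid M B d"
proof -
  obtain \<delta> where \<delta>: "arr \<delta>" "src \<delta> = bang0 M" "tgt \<delta> = bang0 M \<otimes> bang0 M"
    "\<And>D f. over M D f \<Longrightarrow> \<delta> \<odot> bang_in M D f = (bang_in M D f \<otimes>\<^sub>m bang_in M D f) \<odot> comult D"
  proof (rule bang_lift [of "bang0 M \<otimes> bang0 M" M "\<lambda>D f. (bang_in M D f \<otimes>\<^sub>m bang_in M D f) \<odot> comult D"])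
    show "sigma_monoid (bang0 M \<otimes> bang0 M)" by simp
    show "arr ((bang_in M D f \<otimes>\<^sub>m bang_in M D f) \<odot> comult D) \<and> src ((bang_in M D f \<otimes>\<^sub>m bang_in M D f) \<odot> comult D) = und D \<and>
      tgt ((bang_in M D f \<otimes>\<^sub>m bang_in M D f) \<odot> comult D) = bang0 M \<otimes> bang0 M" if "over M D f" for D f
      using that overD(2) [OF that] by simp
    fix D f D' f' h assume o: "over M D f" "over M D' f'" and h: "h \<in> CHom D D'"
      and eq: "\<And>d. d \<in> carr (und D) \<Longrightarrow> f' (fn h d) = f d"
    note D [simp] = overD(2) [OF o(1)] overD(2) [OF o(2)]
    note [simp] = CHomD [OF D h]
    show "((bang_in M D' f' \<otimes>\<^sub>m bang_in M D' f') \<odot> comult D') \<odot> h = (bang_in M D f \<otimes>\<^sub>m bang_in M D f) \<odot> comult D"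
      using o by (simp add: comp_assoc CHom_comult [OF D h] tmap_comp_comp bang_in_glue [OF o h eq])
  qed blast
  obtain \<epsilon> where \<epsilon>: "arr \<epsilon>" "src \<epsilon> = bang0 M" "tgt \<epsilon> = unitI" "\<And>D f. over M D f \<Longrightarrow> \<epsilon> \<odot> bang_in M D f = counit D"
    by (rule bang_lift [of unitI M "\<lambda>D f. counit D"]) (auto simp: overD CHom_iff)
  obtain d where d: "arr d" "src d = bang0 M" "tgt d = M"
    "\<And>D f. over M D f \<Longrightarrow> d \<odot> bang_in M D f = \<lparr>src = und D, tgt = M, fn = f\<rparr>"
  proof (rule bang_lift [OF M, of M "\<lambda>D f. \<lparr>src = und D, tgt = M, fn = f\<rparr>"])
    show "arr \<lparr>src = und D, tgt = M, fn = f\<rparr> \<and> src \<lparr>src = und D, tgt = M, fn = f\<rparr> = und D \<and>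
      tgt \<lparr>src = und D, tgt = M, fn = f\<rparr> = M" if "over M D f" for D f
      using overD [OF that] M by (simp add: arr_mk)
    fix D f D' f' h assume o: "over M D f" "over M D' f'" and h: "h \<in> CHom D D'"
      and eq: "\<And>d. d \<in> carr (und D) \<Longrightarrow> f' (fn h d) = f d"
    note D [simp] = overD(2) [OF o(1)] overD(2) [OF o(2)]
    note [simp] = CHomD [OF D h]
    show "\<lparr>src = und D', tgt = M, fn = f'\<rparr> \<odot> h = \<lparr>src = und D, tgt = M, fn = f\<rparr>"
      by (rule arr_eqI) (use overD [OF o(1)] overD [OF o(2)] M eq in \<open>simp_all add: arr_mk fn_comp\<close>)
  qed blast
  define B where "B = \<lparr>und = bang0 M, comult = \<delta>, counit = \<epsilon>\<rparr>"
  have B: "und B = bang0 M" "comult B = \<delta>" "counit B = \<epsilon>" by (simp_all add: B_def)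
  have dB: "comonoid_data B" unfolding comonoid_data_def B using \<delta>(1-3) \<epsilon>(1-3) by simp
  have "bang_comonoid M B d"
    by (rule bang_comonoid.intro) (simp_all only: B M dB \<delta> \<epsilon> d)
  then show thesis by (rule that)
qed

context bang_comonoid
begin

lemma bang_in_CHom: "over M D f \<Longrightarrow> bang_in M D f \<in> CHom D B"
  using overD(2) [of M D f] by (simp add: CHom_iff comult_in counit_in)

text \<open>Each law is checked after composition with every injection, where naturality reduces it
  to the law of the index comonoid.\<close>

lemma cocomm_bang: "cocomm_comonoid B"
proof -
  have 1: "assoc (und B) (und B) (und B) \<odot> (comult B \<otimes>\<^sub>m ident (und B)) \<odot> comult B =
       (ident (und B) \<otimes>\<^sub>m comult B) \<odot> comult B"
  proof (rule bang_ext [of _ M])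
    fix D f assume o: "over M D f"
    note t = overD(2) [OF o] data bang_in_CHom [OF o]
    show "(assoc (und B) (und B) (und B) \<odot> (comult B \<otimes>\<^sub>m ident (und B)) \<odot> comult B) \<odot> bang_in M D f =
        ((ident (und B) \<otimes>\<^sub>m comult B) \<odot> comult B) \<odot> bang_in M D f"
      unfolding transfer_assoc_left [OF t] transfer_assoc_right [OF t]
      using overD(1) [OF o] unfolding cocomm_comonoid_iff by simp
  qed (use comonoid_dataD [OF data] in simp_all)
  have 2: "lunit (und B) \<odot> (counit B \<otimes>\<^sub>m ident (und B)) \<odot> comult B = ident (und B)"
  proof (rule bang_ext [of _ M])
    fix D f assume o: "over M D f"
    note t = overD(2) [OF o] data bang_in_CHom [OF o]
    show "(lunit (und B) \<odot> (counit B \<otimes>\<^sub>m ident (und B)) \<odot> comult B) \<odot> bang_in M D f = ident (und B) \<odot> bang_in M D f"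
      unfolding transfer_lunit [OF t]
      using overD(1) [OF o] o unfolding cocomm_comonoid_iff by simp
  qed (use comonoid_dataD [OF data] in simp_all)
  have 3: "runit (und B) \<odot> (ident (und B) \<otimes>\<^sub>m counit B) \<odot> comult B = ident (und B)"
  proof (rule bang_ext [of _ M])
    fix D f assume o: "over M D f"
    note t = overD(2) [OF o] data bang_in_CHom [OF o]
    show "(runit (und B) \<odot> (ident (und B) \<otimes>\<^sub>m counit B) \<odot> comult B) \<odot> bang_in M D f = ident (und B) \<odot> bang_in M D f"
      unfolding transfer_runit [OF t]
      using overD(1) [OF o] o unfolding cocomm_comonoid_iff by simp
  qed (use comonoid_dataD [OF data] in simp_all)
  have 4: "swap (und B) (und B) \<odot> comult B = comult B"
  proof (rule bang_ext [of _ M])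
    fix D f assume o: "over M D f"
    note t = overD(2) [OF o] data bang_in_CHom [OF o]
    show "(swap (und B) (und B) \<odot> comult B) \<odot> bang_in M D f = comult B \<odot> bang_in M D f"
      unfolding transfer_swap [OF t]
      using overD(1) [OF o] comult_in [OF o] unfolding cocomm_comonoid_iff by simp
  qed (use comonoid_dataD [OF data] in simp_all)
  show ?thesis unfolding cocomm_comonoid_iff using 1 2 3 4 data by (intro conjI)
qed

section \<open>Lifting linear maps to comonoid morphisms\<close>

lemma over_arr:
  assumes "cocomm_comonoid D" "arr f" "src f = und D" "tgt f = M"
  shows "over M D (fn f)"
  using assms arrD(3) [of f] by (simp add: over_def)

lemma bang_in_factor:
  assumes D: "cocomm_comonoid D" and E: "cocomm_comonoid E" and h: "h \<in> CHom D E"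
    and f: "arr f" "src f = und E" "tgt f = M"
  shows "bang_in M E (fn f) \<odot> h = bang_in M D (fn (f \<odot> h))"
proof -
  note d [simp] = cocomm_comonoid_data [OF D] cocomm_comonoid_data [OF E]
  note [simp] = CHomD [OF d h] f
  show ?thesis
    by (rule bang_in_glue) (auto intro!: over_arr D E h simp: fn_comp)
qed

text \<open>Small subcomonoids are jointly epic, since each element of \<open>C\<close> lies in one
  of them.\<close>

lemma good_ext:
  assumes C: "cocomm_comonoid C" and a: "arr a" "src a = und C" and b: "arr b" "src b = und C" "tgt a = tgt b"
    and eq: "\<And>D j. good C D j \<Longrightarrow> a \<odot> j = b \<odot> j"
  shows "a = b"
proof (rule arr_eqI [OF a(1) b(1)])
  fix c assume "c \<in> carr (src a)"
  then have c: "{c} \<subseteq> carr (und C)" using a by simp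
  obtain D j where j: "good C D j" "{c} \<subseteq> fn j ` carr (und D)"
    by (rule good_exists [OF C small_countable c]) simp
  then obtain n where n: "n \<in> carr (und D)" "c = fn j n" by blast
  have "src j = und D"
    using CHomD(2) [of D C j] j(1) cocomm_comonoid_data C by (simp add: good_def)
  then show "fn a c = fn b c"
    using eq [OF j(1)] fn_comp [of n j a] fn_comp [of n j b] n by simp
qed (use a b in auto)

lemma bang_mediating:
  fixes C :: "'c comonoid"
  assumes C: "cocomm_comonoid C" and f: "arr f" "src f = und C" "tgt f = M"
  obtains g where "g \<in> CHom C B" "d \<odot> g = f" "\<And>D j. good C D j \<Longrightarrow> g \<odot> j = bang_in M D (fn (f \<odot> j))"
proof -
  note dC [simp] = cocomm_comonoid_data [OF C]
  note [simp] = f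
  have goodD: "cocomm_comonoid D" "comonoid_data D" "j \<in> CHom D C" "emb j" "arr j" "src j = und D" "tgt j = und C"
    if "good C D j" for D j
    using that CHomD [of D C j] by (simp_all add: good_def)
  have ov: "over M D (fn (f \<odot> j))" if "good C D j" for D j
    using goodD [OF that] by (intro over_arr) simp_all
  \<comment> \<open>The nested case: the inclusion of the smaller subcomonoid into the larger is a
    comonoid morphism over \<open>M\<close>, so \<open>glue\<close> identifies the two
    values.\<close>
  have wd0: "fn (bang_in M D (fn (f \<odot> j))) n = fn (bang_in M E (fn (f \<odot> k))) m"
    if g: "good C D j" "good C E k" and n: "n \<in> carr (und D)" "m \<in> carr (und E)" "fn j n = fn k m"
      and im: "fn j ` carr (und D) \<subseteq> fn k ` carr (und E)" for D j E k n m
  proof -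
    note D [simp] = goodD [OF g(1)] and E [simp] = goodD [OF g(2)]
    obtain k' where k': "k' \<in> CHom D E" "k \<odot> k' = j"
      by (rule good_factor [OF C g(2) D(1,3) im])
    note [simp] = CHomD [OF D(2) E(2) k'(1)]
    have "bang_in M E (fn (f \<odot> k)) \<odot> k' = bang_in M D (fn ((f \<odot> k) \<odot> k'))"
      by (rule bang_in_factor [OF D(1) E(1) k'(1)]) simp_all
    also have "(f \<odot> k) \<odot> k' = f \<odot> j" unfolding k'(2) [symmetric] by (rule comp_assoc) simp_all
    finally have "fn (bang_in M D (fn (f \<odot> j))) n = fn (bang_in M E (fn (f \<odot> k))) (fn k' n)"
      using fn_comp [of n k' "bang_in M E (fn (f \<odot> k))"] n by simp
    moreover have "fn k' n = m"
    proof (rule emb_inj [OF E(4)])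
      show "fn k (fn k' n) = fn k m" using fn_comp [of n k' k] k'(2) n by simp
    qed (use n in \<open>simp_all add: arr_closed\<close>)
    ultimately show ?thesis by simp
  qed
  have wd: "fn (bang_in M D (fn (f \<odot> j))) n = fn (bang_in M E (fn (f \<odot> k))) m"
    if g: "good C D j" "good C E k" and n: "n \<in> carr (und D)" "m \<in> carr (und E)" "fn j n = fn k m" for D j E k n m
  proof -
    note D [simp] = goodD [OF g(1)] and E [simp] = goodD [OF g(2)]
    have "small (fn j ` carr (und D) \<union> fn k ` carr (und E))"
      by (intro small_Un small_image small_subset [OF small_UNIV]) auto
    moreover have "fn j ` carr (und D) \<union> fn k ` carr (und E) \<subseteq> carr (und C)" by (auto simp: arr_closed)
    ultimately obtain F l where l: "good C F l" "fn j ` carr (und D) \<union> fn k ` carr (und E) \<subseteq> fn l ` carr (und F)"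
      by (rule good_exists [OF C])
    then obtain q where q: "q \<in> carr (und F)" "fn l q = fn j n" using n by fastforce
    have "fn (bang_in M D (fn (f \<odot> j))) n = fn (bang_in M F (fn (f \<odot> l))) q"
      by (rule wd0 [OF g(1) l(1)]) (use n q l(2) in auto)
    moreover have "fn (bang_in M E (fn (f \<odot> k))) m = fn (bang_in M F (fn (f \<odot> l))) q"
      by (rule wd0 [OF g(2) l(1)]) (use n q l(2) in auto)
    ultimately show ?thesis by simp
  qed
  have ex: "\<exists>D j n. good C D j \<and> n \<in> carr (und D) \<and> fn j n = c" if "c \<in> carr (und C)" for c
  proof -
    have c: "{c} \<subseteq> carr (und C)" using that by simp
    obtain D j where "good C D j" "{c} \<subseteq> fn j ` carr (und D)"
      by (rule good_exists [OF C small_countable c]) simp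
    then show ?thesis by blast
  qed
  define g0 where "g0 c = (SOME v. \<exists>D j n. good C D j \<and> n \<in> carr (und D) \<and> fn j n = c \<and> v = fn (bang_in M D (fn (f \<odot> j))) n)" for c
  have g0: "g0 (fn j n) = fn (bang_in M D (fn (f \<odot> j))) n" if j: "good C D j" and n: "n \<in> carr (und D)" for D j n
    unfolding g0_def
  proof (rule some_equality)
    show "\<exists>D' j' n'. good C D' j' \<and> n' \<in> carr (und D') \<and> fn j' n' = fn j n \<and>
        fn (bang_in M D (fn (f \<odot> j))) n = fn (bang_in M D' (fn (f \<odot> j'))) n'" using j n by blast
    fix v assume "\<exists>D' j' n'. good C D' j' \<and> n' \<in> carr (und D') \<and> fn j' n' = fn j n \<and> v = fn (bang_in M D' (fn (f \<odot> j'))) n'"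
    then show "v = fn (bang_in M D (fn (f \<odot> j))) n" using wd j n by blast
  qed
  interpret C: sigma_monoid "und C" by simp
  have "linear_map (und C) (bang0 M) (\<lambda>c\<in>carr (und C). g0 c)"
  proof (rule linear_map_restrictI)
    show "g0 c \<in> carr (bang0 M)" if c: "c \<in> carr (und C)" for c
    proof -
      obtain D j n where j: "good C D j" "n \<in> carr (und D)" "fn j n = c" using ex [OF c] by blast
      then have "g0 c = fn (bang_in M D (fn (f \<odot> j))) n" using g0 by blast
      then show ?thesis using arr_bang_in [OF ov [OF j(1)]] j by (simp add: arr_closed)
    qed
    show "g0 (zer (und C)) = zer (bang0 M)"
    proof -
      obtain D j n where j: "good C D j" "n \<in> carr (und D)" "fn j n = zer (und C)" using ex [OF C.zer_closed] by blast
      have "fn j (zer (und D)) = zer (und C)" using zer_arr [OF goodD(5) [OF j(1)]] goodD [OF j(1)] by simp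
      then have "g0 (zer (und C)) = fn (bang_in M D (fn (f \<odot> j))) (zer (und D))"
        using g0 [OF j(1), of "zer (und D)"] sigma_monoid.zer_closed [OF comonoid_dataD(1) [OF goodD(2) [OF j(1)]]] by simp
      then show ?thesis using zer_arr [OF arr_bang_in [OF ov [OF j(1)]]] by simp
    qed
    fix X c assume X: "sm (und C) X = Some c"
    \<comment> \<open>All summands and their sum are put into one small subcomonoid. Its embedding
      reflects the sum, and on its image \<open>g0\<close> is given by the linear map
      \<open>bang_in\<close>.\<close>
    have "small (insert c (range X))" by (rule small_countable) simp
    moreover have "insert c (range X) \<subseteq> carr (und C)" using C.sm_carr [OF X] by auto
    ultimately obtain D j where j: "good C D j" "insert c (range X) \<subseteq> fn j ` carr (und D)"
      by (rule good_exists [OF C])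
    note D = goodD [OF j(1)]
    have "\<forall>i. \<exists>n. n \<in> carr (und D) \<and> X i = fn j n" using j(2) by blast
    then obtain n where n: "\<And>i. n i \<in> carr (und D)" "\<And>i. X i = fn j (n i)" by metis
    obtain m where m: "sm (und D) n = Some m" "fn j m = c" "m \<in> carr (und D)"
      using emb_sm [OF D(4), of n c] n X D by (metis (no_types, lifting) ext)
    have "sm (bang0 M) (\<lambda>i. fn (bang_in M D (fn (f \<odot> j))) (n i)) = Some (fn (bang_in M D (fn (f \<odot> j))) m)"
      using sm_arr [OF arr_bang_in [OF ov [OF j(1)]], of n m] m(1) by simp
    then show "sm (bang0 M) (\<lambda>i. g0 (X i)) = Some (g0 c)"
      using g0 [OF j(1)] n m(1,3) unfolding m(2) [symmetric] by simp
  qed simp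
  then have g: "arr \<lparr>src = und C, tgt = bang0 M, fn = (\<lambda>c\<in>carr (und C). g0 c)\<rparr>" by (intro arr_mk) simp_all
  define g where "g = \<lparr>src = und C, tgt = bang0 M, fn = (\<lambda>c\<in>carr (und C). g0 c)\<rparr>"
  have g [simp]: "arr g" "src g = und C" "tgt g = bang0 M" using g by (simp_all add: g_def)
  have gj: "g \<odot> j = bang_in M D (fn (f \<odot> j))" if j: "good C D j" for D j
  proof (rule arr_eqI)
    note D = goodD [OF j]
    show "arr (g \<odot> j)" "arr (bang_in M D (fn (f \<odot> j)))" using D ov [OF j] by simp_all
    fix n assume "n \<in> carr (src (g \<odot> j))"
    then have n: "n \<in> carr (und D)" using D by simp
    then have "fn j n \<in> carr (und C)" using D by (simp add: arr_closed)
    then show "fn (g \<odot> j) n = fn (bang_in M D (fn (f \<odot> j))) n"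
      using n D g0 [OF j n] by (simp add: fn_comp) (simp add: g_def)
  qed (use goodD [OF j] in simp_all)
  have "comult B \<odot> g = (g \<otimes>\<^sub>m g) \<odot> comult C"
  proof (rule good_ext [OF C])
    fix D j assume j: "good C D j"
    note D [simp] = goodD [OF j]
    note o [simp] = ov [OF j]
    have "(comult B \<odot> g) \<odot> j = comult B \<odot> (g \<odot> j)" by (rule comp_assoc) simp_all
    also have "\<dots> = ((g \<odot> j) \<otimes>\<^sub>m (g \<odot> j)) \<odot> comult D"
      unfolding gj [OF j] by (rule comult_in [OF o])
    also have "\<dots> = ((g \<otimes>\<^sub>m g) \<odot> comult C) \<odot> j"
      by (simp add: comp_assoc CHom_comult [OF D(2) dC D(3)] tmap_comp_comp)
    finally show "(comult B \<odot> g) \<odot> j = ((g \<otimes>\<^sub>m g) \<odot> comult C) \<odot> j" .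
  qed simp_all
  moreover have "counit B \<odot> g = counit C"
  proof (rule good_ext [OF C])
    fix D j assume j: "good C D j"
    note D [simp] = goodD [OF j]
    have "(counit B \<odot> g) \<odot> j = counit B \<odot> (g \<odot> j)" by (rule comp_assoc) simp_all
    then show "(counit B \<odot> g) \<odot> j = counit C \<odot> j"
      using gj [OF j] counit_in [OF ov [OF j]] CHom_counit [OF D(2) dC D(3)] by simp
  qed simp_all
  ultimately have "g \<in> CHom C B" by (simp add: CHom_iff)
  moreover have "d \<odot> g = f"
  proof (rule good_ext [OF C])
    fix D j assume j: "good C D j"
    note D [simp] = goodD [OF j]
    have "(d \<odot> g) \<odot> j = d \<odot> (g \<odot> j)" by (rule comp_assoc) simp_all
    also have "\<dots> = \<lparr>src = und D, tgt = M, fn = fn (f \<odot> j)\<rparr>"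
      unfolding gj [OF j] by (rule d_in [OF ov [OF j]])
    also have "\<dots> = f \<odot> j" using arrow_eta [of "f \<odot> j"] by simp
    finally show "(d \<odot> g) \<odot> j = f \<odot> j" .
  qed simp_all
  ultimately show thesis using gj by (rule that)
qed

text \<open>The mediating endomorphism of \<open>B\<close> over \<open>d\<close> is the identity, since by gluing it fixes every
  generator; factoring through small subcomonoids of \<open>B\<close> then determines all morphisms into \<open>B\<close>.\<close>

lemma small_CHom_eq:
  assumes D: "cocomm_comonoid D" and k: "k \<in> CHom D B"
  shows "k = bang_in M D (fn (d \<odot> k))"
proof -
  note B = cocomm_bang
  obtain g where g: "g \<in> CHom B B" "d \<odot> g = d" "\<And>E j. good B E j \<Longrightarrow> g \<odot> j = bang_in M E (fn (d \<odot> j))"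
    by (rule bang_mediating [OF B, of d]) simp_all
  note [simp] = CHomD [OF data data g(1)]
  have *: "g \<odot> k = bang_in M D (fn (d \<odot> k))" if D: "cocomm_comonoid D" and k: "k \<in> CHom D B" for D k
  proof -
    note dD [simp] = cocomm_comonoid_data [OF D]
    note [simp] = CHomD [OF dD data k]
    have "small (fn k ` carr (und D))" by (intro small_image small_subset [OF small_UNIV]) auto
    moreover have "fn k ` carr (und D) \<subseteq> carr (und B)" by (auto simp: arr_closed)
    ultimately obtain E j where j: "good B E j" "fn k ` carr (und D) \<subseteq> fn j ` carr (und E)"
      by (rule good_exists [OF B])
    have E [simp]: "cocomm_comonoid E" "comonoid_data E" and jC: "j \<in> CHom E B" using j(1) by (auto simp: good_def)
    note [simp] = CHomD [OF E(2) data jC]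
    obtain k' where k': "k' \<in> CHom D E" "j \<odot> k' = k" by (rule good_factor [OF B j(1) D k j(2)])
    note [simp] = CHomD [OF dD E(2) k'(1)]
    have "g \<odot> k = (g \<odot> j) \<odot> k'" unfolding k'(2) [symmetric] by (rule comp_assoc [symmetric]) simp_all
    also have "\<dots> = bang_in M E (fn (d \<odot> j)) \<odot> k'" by (simp add: g(3) [OF j(1)])
    also have "\<dots> = bang_in M D (fn ((d \<odot> j) \<odot> k'))" by (rule bang_in_factor [OF D E(1) k'(1)]) simp_all
    also have "(d \<odot> j) \<odot> k' = d \<odot> k" unfolding k'(2) [symmetric] by (rule comp_assoc) simp_all
    finally show ?thesis .
  qed
  have "g = ident (bang0 M)"
  proof (rule bang_ext [of g M])
    fix D f assume o: "over M D f"
    show "g \<odot> bang_in M D f = ident (bang0 M) \<odot> bang_in M D f"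
      using * [OF overD(1) [OF o] bang_in_CHom [OF o]] d_in [OF o] o by simp
  qed simp_all
  then show ?thesis
    using * [OF D k] CHomD [OF cocomm_comonoid_data [OF D] data k] by simp
qed

text \<open>Existence is \<open>bang_mediating\<close>. For uniqueness, two morphisms are compared
  on the small subcomonoids of \<open>C\<close>, where \<open>small_CHom_eq\<close> recovers a
  morphism from its composite with \<open>d\<close>.\<close>

lemma cofree_bang: "cofree TYPE('c) M B d"
  unfolding cofree_def
proof (intro conjI allI impI ballI)
  show "cocomm_comonoid B" by (rule cocomm_bang)
  show "d \<in> Hom (und B) M" by (simp add: Hom_arr)
  fix C :: "'c comonoid" and f assume C: "cocomm_comonoid C" and "f \<in> Hom (und C) M"
  note dC [simp] = cocomm_comonoid_data [OF C]
  from \<open>f \<in> Hom (und C) M\<close> have f: "arr f" "src f = und C" "tgt f = M" by (simp_all add: Hom_arr)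
  obtain g where g: "g \<in> CHom C B" "d \<odot> g = f" "\<And>D j. good C D j \<Longrightarrow> g \<odot> j = bang_in M D (fn (f \<odot> j))"
    by (rule bang_mediating [OF C f]) (rule that)
  show "\<exists>!g. g \<in> CHom C B \<and> d \<odot> g = f"
  proof (rule ex1I [of _ g])
    show "g \<in> CHom C B \<and> d \<odot> g = f" using g by simp
    fix g' assume g': "g' \<in> CHom C B \<and> d \<odot> g' = f"
    note [simp] = CHomD [OF dC data g(1)] CHomD [OF dC data conjunct1 [OF g']]
    show "g' = g"
    proof (rule good_ext [OF C])
      fix D j assume j: "good C D j"
      have D: "cocomm_comonoid D" and jC: "j \<in> CHom D C" using j by (auto simp: good_def)
      note dD [simp] = cocomm_comonoid_data [OF D]
      note [simp] = CHomD [OF dD dC jC]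
      have "g' \<odot> j \<in> CHom D B" by (rule comp_CHom [OF dD dC data jC]) (use g' in simp)
      then have "g' \<odot> j = bang_in M D (fn (d \<odot> (g' \<odot> j)))" by (rule small_CHom_eq [OF D])
      also have "d \<odot> (g' \<odot> j) = f \<odot> j" using comp_assoc [of j g' d] g' by simp
      finally show "g' \<odot> j = g \<odot> j" using g(3) [OF j] by simp
    qed simp_all
  qed
qed

end

section \<open>The chosen cofree comonoid and the adjunction\<close>

lemma cofreeD:
  assumes "cofree TYPE('c) M B e" and "cocomm_comonoid (C :: 'c comonoid)"
    and M: "sigma_monoid M" and f: "arr f" "src f = und C" "tgt f = M"
  shows "\<exists>!g. g \<in> CHom C B \<and> e \<odot> g = f"
  using assms by (simp add: cofree_def Hom_arr)

text \<open>\<open>B\<close> itself lives on \<open>bangt\<close>, so the restricted universal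
  property of the chosen comonoid already provides the comparison \<open>\<psi>\<close>.
  Universality over all types is then transported along \<open>\<phi>\<close> and
  \<open>\<psi>\<close>.\<close>

lemma cofree_bang_choice:
  fixes M :: "'m smon"
  assumes M: "sigma_monoid M"
  shows "cofree TYPE('c) M (bang M) (der M)"
proof -
  obtain B d where "bang_comonoid M B d" using bang_comonoid_exists [OF M] .
  then interpret bang_comonoid M B d .
  have same: "cofree TYPE('m bangt) M (bang M) (der M)"
    unfolding bang_def der_def bang_choice_def
    by (rule someI [of "\<lambda>p. cofree TYPE('m bangt) M (fst p) (snd p)" "(B, d)"]) (simp add: cofree_bang)
  then have bang: "cocomm_comonoid (bang M)" and "der M \<in> Hom (und (bang M)) M" by (auto simp: cofree_def)
  note dB [simp] = cocomm_comonoid_data [OF bang]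
  have der [simp]: "arr (der M)" "src (der M) = und (bang M)" "tgt (der M) = M"
    using \<open>der M \<in> Hom (und (bang M)) M\<close> by (simp_all add: Hom_arr)
  obtain \<phi> where \<phi>: "\<phi> \<in> CHom (bang M) B" "d \<odot> \<phi> = der M"
    using cofreeD [OF cofree_bang bang M der] by blast
  obtain \<psi> where \<psi>: "\<psi> \<in> CHom B (bang M)" "der M \<odot> \<psi> = d"
    using cofreeD [OF same cocomm_bang M d(1) _ d(3)] by auto
  note [simp] = CHomD [OF dB data \<phi>(1)] CHomD [OF data dB \<psi>(1)]
  have "der M \<odot> (\<psi> \<odot> \<phi>) = der M" using comp_assoc [of \<phi> \<psi> "der M"] \<phi> \<psi> by simp
  moreover have "\<psi> \<odot> \<phi> \<in> CHom (bang M) (bang M)" by (rule comp_CHom [OF dB data dB \<phi>(1) \<psi>(1)])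
  moreover have "der M \<odot> ident (und (bang M)) = der M" by simp
  moreover have "ident (und (bang M)) \<in> CHom (bang M) (bang M)" by (rule ident_CHom [OF dB])
  ultimately have \<psi>\<phi>: "\<psi> \<odot> \<phi> = ident (und (bang M))"
    using cofreeD [OF same bang M der] by blast
  show ?thesis
    unfolding cofree_def
  proof (intro conjI allI impI ballI)
    show "cocomm_comonoid (bang M)" "der M \<in> Hom (und (bang M)) M" by fact+
    fix C :: "'c comonoid" and f assume C: "cocomm_comonoid C" and "f \<in> Hom (und C) M"
    note dC [simp] = cocomm_comonoid_data [OF C]
    have f: "arr f" "src f = und C" "tgt f = M" using \<open>f \<in> Hom (und C) M\<close> by (simp_all add: Hom_arr)
    note univ = cofreeD [OF cofree_bang C M f]
    obtain g where g: "g \<in> CHom C B" "d \<odot> g = f" using univ by blast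
    note [simp] = CHomD [OF dC data g(1)]
    show "\<exists>!g. g \<in> CHom C (bang M) \<and> der M \<odot> g = f"
    proof (rule ex1I [of _ "\<psi> \<odot> g"])
      have "der M \<odot> (\<psi> \<odot> g) = f" using comp_assoc [of g \<psi> "der M"] \<psi> g by simp
      then show "\<psi> \<odot> g \<in> CHom C (bang M) \<and> der M \<odot> (\<psi> \<odot> g) = f"
        using comp_CHom [OF dC data dB g(1) \<psi>(1)] by simp
      fix k assume k: "k \<in> CHom C (bang M) \<and> der M \<odot> k = f"
      note [simp] = CHomD [OF dC dB conjunct1 [OF k]]
      have "\<phi> \<odot> k \<in> CHom C B" using comp_CHom [OF dC dB data conjunct1 [OF k] \<phi>(1)] .
      moreover have "d \<odot> (\<phi> \<odot> k) = f" using comp_assoc [of k \<phi> d] \<phi> k by simp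
      ultimately have "\<phi> \<odot> k = g" using univ g by blast
      then have "\<psi> \<odot> g = (\<psi> \<odot> \<phi>) \<odot> k" using comp_assoc [of k \<phi> \<psi>] by simp
      then show "k = \<psi> \<odot> g" using \<psi>\<phi> by simp
    qed
  qed
qed

lemma bang_simps [simp]:
  assumes "sigma_monoid M"
  shows "cocomm_comonoid (bang M)" "arr (der M)" "src (der M) = und (bang M)" "tgt (der M) = M"
proof -
  have *: "cocomm_comonoid (bang M)" "der M \<in> Hom (und (bang M)) M"
    using cofree_bang_choice [OF assms] unfolding cofree_def by blast+
  then show "cocomm_comonoid (bang M)" "arr (der M)" "src (der M) = und (bang M)" "tgt (der M) = M"
    using assms cocomm_comonoid_data [OF *(1)] by (simp_all add: Hom_arr)
qed

lemma bang_univ: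
  assumes "sigma_monoid M" "cocomm_comonoid C" "arr f" "src f = und C" "tgt f = M"
  shows "\<exists>!g. g \<in> CHom C (bang M) \<and> der M \<odot> g = f"
  using cofreeD [OF cofree_bang_choice [OF assms(1)] assms(2,1,3-5)] .

lemma bang_eqI:
  assumes "sigma_monoid M" "cocomm_comonoid C" "g \<in> CHom C (bang M)" "h \<in> CHom C (bang M)" "der M \<odot> g = der M \<odot> h"
  shows "g = h"
proof -
  note d = cocomm_comonoid_data [OF assms(2)] cocomm_comonoid_data [OF bang_simps(1) [OF assms(1)]]
  note [simp] = assms(1) CHomD [OF d assms(3)]
  have "\<exists>!k. k \<in> CHom C (bang M) \<and> der M \<odot> k = der M \<odot> g" by (rule bang_univ [OF assms(1,2)]) simp_all
  then show ?thesis using assms(3-5) by metis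
qed

lemma bang_map_props:
  assumes f: "arr f" "src f = M" "tgt f = M'"
  shows "bang_map f \<in> CHom (bang M) (bang M')" "der M' \<odot> bang_map f = f \<odot> der M"
proof -
  have [simp]: "sigma_monoid M" "sigma_monoid M'" using arrD(1,2) [OF f(1)] f by simp_all
  have "\<exists>!g. g \<in> CHom (bang M) (bang M') \<and> der M' \<odot> g = f \<odot> der M"
    by (rule bang_univ) (use f in simp_all)
  from theI' [OF this] show "bang_map f \<in> CHom (bang M) (bang M')" "der M' \<odot> bang_map f = f \<odot> der M"
    using f by (auto simp: bang_map_def)
qed

lemma bang_adjunction:
  assumes M: "sigma_monoid M" and M': "sigma_monoid M'" and M'': "sigma_monoid M''"
    and C: "cocomm_comonoid C" and C': "cocomm_comonoid C'"
  shows "forgetful_bang_adjunction C C' M M' M''"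
  unfolding forgetful_bang_adjunction_def
proof (intro conjI ballI)
  note [simp] = M M' M'' cocomm_comonoid_data [OF C] cocomm_comonoid_data [OF C']
  have b [simp]: "comonoid_data (bang M)" "comonoid_data (bang M')" "comonoid_data (bang M'')"
    by (intro cocomm_comonoid_data bang_simps M M' M'')+
  show "cocomm_comonoid (bang M)" by simp
  show "bang_map f \<in> CHom (bang M) (bang M')" if "f \<in> Hom M M'" for f
    using that bang_map_props(1) [of f M M'] by (simp add: Hom_arr)
  show "bang_map (ident M) = ident (und (bang M))"
    using bang_map_props [of "ident M" M M] ident_CHom [OF b(1)] by (intro bang_eqI [OF M bang_simps(1) [OF M]]) simp_all
  show "bang_map (f' \<odot> f) = bang_map f' \<odot> bang_map f" if "f \<in> Hom M M'" "f' \<in> Hom M' M''" for f f'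
  proof (rule bang_eqI [OF M'' bang_simps(1) [OF M]])
    have f: "arr f" "src f = M" "tgt f = M'" and f': "arr f'" "src f' = M'" "tgt f' = M''"
      using that by (simp_all add: Hom_arr)
    note p = bang_map_props [OF f] and p' = bang_map_props [OF f']
    note [simp] = CHomD [OF b(1,2) p(1)] CHomD [OF b(2,3) p'(1)]
    show "bang_map (f' \<odot> f) \<in> CHom (bang M) (bang M'')"
      by (rule bang_map_props) (use f f' in simp_all)
    show "bang_map f' \<odot> bang_map f \<in> CHom (bang M) (bang M'')"
      by (rule comp_CHom [OF b p(1) p'(1)])
    have "der M'' \<odot> bang_map (f' \<odot> f) = (f' \<odot> f) \<odot> der M"
      by (rule bang_map_props) (use f f' in simp_all)
    also have "\<dots> = f' \<odot> (der M' \<odot> bang_map f)" unfolding p(2) by (rule comp_assoc) (use f f' in simp_all)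
    also have "\<dots> = (der M'' \<odot> bang_map f') \<odot> bang_map f" unfolding p'(2) by (rule comp_assoc [symmetric]) (use f f' in simp_all)
    also have "\<dots> = der M'' \<odot> (bang_map f' \<odot> bang_map f)" by (rule comp_assoc) simp_all
    finally show "der M'' \<odot> bang_map (f' \<odot> f) = der M'' \<odot> (bang_map f' \<odot> bang_map f)" .
  qed
  show "bij_betw (\<lambda>g. der M \<odot> g) (CHom C (bang M)) (Hom (und C) M)"
    unfolding bij_betw_def
  proof (intro conjI inj_onI equalityI subsetI)
    show "g = h" if "g \<in> CHom C (bang M)" "h \<in> CHom C (bang M)" "der M \<odot> g = der M \<odot> h" for g h
      by (rule bang_eqI [OF M C that])
    show "f \<in> Hom (und C) M" if "f \<in> (\<lambda>g. der M \<odot> g) ` CHom C (bang M)" for f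
      using that by (auto simp: Hom_arr CHom_iff)
    show "f \<in> (\<lambda>g. der M \<odot> g) ` CHom C (bang M)" if "f \<in> Hom (und C) M" for f
    proof -
      have "arr f" "src f = und C" "tgt f = M" using that by (simp_all add: Hom_arr)
      then obtain g where "g \<in> CHom C (bang M)" "der M \<odot> g = f" using bang_univ [OF M C] by blast
      then show ?thesis by blast
    qed
  qed
  show "der M' \<odot> (bang_map v \<odot> g \<odot> u) = v \<odot> (der M \<odot> g) \<odot> u"
    if "u \<in> CHom C' C" "g \<in> CHom C (bang M)" "v \<in> Hom M M'" for u g v
  proof -
    have v: "arr v" "src v = M" "tgt v = M'" using that by (simp_all add: Hom_arr)
    note p = bang_map_props [OF v]
    note [simp] = v CHomD [OF b(1,2) p(1)] CHomD [OF _ _ that(1)] CHomD [OF _ _ that(2)]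
    have "der M' \<odot> (bang_map v \<odot> (g \<odot> u)) = (der M' \<odot> bang_map v) \<odot> (g \<odot> u)"
      by (rule comp_assoc [symmetric]) simp_all
    also have "\<dots> = v \<odot> (der M \<odot> (g \<odot> u))" unfolding p(2) by (rule comp_assoc) simp_all
    also have "der M \<odot> (g \<odot> u) = (der M \<odot> g) \<odot> u" by (rule comp_assoc [symmetric]) simp_all
    finally show ?thesis .
  qed
qed

theorem theorem3p6:
  fixes K :: "'k smon"
    and L :: "'l smon" and L' :: "'l1 smon"
    and M :: "'m smon" and M' :: "'m1 smon" and M'' :: "'m2 smon"
    and N :: "'n smon" and N' :: "'n1 smon" and N'' :: "'n2 smon"
    and C :: "'c comonoid" and C' :: "'c1 comonoid" and C'' :: "'c2 comonoid"
  assumes "sigma_monoid K"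
    and "sigma_monoid L" and "sigma_monoid L'"
    and "sigma_monoid M" and "sigma_monoid M'" and "sigma_monoid M''"
    and "sigma_monoid N" and "sigma_monoid N'" and "sigma_monoid N''"
    and "cocomm_comonoid C" and "cocomm_comonoid C'" and "cocomm_comonoid C''"
  shows "category_laws K L M N \<and>
    sigma_monoid unitI \<and>
    represents_bilinear TYPE('l) M N (M \<otimes> N) (pure_tensor M N) \<and>
    tensor_bifunctor M M' M'' N N' N'' \<and>
    structure_isos L M N L' M' N' \<and>
    coherence K L M N \<and>
    tensor_hom_adjunction L L' M N N' N'' \<and>
    comonoid_category_laws C C' C'' \<and>
    forgetful_bang_adjunction C C' M M' M''"
  using assms
  by (intro conjI category_SMon sigma_monoid_unitI represents_tensor bifunctor monoidal_structure
      coherent hom_adjunction comonoid_category bang_adjunction)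

end
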